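(* Let $k \geq 2$ be an integer and let $M$ be a binary gammoid with $M \in \mathcal{G}_k$. Then $M$ contains a minor $P$ for which one of the following holds. (i) $P$ is isomorphic to a one-element extension of some minimal minor of the class $\mathcal{G}_{k-1}$. (ii) For some $i \in \{2,3,4\}$, $P$ is (up to isomorphism) $M(Q_i)$ or an extension of $M(Q_i)$ by not more than $k$ elements.
   Context: A binary gammoid is a gammoid that is representable over $GF(2)$. $M(G)$ denotes the cycle matroid of a graph $G$ (loops and parallel edges allowed). Splitting: let $B$ be a binary matroid, $H \subseteq E(B)$, and let $A$ be a matrix over $GF(2)$ representing $B$. Let $A_H$ be obtained from $A$ by adjoining a new last row whose entries are $1$ in the columns corresponding to the elements of $H$ and $0$ elsewhere. The splitting matroid $B_H$ is the vector matroid of $A_H$ (on the same ground set as $B$). For an integer $k\ge 1$, $\mathcal{G}_k$ denotes the class of binary gammoids $M$ for which there is a set $H \subseteq E(M)$ with $|H| = k$ such that $M_H$ is not a binary gammoid. A minimal minor of the class $\mathcal{G}_k$ is a member of $\mathcal{G}_k$ none of whose proper minors belongs to $\mathcal{G}_k$. A matroid $N$ is an extension of a matroid $L$ by $m$ elements if there is $X \subseteq E(N)$ with $|X| = m$ and $N \backslash X = L$; a one-element extension is the case $m=1$. Graphs (each on three vertices $u,v,w$ with six edges): $Q_2$ has two parallel edges joining $u$ and $v$, two parallel edges joining $u$ and $w$, one edge joining $v$ and $w$, and one loop at $u$. $Q_3$ has two parallel edges joining $u$ and $v$, two parallel edges joining $u$ and $w$, one edge joining $v$ and $w$, and one loop at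 $w$. $Q_4$ has exactly two parallel edges joining each pair of the three vertices and no loops. *)

theory Defs
  imports "HOL-Library.Z2" "Graph_Theory.Graph_Theory"
begin

section \<open>Matroids\<close>

record 'a pre_matroid =
  ground :: "'a set"
  indeps :: "'a set set"

locale matroid =
  fixes M :: "'a pre_matroid"
  assumes finite_ground: "finite (ground M)"
    and indeps_subset: "X \<in> indeps M \<Longrightarrow> X \<subseteq> ground M"
    and empty_indep: "{} \<in> indeps M"
    and indep_mono: "Y \<in> indeps M \<Longrightarrow> X \<subseteq> Y \<Longrightarrow> X \<in> indeps M"
    and augment: "X \<in> indeps M \<Longrightarrow> Y \<in> indeps M \<Longrightarrow> card X < card Y \<Longrightarrow>
      \<exists>y \<in> Y - X. insert y X \<in> indeps M"

definition matroid_iso :: "'a pre_matroid \<Rightarrow> 'b pre_matroid \<Rightarrow> bool" where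
  "matroid_iso M N \<longleftrightarrow> (\<exists>f. bij_betw f (ground M) (ground N) \<and>
     (\<forall>X \<subseteq> ground M. X \<in> indeps M \<longleftrightarrow> f ` X \<in> indeps N))"

definition deletion :: "'a pre_matroid \<Rightarrow> 'a set \<Rightarrow> 'a pre_matroid" where
  "deletion M D = \<lparr>ground = ground M - D, indeps = {X \<in> indeps M. X \<inter> D = {}}\<rparr>"

definition basis_of :: "'a pre_matroid \<Rightarrow> 'a set \<Rightarrow> 'a set \<Rightarrow> bool" where
  "basis_of M X B \<longleftrightarrow> B \<in> indeps M \<and> B \<subseteq> X \<and>
     (\<forall>Y \<in> indeps M. B \<subseteq> Y \<and> Y \<subseteq> X \<longrightarrow> Y = B)"

definition contraction :: "'a pre_matroid \<Rightarrow> 'a set \<Rightarrow> 'a pre_matroid" where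
  "contraction M C = \<lparr>ground = ground M - C,
     indeps = {X. X \<subseteq> ground M - C \<and> (\<exists>B. basis_of M C B \<and> X \<union> B \<in> indeps M)}\<rparr>"

definition minor :: "'a pre_matroid \<Rightarrow> 'a pre_matroid \<Rightarrow> bool" where
  "minor N M \<longleftrightarrow> (\<exists>C D. C \<subseteq> ground M \<and> D \<subseteq> ground M \<and> C \<inter> D = {} \<and>
     N = deletion (contraction M C) D)"

definition extension_by :: "nat \<Rightarrow> 'a pre_matroid \<Rightarrow> 'a pre_matroid \<Rightarrow> bool" where
  "extension_by m N L \<longleftrightarrow> matroid N \<and> (\<exists>X \<subseteq> ground N. card X = m \<and> deletion N X = L)"


section \<open>Binary matroids and splitting\<close>

text \<open>
  A matrix over GF(2) with \<open>r\<close> rows whose columns are labelled by the ground set is a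
  function \<open>A\<close>, with \<open>A i e\<close> the entry in row \<open>i < r\<close> and column \<open>e\<close>. Independence is that of
  the labelled family of columns, so two equal columns with different labels are dependent.
\<close>

definition columns_indep :: "nat \<Rightarrow> (nat \<Rightarrow> 'a \<Rightarrow> bit) \<Rightarrow> 'a set \<Rightarrow> bool" where
  "columns_indep r A X \<longleftrightarrow>
     (\<forall>c. (\<forall>i<r. (\<Sum>e\<in>X. c e * A i e) = 0) \<longrightarrow> (\<forall>e\<in>X. c e = 0))"

definition vector_matroid :: "'a set \<Rightarrow> nat \<Rightarrow> (nat \<Rightarrow> 'a \<Rightarrow> bit) \<Rightarrow> 'a pre_matroid" where
  "vector_matroid E r A = \<lparr>ground = E, indeps = {X. X \<subseteq> E \<and> columns_indep r A X}\<rparr>"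

definition represents :: "nat \<Rightarrow> (nat \<Rightarrow> 'a \<Rightarrow> bit) \<Rightarrow> 'a pre_matroid \<Rightarrow> bool" where
  "represents r A M \<longleftrightarrow> M = vector_matroid (ground M) r A"

definition binary :: "'a pre_matroid \<Rightarrow> bool" where
  "binary M \<longleftrightarrow> matroid M \<and> (\<exists>r A. represents r A M)"

definition adjoin_row :: "nat \<Rightarrow> (nat \<Rightarrow> 'a \<Rightarrow> bit) \<Rightarrow> 'a set \<Rightarrow> (nat \<Rightarrow> 'a \<Rightarrow> bit)" where
  "adjoin_row r A H = A(r := (\<lambda>e. if e \<in> H then 1 else 0))"

text \<open>
  The choice of the representing matrix is immaterial, see \<open>splitting_eq\<close> below.
\<close>

definition splitting :: "'a pre_matroid \<Rightarrow> 'a set \<Rightarrow> 'a pre_matroid" where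
  "splitting M H = (let (r, A) = (SOME (r, A). represents r A M)
     in vector_matroid (ground M) (Suc r) (adjoin_row r A H))"

definition null_set :: "nat \<Rightarrow> (nat \<Rightarrow> 'a \<Rightarrow> bit) \<Rightarrow> 'a set \<Rightarrow> bool" where
  "null_set r A Y \<longleftrightarrow> (\<forall>i<r. (\<Sum>e\<in>Y. A i e) = 0)"

lemma columns_indep_iff_null_set:
  assumes "finite X"
  shows "columns_indep r A X \<longleftrightarrow> (\<forall>Y \<subseteq> X. null_set r A Y \<longrightarrow> Y = {})"
proof -
  have ind: "(\<Sum>e\<in>X. (if e \<in> Y then 1 else 0) * A i e) = (\<Sum>e\<in>Y. A i e)"
    if "Y \<subseteq> X" for Y i
  proof -
    have "(\<Sum>e\<in>X. (if e \<in> Y then 1 else 0) * A i e) = (\<Sum>e\<in>X. if e \<in> Y then A i e else 0)"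
      by (rule sum.cong) auto
    also have "\<dots> = (\<Sum>e\<in>X \<inter> Y. A i e)"
      using assms by (simp add: sum.inter_restrict)
    finally show ?thesis using that by (simp add: Int_absorb1)
  qed
  show ?thesis
  proof (intro iffI allI impI)
    fix Y assume *: "columns_indep r A X" "Y \<subseteq> X" "null_set r A Y"
    then have "\<forall>e\<in>X. (if e \<in> Y then 1 else 0) = (0::bit)"
      using ind[of Y] unfolding columns_indep_def null_set_def by presburger
    with * show "Y = {}" by (auto split: if_splits)
  next
    assume *: "\<forall>Y\<subseteq>X. null_set r A Y \<longrightarrow> Y = {}"
    show "columns_indep r A X" unfolding columns_indep_def
    proof (intro allI impI)
      fix c :: "'a \<Rightarrow> bit" assume c: "\<forall>i<r. (\<Sum>e\<in>X. c e * A i e) = 0"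
      define Y where "Y = {e \<in> X. c e = 1}"
      have "(\<Sum>e\<in>X. c e * A i e) = (\<Sum>e\<in>Y. A i e)" for i
      proof -
        have "(\<Sum>e\<in>X. c e * A i e) = (\<Sum>e\<in>X. (if e \<in> Y then 1 else 0) * A i e)"
          by (rule sum.cong) (auto simp: Y_def)
        then show ?thesis using ind[of Y i] by (simp add: Y_def)
      qed
      with c have "null_set r A Y" by (simp add: null_set_def)
      moreover have "Y \<subseteq> X" by (simp add: Y_def)
      ultimately have "Y = {}" using * by blast
      then show "\<forall>e\<in>X. c e = 0" by (auto simp: Y_def)
    qed
  qed
qed

lemma null_set_Diff:
  assumes "finite Y" "Z \<subseteq> Y" "null_set r A Z"
  shows "null_set r A (Y - Z) \<longleftrightarrow> null_set r A Y"
proof -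
  have "(\<Sum>e\<in>Y. A i e) = (\<Sum>e\<in>Y - Z. A i e) + (\<Sum>e\<in>Z. A i e)" for i
    using assms(1,2) by (rule sum.subset_diff[rotated])
  with assms(3) show ?thesis by (simp add: null_set_def)
qed

lemma null_set_transfer:
  assumes "finite E" "vector_matroid E r A = vector_matroid E s B"
    and "Y \<subseteq> E" "null_set r A Y"
  shows "null_set s B Y"
  using assms(3,4)
proof (induction "card Y" arbitrary: Y rule: less_induct)
  case less
  have same: "columns_indep r A X \<longleftrightarrow> columns_indep s B X" if "X \<subseteq> E" for X
  proof -
    have "indeps (vector_matroid E r A) = indeps (vector_matroid E s B)"
      using assms(2) by simp
    with that show ?thesis by (auto simp: vector_matroid_def)
  qed
  have fin: "finite X" if "X \<subseteq> E" for X
    using that assms(1) by (rule finite_subset)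
  show ?case
  proof (cases "Y = {}")
    case False
    let ?P = "\<lambda>Z. Z \<subseteq> Y \<and> Z \<noteq> {} \<and> null_set s B Z"
    have iffA: "columns_indep r A X \<longleftrightarrow> (\<forall>Y\<subseteq>X. null_set r A Y \<longrightarrow> Y = {})"
      and iffB: "columns_indep s B X \<longleftrightarrow> (\<forall>Y\<subseteq>X. null_set s B Y \<longrightarrow> Y = {})"
      if "X \<subseteq> E" for X
      using columns_indep_iff_null_set[OF fin[OF that]] by blast+
    have "\<not> columns_indep r A Y"
      using iffA less.prems False by blast
    then have "\<not> columns_indep s B Y"
      using same less.prems by simp
    then have "\<exists>Z. ?P Z"
      using iffB[of Y] less.prems by blast
    then obtain Z0 where "?P Z0" by (rule exE)
    from ex_has_least_nat[of ?P, OF this, of card]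
    obtain Z where Z: "?P Z" and min: "\<And>W. ?P W \<Longrightarrow> card Z \<le> card W"
      by (elim exE conjE) simp
    have ZE: "Z \<subseteq> E" using Z less.prems by blast
    have "\<not> columns_indep s B Z" using iffB[OF ZE] Z by blast
    then have "\<not> columns_indep r A Z" using same[OF ZE] by simp
    then obtain W where W: "W \<subseteq> Z" "null_set r A W" "W \<noteq> {}"
      using iffA[OF ZE] by blast
    have WE: "W \<subseteq> E" using W ZE by blast
    have "\<not> columns_indep r A W" using iffA[OF WE] W by blast
    then have "\<not> columns_indep s B W" using same[OF WE] by simp
    then obtain V where V: "V \<subseteq> W" "null_set s B V" "V \<noteq> {}"
      using iffB[OF WE] by blast
    have "card Z \<le> card V" by (rule min) (use V W Z in auto)
    moreover have "V \<subseteq> Z" using V W by blast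
    ultimately have "V = Z" using fin[OF ZE] by (simp add: card_seteq)
    with V W have "W = Z" by blast
    with W have ZA: "null_set r A Z" by simp
    have finY: "finite Y" using fin less.prems by blast
    have "card (Y - Z) < card Y"
      using Z finY by (intro psubset_card_mono) auto
    moreover have "null_set r A (Y - Z)"
      using null_set_Diff[OF finY _ ZA] Z less.prems by blast
    ultimately have "null_set s B (Y - Z)"
      using less.hyps less.prems by blast
    with Z show ?thesis using null_set_Diff[OF finY] by blast
  qed (simp add: null_set_def)
qed

lemma null_set_adjoin_row:
  "null_set (Suc r) (adjoin_row r A H) Y \<longleftrightarrow>
     null_set r A Y \<and> (\<Sum>e\<in>Y. if e \<in> H then 1 else 0) = (0::bit)"
  by (auto simp: null_set_def adjoin_row_def less_Suc_eq)

lemma splitting_eq: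
  assumes "finite (ground M)" "represents r A M"
  shows "splitting M H = vector_matroid (ground M) (Suc r) (adjoin_row r A H)"
proof -
  obtain s B where sB: "(SOME (r, A). represents r A M) = (s, B)"
    by (cases "SOME (r, A). represents r A M") auto
  have "case (SOME (r, A). represents r A M) of (r, A) \<Rightarrow> represents r A M"
    by (rule someI[of _ "(r, A)"]) (simp add: assms(2))
  with sB have B: "represents s B M" by simp
  with assms(2) have eq: "vector_matroid (ground M) s B = vector_matroid (ground M) r A"
    by (metis represents_def)
  have "null_set s B Y \<longleftrightarrow> null_set r A Y" if "Y \<subseteq> ground M" for Y
    using null_set_transfer[OF assms(1) eq that] null_set_transfer[OF assms(1) eq[symmetric] that]
    by blast
  then have "columns_indep (Suc s) (adjoin_row s B H) X \<longleftrightarrow>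
      columns_indep (Suc r) (adjoin_row r A H) X" if "X \<subseteq> ground M" for X
    using that finite_subset[OF that assms(1)]
    unfolding columns_indep_iff_null_set[OF finite_subset[OF that assms(1)]] null_set_adjoin_row
    by (meson order.trans)
  then show ?thesis
    by (auto simp: splitting_def sB vector_matroid_def)
qed


section \<open>Gammoids\<close>

text \<open>
  \<open>linked_into G X S\<close>: there are \<open>|X|\<close> pairwise vertex-disjoint directed paths in \<open>G\<close>, one
  starting at each vertex of \<open>X\<close>, all ending in \<open>S\<close>. A path may consist of a single vertex.
\<close>

definition linked_into :: "('v, 'b) pre_digraph \<Rightarrow> 'v set \<Rightarrow> 'v set \<Rightarrow> bool" where
  "linked_into G X S \<longleftrightarrow> (\<exists>p.
     (\<forall>x\<in>X. \<exists>s\<in>S. pre_digraph.apath G x (p x) s) \<and>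
     (\<forall>x\<in>X. \<forall>y\<in>X. x \<noteq> y \<longrightarrow>
        set (pre_digraph.awalk_verts G x (p x)) \<inter> set (pre_digraph.awalk_verts G y (p y)) = {}))"

definition gammoid_of :: "('v, 'b) pre_digraph \<Rightarrow> 'v set \<Rightarrow> 'v set \<Rightarrow> 'v pre_matroid" where
  "gammoid_of G S T = \<lparr>ground = T, indeps = {X. X \<subseteq> T \<and> linked_into G X S}\<rparr>"

text \<open>
  Every finite digraph is isomorphic to one whose vertices and arcs are natural numbers, so
  that quantifying over the latter up to isomorphism of matroids covers all finite digraphs.
\<close>

definition gammoid :: "'a pre_matroid \<Rightarrow> bool" where
  "gammoid M \<longleftrightarrow> matroid M \<and> (\<exists>(G :: (nat, nat) pre_digraph) S T.
     fin_digraph G \<and> S \<subseteq> verts G \<and> T \<subseteq> verts G \<and> matroid_iso M (gammoid_of G S T))"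

definition binary_gammoid :: "'a pre_matroid \<Rightarrow> bool" where
  "binary_gammoid M \<longleftrightarrow> gammoid M \<and> binary M"

definition split_class :: "nat \<Rightarrow> 'a pre_matroid set" where
  "split_class k = {M. binary_gammoid M \<and>
     (\<exists>H \<subseteq> ground M. card H = k \<and> \<not> binary_gammoid (splitting M H))}"

definition minimal_minor :: "nat \<Rightarrow> 'a pre_matroid \<Rightarrow> bool" where
  "minimal_minor k L \<longleftrightarrow> L \<in> split_class k \<and>
     (\<forall>N. minor N L \<and> N \<noteq> L \<longrightarrow> N \<notin> split_class k)"


section \<open>Cycle matroids of undirected multigraphs\<close>

text \<open>
  \<open>mends G e\<close> is the set of end vertices of the edge \<open>e\<close>, a singleton if \<open>e\<close> is a loop.
\<close>

record ('v, 'e) multigraph =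
  mverts :: "'v set"
  medges :: "'e set"
  mends :: "'e \<Rightarrow> 'v set"

text \<open>
  The edge sets of cycles: a loop is a cycle with one edge, a pair of parallel edges forms a
  cycle with two edges.
\<close>

definition cycle_edges :: "('v, 'e) multigraph \<Rightarrow> 'e set \<Rightarrow> bool" where
  "cycle_edges G C \<longleftrightarrow> (\<exists>vs es. es \<noteq> [] \<and> length vs = length es \<and> distinct vs \<and> distinct es \<and>
     set vs \<subseteq> mverts G \<and> set es \<subseteq> medges G \<and> C = set es \<and>
     (\<forall>i < length es. mends G (es ! i) = {vs ! i, vs ! (Suc i mod length es)}))"

definition cycle_matroid :: "('v, 'e) multigraph \<Rightarrow> 'e pre_matroid" where
  "cycle_matroid G = \<lparr>ground = medges G,
     indeps = {X. X \<subseteq> medges G \<and> \<not> (\<exists>C \<subseteq> X. cycle_edges G C)}\<rparr>"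

datatype qvertex = Qu | Qv | Qw

definition graph_of_ends :: "qvertex set list \<Rightarrow> (qvertex, nat) multigraph" where
  "graph_of_ends ends = \<lparr>mverts = {Qu, Qv, Qw}, medges = {..<length ends}, mends = (\<lambda>e. ends ! e)\<rparr>"

definition Q2 :: "(qvertex, nat) multigraph" where
  "Q2 = graph_of_ends [{Qu, Qv}, {Qu, Qv}, {Qu, Qw}, {Qu, Qw}, {Qv, Qw}, {Qu}]"

definition Q3 :: "(qvertex, nat) multigraph" where
  "Q3 = graph_of_ends [{Qu, Qv}, {Qu, Qv}, {Qu, Qw}, {Qu, Qw}, {Qv, Qw}, {Qw}]"

definition Q4 :: "(qvertex, nat) multigraph" where
  "Q4 = graph_of_ends [{Qu, Qv}, {Qu, Qv}, {Qu, Qw}, {Qu, Qw}, {Qv, Qw}, {Qv, Qw}]"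

end

theory Submission
  imports Defs
begin

text \<open>
  Splitting undoes a projection. Let the columns of a matrix represent \<open>M\<close> and adjoin the row of
  \<open>H\<close>; if \<open>p\<close> is the unit vector of the new coordinate, then \<open>M\<close> is the projection of \<open>M\<^sub>H\<close> from \<open>p\<close>.
  Projecting commutes with contracting and deleting, so every minor of \<open>M\<^sub>H\<close> projects to the
  minor of \<open>M\<close> on the same elements.

  A binary matroid is a gammoid iff it has no \<open>M(K\<^sub>4)\<close>-minor. If \<open>M\<^sub>H\<close> is not a gammoid, it
  therefore has a minor \<open>M\<^sub>H / C \ D\<close> equal to \<open>M(K\<^sub>4)\<close>, and \<open>M / C \ D\<close> is the projection of
  \<open>M(K\<^sub>4)\<close> from the image of \<open>p\<close>. This image is not zero, since otherwise the gammoid \<open>M\<close> would have an \<open>M(K\<^sub>4)\<close>-minor.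
  So it is one of the seven points of the Fano plane, six of which are the elements of \<open>M(K\<^sub>4)\<close>.
  Projecting from an element makes it a loop and pairs up the two other elements on each of its two
  triangles, which gives \<open>M(Q\<^sub>2)\<close>; projecting from the seventh point pairs up opposite
  edges of \<open>K\<^sub>4\<close>, which gives \<open>M(Q\<^sub>4)\<close>. Either way \<open>M\<close> has a minor as in the second alternative.

  All of this is done with row spaces: a binary matroid is given by a set of subsets of the ground set
  that is closed under symmetric difference, its cocycles. Its cycles are the sets that meet every
  cocycle in an even number of elements, minors are traces of subspaces (\<open>sminor\<close>), and the projection
  becomes the passage to a subspace of codimension one (\<open>K4_hyperplane\<close>).

  The characterization of binary gammoids has two halves. A nonempty binary matroid without
  \<open>M(K\<^sub>4)\<close>-minor has a loop, a coloop, a parallel pair or a series pair (\<open>dirac_binary\<close>); removing it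
  and putting it back shows by induction that the matroid is a gammoid
  (\<open>gammoid_if_no_K4\<close>). For putting it back, gammoids are described by matchings of a bipartite graph
  instead of linkings of a digraph (\<open>linked_into_iff_matched\<close>). Conversely, two matchings can be
  exchanged along alternating paths, which gives bases of a gammoid a symmetric exchange property
  with a fixed injection (\<open>gammoid_exchange\<close>). It is inherited by minors and fails for two
  complementary Hamiltonian paths of \<open>K\<^sub>4\<close> (\<open>no_K4_if_gammoid\<close>).
\<close>

section \<open>Binary spaces of sets\<close>

definition symd :: "'a set \<Rightarrow> 'a set \<Rightarrow> 'a set" (infixl "\<triangle>" 65) where
  "X \<triangle> Y = (X - Y) \<union> (Y - X)"

lemma mem_symd [simp]: "e \<in> X \<triangle> Y \<longleftrightarrow> (e \<in> X) \<noteq> (e \<in> Y)"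
  by (auto simp: symd_def)

definition orth :: "'a set \<Rightarrow> 'a set \<Rightarrow> bool" where
  "orth X Y \<longleftrightarrow> even (card (X \<inter> Y))"

lemma orth_commute: "orth X Y \<longleftrightarrow> orth Y X"
  by (simp add: orth_def Int_commute)

lemma orth_empty [simp]: "orth {} Y" "orth X {}"
  by (simp_all add: orth_def)

lemma orth_insert:
  assumes "finite X" "e \<notin> X"
  shows "orth (insert e X) Y \<longleftrightarrow> (e \<in> Y) \<noteq> orth X Y"
  using assms by (simp add: orth_def Int_insert_left)

lemma orth_pair: "a \<noteq> b \<Longrightarrow> orth {a, b} D \<longleftrightarrow> (a \<in> D \<longleftrightarrow> b \<in> D)"
  by (simp add: orth_insert)

lemma orth_triple:
  assumes "a \<noteq> b" "a \<noteq> c" "b \<noteq> c"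
  shows "orth {a, b, c} D \<longleftrightarrow> (c \<in> D \<longleftrightarrow> (a \<in> D) \<noteq> (b \<in> D))"
  using assms by (auto simp: orth_insert)

lemma orth_quadruple:
  assumes "distinct [a, b, c, d]"
  shows "orth {a, b, c, d} D \<longleftrightarrow> (((a \<in> D) \<noteq> (b \<in> D)) = ((c \<in> D) \<noteq> (d \<in> D)))"
  using assms by (auto simp: orth_insert)

lemma orth_symd:
  assumes "finite Y"
  shows "orth (X1 \<triangle> X2) Y \<longleftrightarrow> (orth X1 Y \<longleftrightarrow> orth X2 Y)"
proof -
  define P Q R where "P = (X1 - X2) \<inter> Y" and "Q = (X2 - X1) \<inter> Y" and "R = X1 \<inter> X2 \<inter> Y"
  have fin: "finite P" "finite Q" "finite R" using assms by (auto simp: P_def Q_def R_def)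
  have "(X1 \<triangle> X2) \<inter> Y = P \<union> Q" "X1 \<inter> Y = P \<union> R" "X2 \<inter> Y = Q \<union> R"
    by (auto simp: P_def Q_def R_def)
  moreover have "card (P \<union> Q) = card P + card Q" "card (P \<union> R) = card P + card R"
    "card (Q \<union> R) = card Q + card R"
    using fin by (auto intro!: card_Un_disjoint simp: P_def Q_def R_def)
  ultimately show ?thesis by (auto simp: orth_def)
qed

lemma orth_symd_right:
  assumes "finite Y"
  shows "orth Y (X1 \<triangle> X2) \<longleftrightarrow> (orth Y X1 \<longleftrightarrow> orth Y X2)"
  using orth_symd[OF assms] by (simp add: orth_commute)

lemma orth_singletonD:
  assumes "orth Y D" "Y \<subseteq> T" "T \<inter> D = {e}"
  shows "e \<notin> Y"
proof
  assume "e \<in> Y"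
  then have "Y \<inter> D = {e}" using assms(2,3) by blast
  then show False using assms(1) by (simp add: orth_def)
qed

text \<open>
  The role of \<open>\<D>\<close> is that of the cocycle space of a binary matroid on \<open>E\<close>, that is, of the row
  space of a matrix representing it, with a vector over GF(2) identified with its support.
\<close>

definition bspace :: "'a set \<Rightarrow> 'a set set \<Rightarrow> bool" where
  "bspace E \<D> \<longleftrightarrow> \<D> \<subseteq> Pow E \<and> {} \<in> \<D> \<and> (\<forall>X\<in>\<D>. \<forall>Y\<in>\<D>. X \<triangle> Y \<in> \<D>)"

definition cycles :: "'a set \<Rightarrow> 'a set set \<Rightarrow> 'a set set" where
  "cycles E \<D> = {Y. Y \<subseteq> E \<and> (\<forall>D\<in>\<D>. orth Y D)}"

text \<open>
  The cocycle space of the minor on \<open>S\<close> obtained by contracting \<open>C\<close> and deleting all elements outside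
  \<open>C \<union> S\<close>.
\<close>

definition sminor :: "'a set set \<Rightarrow> 'a set \<Rightarrow> 'a set \<Rightarrow> 'a set set" where
  "sminor \<D> C S = {D \<inter> S |D. D \<in> \<D> \<and> D \<inter> C = {}}"

lemma bspaceD:
  assumes "bspace E \<D>"
  shows "D \<in> \<D> \<Longrightarrow> D \<subseteq> E" "{} \<in> \<D>" "X \<in> \<D> \<Longrightarrow> Y \<in> \<D> \<Longrightarrow> X \<triangle> Y \<in> \<D>"
  using assms by (auto simp: bspace_def)

lemma cycles_bspace:
  assumes "finite E"
  shows "bspace E (cycles E \<D>)"
  unfolding bspace_def
proof (intro conjI ballI)
  fix X Y assume "X \<in> cycles E \<D>" "Y \<in> cycles E \<D>"
  moreover have "orth (X \<triangle> Y) D" if "orth X D" "orth Y D" "X \<subseteq> E" "Y \<subseteq> E" for D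
  proof -
    have eq: "orth Z D \<longleftrightarrow> orth Z (D \<inter> E)" if "Z \<subseteq> E" for Z
    proof -
      have "Z \<inter> D = Z \<inter> (D \<inter> E)" using that by auto
      then show ?thesis by (simp add: orth_def)
    qed
    have "X \<triangle> Y \<subseteq> E" using that by (auto simp: symd_def)
    then show ?thesis using that eq orth_symd[of "D \<inter> E" X Y] assms by blast
  qed
  ultimately show "X \<triangle> Y \<in> cycles E \<D>" by (auto simp: cycles_def symd_def)
qed (auto simp: cycles_def)

lemma bspace_avoid:
  assumes "bspace E \<D>"
  shows "bspace E {D \<in> \<D>. e \<notin> D}"
  using assms by (auto simp: bspace_def)

lemma sminor_bspace:
  assumes "bspace E \<D>"
  shows "bspace S (sminor \<D> C S)"
  unfolding bspace_def
proof (intro conjI ballI)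
  fix X Y assume "X \<in> sminor \<D> C S" "Y \<in> sminor \<D> C S"
  then obtain D1 D2 where *: "D1 \<in> \<D>" "D2 \<in> \<D>" "X = D1 \<inter> S" "Y = D2 \<inter> S" "D1 \<inter> C = {}" "D2 \<inter> C = {}"
    by (auto simp: sminor_def)
  then have "X \<triangle> Y = (D1 \<triangle> D2) \<inter> S" "(D1 \<triangle> D2) \<inter> C = {}" by (auto simp: symd_def)
  with * bspaceD(3)[OF assms] show "X \<triangle> Y \<in> sminor \<D> C S" by (auto simp: sminor_def)
next
  show "{} \<in> sminor \<D> C S" using bspaceD(2)[OF assms] unfolding sminor_def by blast
qed (auto simp: sminor_def)

lemma sminor_sminor:
  assumes "C' \<subseteq> S" "S' \<subseteq> S"
  shows "sminor (sminor \<D> C S) C' S' = sminor \<D> (C \<union> C') S'"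
proof -
  have *: "D \<inter> S \<inter> C' = D \<inter> C'" "D \<inter> S \<inter> S' = D \<inter> S'" for D using assms by auto
  have "sminor (sminor \<D> C S) C' S' =
      {D \<inter> S \<inter> S' |D. D \<in> \<D> \<and> D \<inter> C = {} \<and> D \<inter> S \<inter> C' = {}}"
    unfolding sminor_def by blast
  then show ?thesis by (simp add: * sminor_def Int_Un_distrib)
qed

text \<open>
  Contracting \<open>e\<close> keeps the cocycles that avoid \<open>e\<close>. These have codimension at most one, so a set
  orthogonal to them fails on all of the others or on none, and adding \<open>e\<close> repairs the former.
\<close>

lemma cycle_avoid_lift:
  assumes "finite E" "bspace E \<D>" "e \<in> E" "Y \<in> cycles E {D \<in> \<D>. e \<notin> D}" "e \<notin> Y"
  shows "Y \<in> cycles E \<D> \<or> insert e Y \<in> cycles E \<D>"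
proof (cases "Y \<in> cycles E \<D>")
  case False
  have YE: "Y \<subseteq> E" and finY: "finite Y"
    using assms(1,4) by (auto simp: cycles_def intro: finite_subset)
  have av: "orth Y D" if "D \<in> \<D>" "e \<notin> D" for D using assms(4) that by (auto simp: cycles_def)
  obtain D0 where D0: "D0 \<in> \<D>" "\<not> orth Y D0" using False YE by (auto simp: cycles_def)
  then have e0: "e \<in> D0" using av by blast
  have "orth (insert e Y) D" if D: "D \<in> \<D>" for D
  proof (cases "e \<in> D")
    case True
    have "orth Y (D \<triangle> D0)" using bspaceD(3)[OF assms(2) D D0(1)] True e0 by (intro av) auto
    then have "\<not> orth Y D" using D0 orth_symd_right[OF finY] by blast
    then show ?thesis using orth_insert[OF finY assms(5)] True by blast
  next
    case False
    then show ?thesis using orth_insert[OF finY assms(5)] av D by blast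
  qed
  then show ?thesis using YE assms(3) by (auto simp: cycles_def)
qed blast

lemma cycles_sminor:
  assumes "W \<in> cycles E \<D>" "W \<subseteq> C \<union> S"
  shows "W \<inter> S \<in> cycles S (sminor \<D> C S)"
proof -
  have "orth (W \<inter> S) (D \<inter> S)" if "D \<in> \<D>" "D \<inter> C = {}" for D
  proof -
    have "(W \<inter> S) \<inter> (D \<inter> S) = W \<inter> D" using that assms(2) by auto
    moreover have "orth W D" using assms(1) that by (simp add: cycles_def)
    ultimately show ?thesis by (simp add: orth_def)
  qed
  then show ?thesis by (auto simp: cycles_def sminor_def)
qed

lemma cycles_sminor_lift:
  assumes "finite E" "bspace E \<D>" "C \<subseteq> E" "S \<subseteq> E" "C \<inter> S = {}"
    and "Y \<in> cycles S (sminor \<D> C S)"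
  shows "\<exists>Z\<subseteq>C. Y \<union> Z \<in> cycles E \<D>"
proof -
  have "finite C" using assms(1,3) finite_subset by blast
  then show ?thesis using assms(2-)
  proof (induction C arbitrary: \<D>)
    case empty
    have "orth Y D" if "D \<in> \<D>" for D
    proof -
      have "orth Y (D \<inter> S)" using that empty.prems(5) by (auto simp: cycles_def sminor_def)
      moreover have "Y \<inter> (D \<inter> S) = Y \<inter> D" using empty.prems(5) by (auto simp: cycles_def)
      ultimately show ?thesis by (simp add: orth_def)
    qed
    then have "Y \<in> cycles E \<D>" using empty.prems(3,5) by (auto simp: cycles_def)
    then show ?case by simp
  next
    case (insert c C)
    let ?D1 = "{D \<in> \<D>. c \<notin> D}"
    have "sminor \<D> (insert c C) S = sminor ?D1 C S" by (auto simp: sminor_def)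
    then obtain Z where Z: "Z \<subseteq> C" "Y \<union> Z \<in> cycles E ?D1"
      using insert.IH[OF bspace_avoid[OF insert.prems(1), of c]] insert.prems by auto
    have "c \<notin> Y \<union> Z" using Z insert.hyps insert.prems by (auto simp: cycles_def)
    then have "Y \<union> Z \<in> cycles E \<D> \<or> insert c (Y \<union> Z) \<in> cycles E \<D>"
      using cycle_avoid_lift[OF assms(1) insert.prems(1) _ Z(2)] insert.prems(2) by blast
    moreover have "insert c (Y \<union> Z) = Y \<union> insert c Z" by blast
    ultimately show ?case using Z by (metis insert_mono subset_insertI2)
  qed
qed


section \<open>The matroid of a binary space\<close>

definition sp_indep :: "'a set \<Rightarrow> 'a set set \<Rightarrow> 'a set \<Rightarrow> bool" where
  "sp_indep E \<D> X \<longleftrightarrow> X \<subseteq> E \<and> (\<forall>Y\<subseteq>X. Y \<in> cycles E \<D> \<longrightarrow> Y = {})"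

definition sp_matroid :: "'a set \<Rightarrow> 'a set set \<Rightarrow> 'a pre_matroid" where
  "sp_matroid E \<D> = \<lparr>ground = E, indeps = {X. sp_indep E \<D> X}\<rparr>"

lemma sp_matroid_simps [simp]:
  "ground (sp_matroid E \<D>) = E" "X \<in> indeps (sp_matroid E \<D>) \<longleftrightarrow> sp_indep E \<D> X"
  by (simp_all add: sp_matroid_def)

lemma sp_indepI:
  assumes "X \<subseteq> E" "\<And>Y. Y \<subseteq> X \<Longrightarrow> Y \<in> cycles E \<D> \<Longrightarrow> Y = {}"
  shows "sp_indep E \<D> X"
  using assms by (simp add: sp_indep_def)

lemma sp_indepD: "sp_indep E \<D> X \<Longrightarrow> Y \<subseteq> X \<Longrightarrow> Y \<in> cycles E \<D> \<Longrightarrow> Y = {}"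
  by (simp add: sp_indep_def)

lemma sp_indep_mono: "sp_indep E \<D> Y \<Longrightarrow> X \<subseteq> Y \<Longrightarrow> sp_indep E \<D> X"
  by (auto simp: sp_indep_def)

text \<open>
  Induction on \<open>X\<close>: if \<open>a\<close> is an element of \<open>X\<close>, then \<open>X - {a}\<close> is independent in the contraction by \<open>a\<close>, so
  by induction all traces are attained on it by cocycles that avoid \<open>a\<close>; some cocycle contains \<open>a\<close>.
\<close>

lemma sp_indep_trace:
  assumes "finite E" "bspace E \<D>" "sp_indep E \<D> X" "T \<subseteq> X"
  shows "\<exists>D\<in>\<D>. D \<inter> X = T"
proof -
  have "finite X" using assms(1,3) by (auto simp: sp_indep_def intro: finite_subset)
  then show ?thesis using assms(2-)
  proof (induction X arbitrary: \<D> T)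
    case empty
    then show ?case using bspaceD(2) by fastforce
  next
    case (insert a X)
    let ?D1 = "{D \<in> \<D>. a \<notin> D}"
    have aE: "a \<in> E" using insert.prems(2) by (auto simp: sp_indep_def)
    have "{a} \<notin> cycles E \<D>" using insert.prems(2) by (auto simp: sp_indep_def)
    then obtain D0 where D0: "D0 \<in> \<D>" "a \<in> D0"
      using aE by (auto simp: cycles_def orth_insert)
    have "sp_indep E ?D1 X"
      unfolding sp_indep_def
    proof (intro conjI allI impI)
      fix Y assume Y: "Y \<subseteq> X" "Y \<in> cycles E ?D1"
      have "Y \<in> cycles E \<D> \<or> insert a Y \<in> cycles E \<D>"
        using cycle_avoid_lift[OF assms(1) insert.prems(1) aE Y(2)] Y(1) insert.hyps by blast
      then show "Y = {}"
        using insert.prems(2) Y(1) unfolding sp_indep_def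
        by (metis insert_mono insert_not_empty subset_insertI2)
    qed (use insert.prems(2) in \<open>auto simp: sp_indep_def\<close>)
    note IH = insert.IH[OF bspace_avoid[OF insert.prems(1)] this]
    show ?case
    proof (cases "a \<in> T")
      case False
      then obtain D where "D \<in> \<D>" "a \<notin> D" "D \<inter> X = T" using IH[of T] insert.prems(3) by auto
      then show ?thesis by (intro bexI[of _ D]) auto
    next
      case True
      obtain D where D: "D \<in> \<D>" "a \<notin> D" "D \<inter> X = ((T - {a}) \<triangle> (D0 \<inter> X)) \<inter> X"
        using IH[of "((T - {a}) \<triangle> (D0 \<inter> X)) \<inter> X"] by auto
      have "e \<in> (D \<triangle> D0) \<inter> insert a X \<longleftrightarrow> e \<in> T" for e
      proof (cases "e = a")
        case True
        then show ?thesis using D D0 \<open>a \<in> T\<close> by simp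
      next
        case False
        show ?thesis
        proof (cases "e \<in> X")
          case True
          then have "e \<in> D \<longleftrightarrow> (e \<in> T) \<noteq> (e \<in> D0)" using D(3) False by (auto simp: set_eq_iff)
          then show ?thesis using True by auto
        next
          case 2: False
          then show ?thesis using False insert.prems(3) by auto
        qed
      qed
      then show ?thesis using bspaceD(3)[OF insert.prems(1) D(1) D0(1)] by blast
    qed
  qed
qed

lemma sp_indep_insertD:
  assumes "sp_indep E \<D> X" "e \<in> E" "\<not> sp_indep E \<D> (insert e X)"
  obtains W where "W \<in> cycles E \<D>" "W \<subseteq> insert e X" "e \<in> W"
proof -
  obtain W where "W \<subseteq> insert e X" "W \<in> cycles E \<D>" "W \<noteq> {}"
    using assms by (auto simp: sp_indep_def)
  moreover from this have "e \<in> W" using assms(1) by (auto simp: sp_indep_def)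
  ultimately show ?thesis using that by blast
qed

text \<open>
  For augmentation, assume that every element of \<open>Y - X\<close> closes a cycle with \<open>X\<close>. Then the trace
  of a cocycle on \<open>X\<close> determines its trace on \<open>Y\<close>. All subsets of \<open>Y\<close> are traces, so
  \<open>Y\<close> has at most as many subsets as \<open>X\<close>.
\<close>

lemma sp_matroid_matroid:
  assumes "finite E" "bspace E \<D>"
  shows "matroid (sp_matroid E \<D>)"
proof
  fix X Y assume "X \<in> indeps (sp_matroid E \<D>)" "Y \<in> indeps (sp_matroid E \<D>)" and less: "card X < card Y"
  then have X: "sp_indep E \<D> X" and Y: "sp_indep E \<D> Y" by simp_all
  have fin: "finite X" "finite Y" using X Y assms(1) by (auto simp: sp_indep_def intro: finite_subset)
  show "\<exists>y \<in> Y - X. insert y X \<in> indeps (sp_matroid E \<D>)"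
  proof (rule ccontr)
    assume "\<not> ?thesis"
    then have no: "\<not> sp_indep E \<D> (insert y X)" if "y \<in> Y - X" for y using that by simp
    \<comment> \<open>\<open>F T\<close> is a cocycle with trace \<open>T\<close> on \<open>Y\<close>; its trace on \<open>X\<close> determines \<open>T\<close>.\<close>
    define F where "F T = (SOME D. D \<in> \<D> \<and> D \<inter> Y = T)" for T
    have F: "F T \<in> \<D>" "F T \<inter> Y = T" if "T \<subseteq> Y" for T
      using someI_ex[OF sp_indep_trace[OF assms Y that, unfolded Bex_def]] by (simp_all add: F_def)
    have "inj_on (\<lambda>T. F T \<inter> X) (Pow Y)"
    proof (rule inj_onI)
      fix T T' assume TT: "T \<in> Pow Y" "T' \<in> Pow Y" "F T \<inter> X = F T' \<inter> X"
      let ?D = "F T \<triangle> F T'"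
      have D: "?D \<in> \<D>" using F TT bspaceD(3)[OF assms(2)] by auto
      have DX: "?D \<inter> X = {}" using TT(3) by (auto simp: set_eq_iff)
      have "y \<notin> ?D" if y: "y \<in> Y" for y
      proof (cases "y \<in> X")
        case False
        have "y \<in> E" using y Y by (auto simp: sp_indep_def)
        then obtain W where W: "W \<in> cycles E \<D>" "W \<subseteq> insert y X" "y \<in> W"
          using sp_indep_insertD[OF X _ no] y False by blast
        have "even (card (W \<inter> ?D))" using W(1) D by (simp add: cycles_def orth_def)
        moreover have "W \<inter> ?D = {y}" if "y \<in> ?D" using that W DX by blast
        ultimately show ?thesis by (metis is_singletonI is_singleton_altdef odd_one)
      qed (use DX in blast)
      then have "F T \<inter> Y = F T' \<inter> Y" by auto
      then show "T = T'" using F TT by auto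
    qed
    then have "card (Pow Y) \<le> card (Pow X)"
      by (rule card_inj_on_le) (use fin in auto)
    then show False using less fin by (simp add: card_Pow)
  qed
qed (use assms in \<open>auto simp: sp_indep_def intro: finite_subset\<close>)

text \<open>
  Each element of \<open>C - B\<close> closes a cycle with \<open>B\<close>; adding these cycles to \<open>Z\<close> moves it into \<open>B\<close>.
\<close>

lemma basis_of_span:
  assumes "finite E" "bspace E \<D>" "C \<subseteq> E" "basis_of (sp_matroid E \<D>) C B" "Z \<subseteq> C"
  shows "\<exists>W \<in> cycles E \<D>. W \<subseteq> C \<and> Z \<triangle> W \<subseteq> B"
proof -
  note csp = bspaceD[OF cycles_bspace[OF assms(1), of \<D>]]
  have B: "sp_indep E \<D> B" "B \<subseteq> C" using assms(4) by (auto simp: basis_of_def)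
  have max: "\<not> sp_indep E \<D> (insert z B)" if "z \<in> C - B" for z
    using assms(4) that B by (auto simp: basis_of_def)
  have "finite Z" using assms by (meson finite_subset)
  then show ?thesis using assms(5)
  proof (induction Z)
    case empty
    then show ?case using csp(2) by (intro bexI[of _ "{}"]) (auto simp: symd_def)
  next
    case (insert z Z)
    then obtain W where W: "W \<in> cycles E \<D>" "W \<subseteq> C" "Z \<triangle> W \<subseteq> B" by auto
    show ?case
    proof (cases "z \<in> B")
      case True
      then have "insert z Z \<triangle> W \<subseteq> B" using W(3) by (auto simp: symd_def)
      then show ?thesis using W by blast
    next
      case False
      then obtain U where U: "U \<in> cycles E \<D>" "U \<subseteq> insert z B" "z \<in> U"
        using sp_indep_insertD[OF B(1) _ max] insert.prems assms(3) by blast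
      have "insert z Z \<triangle> (W \<triangle> U) \<subseteq> B"
      proof
        fix e assume e: "e \<in> insert z Z \<triangle> (W \<triangle> U)"
        show "e \<in> B"
          using e W(3) U(2,3) insert.hyps(2) False by (cases "e = z") (auto simp: subset_iff)
      qed
      moreover have "W \<triangle> U \<subseteq> C" using W U B insert.prems by (auto simp: symd_def)
      ultimately show ?thesis using csp(3)[OF W(1) U(1)] by blast
    qed
  qed
qed

lemma basis_of_exists:
  assumes "finite E" "bspace E \<D>" "C \<subseteq> E"
  shows "\<exists>B. basis_of (sp_matroid E \<D>) C B"
proof -
  let ?F = "{B. B \<subseteq> C \<and> sp_indep E \<D> B}"
  have "finite ?F" using finite_subset[OF assms(3,1)] by simp
  moreover have "{} \<in> ?F" by (auto simp: sp_indep_def)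
  then have "?F \<noteq> {}" by blast
  ultimately obtain B where B: "B \<in> ?F" "\<forall>Y\<in>?F. B \<subseteq> Y \<longrightarrow> B = Y"
    using finite_has_maximal[of ?F] by blast
  then have "Y = B" if "sp_indep E \<D> Y" "B \<subseteq> Y" "Y \<subseteq> C" for Y using that by blast
  with B(1) show ?thesis unfolding basis_of_def by (intro exI[of _ B]) simp
qed

text \<open>
  A cycle of the minor becomes a cycle of the whole matroid by adding a subset of \<open>C\<close>, and modulo cycles
  inside \<open>C\<close> this subset can be chosen in \<open>B\<close>.
\<close>

lemma sp_indep_contract:
  assumes "finite E" "bspace E \<D>" "C \<subseteq> E" "S \<subseteq> E" "C \<inter> S = {}"
    and B: "basis_of (sp_matroid E \<D>) C B" and XS: "X \<subseteq> S"
  shows "sp_indep S (sminor \<D> C S) X \<longleftrightarrow> sp_indep E \<D> (X \<union> B)"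
proof
  note csp = bspaceD[OF cycles_bspace[OF assms(1), of \<D>]]
  assume ind: "sp_indep E \<D> (X \<union> B)"
  show "sp_indep S (sminor \<D> C S) X"
    unfolding sp_indep_def
  proof (intro conjI XS allI impI)
    fix Y assume Y: "Y \<subseteq> X" "Y \<in> cycles S (sminor \<D> C S)"
    then obtain Z where Z: "Z \<subseteq> C" "Y \<union> Z \<in> cycles E \<D>"
      using cycles_sminor_lift[OF assms(1-5)] by blast
    obtain W where W: "W \<in> cycles E \<D>" "W \<subseteq> C" "Z \<triangle> W \<subseteq> B"
      using basis_of_span[OF assms(1-3) B Z(1)] by blast
    have "Y \<inter> W = {}" using Y(1) XS W(2) assms(5) by blast
    then have "(Y \<union> Z) \<triangle> W = Y \<union> (Z \<triangle> W)" by (auto simp: symd_def)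
    then have "Y \<union> (Z \<triangle> W) \<in> cycles E \<D>" using csp(3)[OF Z(2) W(1)] by simp
    then have "Y \<union> (Z \<triangle> W) = {}" using ind W(3) Y(1) unfolding sp_indep_def by (meson Un_mono)
    then show "Y = {}" by blast
  qed
next
  assume ind: "sp_indep S (sminor \<D> C S) X"
  have BC: "B \<subseteq> C" "sp_indep E \<D> B" using B by (auto simp: basis_of_def)
  have "Y = {}" if Y: "Y \<subseteq> X \<union> B" "Y \<in> cycles E \<D>" for Y
  proof -
    have "Y \<inter> S \<in> cycles S (sminor \<D> C S)"
      using Y BC XS by (intro cycles_sminor) auto
    moreover have "Y \<inter> S \<subseteq> X" using Y(1) BC(1) assms(5) by auto
    ultimately have "Y \<inter> S = {}" using ind by (auto simp: sp_indep_def)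
    then have "Y \<subseteq> B" using Y(1) XS by auto
    then show "Y = {}" using BC(2) Y(2) by (auto simp: sp_indep_def)
  qed
  then show "sp_indep E \<D> (X \<union> B)" using BC XS assms(3,4) by (auto simp: sp_indep_def)
qed

lemma sp_matroid_minor:
  assumes "finite E" "bspace E \<D>" "C \<subseteq> E" "S \<subseteq> E" "C \<inter> S = {}"
  shows "minor (sp_matroid S (sminor \<D> C S)) (sp_matroid E \<D>)"
proof -
  have key: "(\<exists>B. basis_of (sp_matroid E \<D>) C B \<and> sp_indep E \<D> (X \<union> B)) \<longleftrightarrow>
      sp_indep S (sminor \<D> C S) X" if XS: "X \<subseteq> S" for X
    using basis_of_exists[OF assms(1-3)] sp_indep_contract[OF assms _ XS] by blast
  have "E - C - (E - C - S) = S" using assms by auto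
  moreover have "{X. (X \<subseteq> E - C \<and> (\<exists>B. basis_of (sp_matroid E \<D>) C B \<and> sp_indep E \<D> (X \<union> B)))
      \<and> X \<inter> (E - C - S) = {}} = {X. sp_indep S (sminor \<D> C S) X}" (is "?L = ?R")
  proof -
    have "X \<in> ?L \<longleftrightarrow> X \<subseteq> S \<and> (\<exists>B. basis_of (sp_matroid E \<D>) C B \<and> sp_indep E \<D> (X \<union> B))" for X
      using assms(4,5) by blast
    also have "\<dots> X \<longleftrightarrow> X \<in> ?R" for X using key[of X] by (auto simp: sp_indep_def[of S])
    finally show ?thesis by blast
  qed
  ultimately have "sp_matroid S (sminor \<D> C S) =
      deletion (contraction (sp_matroid E \<D>) C) (E - C - S)"
    by (simp add: deletion_def contraction_def sp_matroid_def[of S])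
  note eq = this
  show ?thesis
    unfolding minor_def
  proof (intro exI conjI)
    show "C \<subseteq> ground (sp_matroid E \<D>)" using assms(3) by simp
    show "E - C - S \<subseteq> ground (sp_matroid E \<D>)" by auto
    show "C \<inter> (E - C - S) = {}" by blast
    show "sp_matroid S (sminor \<D> C S) = deletion (contraction (sp_matroid E \<D>) C) (E - C - S)"
      by (fact eq)
  qed
qed


section \<open>Row spaces of matrices\<close>

definition adjoin_vector :: "'a set set \<Rightarrow> 'a set \<Rightarrow> 'a set set" where
  "adjoin_vector \<D> H = \<D> \<union> (\<lambda>D. D \<triangle> H) ` \<D>"

primrec row_space :: "'a set \<Rightarrow> (nat \<Rightarrow> 'a \<Rightarrow> bit) \<Rightarrow> nat \<Rightarrow> 'a set set" where
  "row_space E A 0 = {{}}"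
| "row_space E A (Suc r) = adjoin_vector (row_space E A r) {e \<in> E. A r e = 1}"

lemma adjoin_vector_bspace:
  assumes "bspace E \<D>" "H \<subseteq> E"
  shows "bspace E (adjoin_vector \<D> H)"
proof -
  have *: "(X \<triangle> H) \<triangle> Y = (X \<triangle> Y) \<triangle> H" "X \<triangle> (Y \<triangle> H) = (X \<triangle> Y) \<triangle> H" "(X \<triangle> H) \<triangle> (Y \<triangle> H) = X \<triangle> Y" for X Y
    by auto
  note \<D> = bspaceD[OF assms(1)]
  show ?thesis
    unfolding bspace_def
  proof (intro conjI ballI)
    show "adjoin_vector \<D> H \<subseteq> Pow E"
      using \<D>(1) assms(2) by (fastforce simp: adjoin_vector_def symd_def)
    show "{} \<in> adjoin_vector \<D> H" using \<D>(2) by (simp add: adjoin_vector_def)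
    fix X Y assume X: "X \<in> adjoin_vector \<D> H" and Y: "Y \<in> adjoin_vector \<D> H"
    from X obtain X' where X': "X' \<in> \<D>" "X = X' \<or> X = X' \<triangle> H" by (auto simp: adjoin_vector_def)
    from Y obtain Y' where Y': "Y' \<in> \<D>" "Y = Y' \<or> Y = Y' \<triangle> H" by (auto simp: adjoin_vector_def)
    have "X \<triangle> Y = X' \<triangle> Y' \<or> X \<triangle> Y = (X' \<triangle> Y') \<triangle> H" using X'(2) Y'(2) * by metis
    then show "X \<triangle> Y \<in> adjoin_vector \<D> H"
      using \<D>(3)[OF X'(1) Y'(1)] by (auto simp: adjoin_vector_def)
  qed
qed

lemma row_space_bspace: "bspace E (row_space E A r)"
  by (induction r) (auto intro: adjoin_vector_bspace, simp add: bspace_def symd_def)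

lemma cycles_adjoin_vector:
  assumes "finite Y" "bspace E \<D>"
  shows "Y \<in> cycles E (adjoin_vector \<D> H) \<longleftrightarrow> Y \<in> cycles E \<D> \<and> orth Y H"
  using bspaceD(2)[OF assms(2)] orth_symd_right[OF assms(1)] orth_empty(2)[of Y]
  unfolding cycles_def adjoin_vector_def by blast

lemma sum_bit_eq_0_iff:
  fixes f :: "'a \<Rightarrow> bit"
  assumes "finite Y"
  shows "(\<Sum>e\<in>Y. f e) = 0 \<longleftrightarrow> even (card {e \<in> Y. f e = 1})"
  using assms
proof (induction Y)
  case (insert a Y)
  have "{e \<in> insert a Y. f e = 1} = (if f a = 1 then insert a {e \<in> Y. f e = 1} else {e \<in> Y. f e = 1})"
    by auto
  then show ?case using insert by (cases "f a"; cases "\<Sum>e\<in>Y. f e") auto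
qed simp

text \<open>
  Because of this, the vector matroid and the matroid of the row space have the same circuits.
\<close>

lemma null_set_iff_cycle:
  assumes "finite E" "Y \<subseteq> E"
  shows "null_set r A Y \<longleftrightarrow> Y \<in> cycles E (row_space E A r)"
proof (induction r)
  case 0
  then show ?case using assms by (simp add: null_set_def cycles_def)
next
  case (Suc r)
  have fin: "finite Y" using assms finite_subset by blast
  have "Y \<inter> {e \<in> E. A r e = 1} = {e \<in> Y. A r e = 1}" using assms(2) by auto
  then have "orth Y {e \<in> E. A r e = 1} \<longleftrightarrow> (\<Sum>e\<in>Y. A r e) = 0"
    using sum_bit_eq_0_iff[OF fin] by (simp add: orth_def)
  moreover have "null_set (Suc r) A Y \<longleftrightarrow> null_set r A Y \<and> (\<Sum>e\<in>Y. A r e) = 0"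
    by (auto simp: null_set_def less_Suc_eq)
  ultimately show ?case
    using Suc cycles_adjoin_vector[OF fin row_space_bspace] by (simp add: adjoin_vector_def)
qed

lemma vector_matroid_eq_sp_matroid:
  assumes "finite E"
  shows "vector_matroid E r A = sp_matroid E (row_space E A r)"
proof -
  have "columns_indep r A X \<longleftrightarrow> (\<forall>Y\<subseteq>X. Y \<in> cycles E (row_space E A r) \<longrightarrow> Y = {})" if "X \<subseteq> E" for X
    using that columns_indep_iff_null_set[OF finite_subset[OF that assms]] null_set_iff_cycle[OF assms]
    by (meson order.trans)
  then show ?thesis by (auto simp: vector_matroid_def sp_matroid_def sp_indep_def)
qed

lemma row_space_cong: "(\<And>i. i < r \<Longrightarrow> A i = B i) \<Longrightarrow> row_space E A r = row_space E B r"
  by (induction r) (simp_all add: less_Suc_eq)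

lemma splitting_eq_sp_matroid:
  assumes "finite (ground M)" "represents r A M" "H \<subseteq> ground M"
  shows "splitting M H = sp_matroid (ground M) (adjoin_vector (row_space (ground M) A r) H)"
proof -
  have "row_space (ground M) (adjoin_row r A H) r = row_space (ground M) A r"
    by (rule row_space_cong) (simp add: adjoin_row_def)
  moreover have "{e \<in> ground M. adjoin_row r A H r e = 1} = H"
    using assms(3) by (auto simp: adjoin_row_def)
  ultimately show ?thesis
    by (simp add: splitting_eq[OF assms(1,2)] vector_matroid_eq_sp_matroid[OF assms(1)])
qed


section \<open>Dirac's theorem for binary matroids\<close>

text \<open>
  The edge cuts of \<open>K\<^sub>4\<close>, where \<open>a\<close>, \<open>b\<close>, \<open>c\<close> are the edges at one vertex and \<open>x\<close>, \<open>y\<close>, \<open>z\<close>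
  complete \<open>{a, b}\<close>, \<open>{b, c}\<close>, \<open>{a, c}\<close> to triangles.
\<close>

definition K4_cocycles :: "'a \<Rightarrow> 'a \<Rightarrow> 'a \<Rightarrow> 'a \<Rightarrow> 'a \<Rightarrow> 'a \<Rightarrow> 'a set set" where
  "K4_cocycles a b c x y z = {{}, {a, x, z}, {b, x, y}, {c, y, z},
     {a, b, y, z}, {a, c, x, y}, {b, c, x, z}, {a, b, c}}"

definition has_K4 :: "'a set \<Rightarrow> 'a set set \<Rightarrow> bool" where
  "has_K4 E \<D> \<longleftrightarrow> (\<exists>C a b c x y z. distinct [a, b, c, x, y, z] \<and>
     {a, b, c, x, y, z} \<subseteq> E \<and> C \<subseteq> E \<and> C \<inter> {a, b, c, x, y, z} = {} \<and>
     sminor \<D> C {a, b, c, x, y, z} = K4_cocycles a b c x y z)"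

lemma has_K4I:
  assumes "distinct [a, b, c, x, y, z]" "{a, b, c, x, y, z} \<subseteq> E" "C \<subseteq> E"
    "C \<inter> {a, b, c, x, y, z} = {}"
    "sminor \<D> C {a, b, c, x, y, z} = K4_cocycles a b c x y z"
  shows "has_K4 E \<D>"
  unfolding has_K4_def by (intro exI conjI; rule assms)

lemma has_K4E:
  assumes "has_K4 E \<D>"
  obtains C a b c x y z where "distinct [a, b, c, x, y, z]" "{a, b, c, x, y, z} \<subseteq> E" "C \<subseteq> E"
    "C \<inter> {a, b, c, x, y, z} = {}"
    "sminor \<D> C {a, b, c, x, y, z} = K4_cocycles a b c x y z"
  using assms unfolding has_K4_def by (elim exE conjE) (rule that; assumption)

lemma has_K4_sminor:
  assumes "has_K4 S (sminor \<D> C S)" "C \<subseteq> E" "S \<subseteq> E" "C \<inter> S = {}"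
  shows "has_K4 E \<D>"
proof -
  obtain C' a b c x y z where *: "distinct [a, b, c, x, y, z]"
    "{a, b, c, x, y, z} \<subseteq> S" "C' \<subseteq> S" "C' \<inter> {a, b, c, x, y, z} = {}"
    "sminor (sminor \<D> C S) C' {a, b, c, x, y, z} = K4_cocycles a b c x y z"
    using assms(1) by (rule has_K4E)
  define K where "K = {a, b, c, x, y, z}"
  have "sminor \<D> (C \<union> C') K = K4_cocycles a b c x y z"
    using sminor_sminor[OF *(3,2)] *(5) by (simp add: K_def)
  moreover have "K \<subseteq> E" "C \<union> C' \<subseteq> E" "(C \<union> C') \<inter> K = {}"
    using *(2-4) assms(2-4) unfolding K_def[symmetric] by blast+
  ultimately show ?thesis
    unfolding K_def by (intro has_K4I[OF *(1)])
qed

text \<open>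
  The three triangles express the cocycles by their traces on \<open>{a, b, c}\<close>, and these are arbitrary
  because \<open>{a, b, c}\<close> is independent.
\<close>

lemma has_K4_of_triangles:
  assumes "finite E" "bspace E \<D>" "distinct [a, b, c, x, y, z]"
    and tri: "{a, b, x} \<in> cycles E \<D>" "{b, c, y} \<in> cycles E \<D>" "{a, c, z} \<in> cycles E \<D>"
    and ind: "sp_indep E \<D> {a, b, c}"
  shows "has_K4 E \<D>"
proof -
  let ?S = "{a, b, c, x, y, z}"
  define f where "f T = T \<union> (if (a \<in> T) \<noteq> (b \<in> T) then {x} else {}) \<union>
    (if (b \<in> T) \<noteq> (c \<in> T) then {y} else {}) \<union> (if (a \<in> T) \<noteq> (c \<in> T) then {z} else {})" for T
  have ne: "distinct [z, y, x, c, b, a]" using assms(3) by auto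
  have f: "D \<inter> ?S = f (D \<inter> {a, b, c})" if "D \<in> \<D>" for D
  proof -
    have "x \<in> D \<longleftrightarrow> (a \<in> D) \<noteq> (b \<in> D)" "y \<in> D \<longleftrightarrow> (b \<in> D) \<noteq> (c \<in> D)" "z \<in> D \<longleftrightarrow> (a \<in> D) \<noteq> (c \<in> D)"
      using that tri assms(3) by (auto simp: cycles_def orth_triple)
    then show ?thesis using assms(3) by (auto simp: f_def)
  qed
  have "sminor \<D> {} ?S = (\<lambda>D. D \<inter> ?S) ` \<D>" by (auto simp: sminor_def)
  also have "\<dots> = f ` (\<lambda>D. D \<inter> {a, b, c}) ` \<D>" using f by (simp add: image_image)
  also have "(\<lambda>D. D \<inter> {a, b, c}) ` \<D> = Pow {a, b, c}"
  proof
    show "Pow {a, b, c} \<subseteq> (\<lambda>D. D \<inter> {a, b, c}) ` \<D>"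
    proof
      fix T assume "T \<in> Pow {a, b, c}"
      then obtain D where "D \<in> \<D>" "D \<inter> {a, b, c} = T"
        using sp_indep_trace[OF assms(1,2) ind, of T] by auto
      then show "T \<in> (\<lambda>D. D \<inter> {a, b, c}) ` \<D>" by (metis image_eqI)
    qed
  qed auto
  also have "f ` Pow {a, b, c} = K4_cocycles a b c x y z"
    using assms(3) ne by (simp add: Pow_insert f_def K4_cocycles_def insert_commute)
  finally have "sminor \<D> {} ?S = K4_cocycles a b c x y z" .
  moreover have "?S \<subseteq> E" using tri by (auto simp: cycles_def)
  ultimately show ?thesis by (intro has_K4I[OF assms(3), of E "{}"]) simp_all
qed

text \<open>
  Dirac's theorem that a simple graph of minimum degree at least three has a \<open>K\<^sub>4\<close>-minor, for binary
  matroids; minimum degree three becomes the absence of cocycles with one or two elements.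

  Take a smallest counterexample. Deleting an element must create a coloop or a series pair, so every
  element lies in a three-element cocycle (a triad), and dually in a triangle. A triangle meets a triad
  in an even number of elements. Hence there are a triad \<open>{a, b, c}\<close> and triangles \<open>{a, b, x}\<close>, \<open>{b, c, y}\<close>,
  as at a rim vertex of a wheel with spoke \<open>b\<close>, rim edges \<open>a\<close>, \<open>c\<close> and neighbouring spokes \<open>x\<close>, \<open>y\<close>. If some \<open>z\<close> completes
  \<open>{a, c}\<close> to a triangle, there is an \<open>M(K\<^sub>4)\<close>. Otherwise, contracting \<open>a\<close> and deleting \<open>b\<close> is
  the reduction to a smaller wheel, which has to fail and thus makes \<open>{b, x, y}\<close> a triad. Replacing
  \<open>a\<close>, \<open>b\<close>, \<open>c\<close>, \<open>x\<close>, \<open>y\<close> by the single element \<open>c\<close> has to fail as well, which gives a triad \<open>{c, y, p}\<close>.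
  Every possible triangle through \<open>p\<close> then produces a parallel pair or the triangle \<open>{a, c, p}\<close>.
\<close>

lemma dirac_binary:
  assumes "finite E" "bspace E \<D>" "E \<noteq> {}"
    and "\<And>Y. Y \<in> cycles E \<D> \<Longrightarrow> card Y \<le> 2 \<Longrightarrow> Y = {}"
    and "\<And>D. D \<in> \<D> \<Longrightarrow> card D \<le> 2 \<Longrightarrow> D = {}"
  shows "has_K4 E \<D>"
  using assms
proof (induction "card E" arbitrary: E \<D> rule: less_induct)
  case less
  note fin = less.prems(1) and bs = less.prems(2) and simple = less.prems(4) and cosimple = less.prems(5)
  note dsp = bspaceD[OF bs] and csp = bspaceD[OF cycles_bspace[OF fin, of \<D>]]
  have c2: "{p, q} \<notin> cycles E \<D>" for p q
    using simple[of "{p, q}"] by (cases "p = q") auto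
  have d2: "{p, q} \<notin> \<D>" for p q
    using cosimple[of "{p, q}"] by (cases "p = q") auto
  have orthD: "orth Y D" if "Y \<in> cycles E \<D>" "D \<in> \<D>" for Y D using that by (simp add: cycles_def)
  have finD: "finite D" if "D \<in> \<D>" for D using dsp(1)[OF that] fin finite_subset by blast
  show ?case
  proof (rule ccontr)
    assume noK4: "\<not> has_K4 E \<D>"
    \<comment> \<open>By minimality, no proper nonempty minor is simple and cosimple.\<close>
    have reduce: "(\<exists>Y Z. Y \<subseteq> S \<and> Y \<noteq> {} \<and> card Y \<le> 2 \<and> Z \<subseteq> C \<and> Y \<union> Z \<in> cycles E \<D>) \<or>
        (\<exists>D\<in>\<D>. D \<inter> C = {} \<and> D \<inter> S \<noteq> {} \<and> card (D \<inter> S) \<le> 2)"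
      if CS: "C \<subseteq> E" "S \<subset> E" "C \<inter> S = {}" "S \<noteq> {}" for C S
    proof (rule ccontr)
      assume neg: "\<not> ?thesis"
      have "has_K4 S (sminor \<D> C S)"
      proof (rule less.hyps)
        show "card S < card E" using CS(2) fin by (simp add: psubset_card_mono)
        show "finite S" using CS(2) fin finite_subset by blast
        show "bspace S (sminor \<D> C S)" by (rule sminor_bspace[OF bs])
        show "Y = {}" if Y: "Y \<in> cycles S (sminor \<D> C S)" "card Y \<le> 2" for Y
          using cycles_sminor_lift[OF fin bs CS(1) _ CS(3) Y(1)] CS(2) Y neg
          by (metis (no_types, lifting) cycles_def mem_Collect_eq psubset_imp_subset)
        show "D = {}" if D: "D \<in> sminor \<D> C S" "card D \<le> 2" for D
          using D neg by (auto simp: sminor_def)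
      qed fact
      then show False using has_K4_sminor CS noK4 by (metis psubset_imp_subset)
    qed
    have two: "\<exists>f g. e \<noteq> f \<and> e \<noteq> g \<and> f \<noteq> g \<and> X = {e, f, g}"
      if "finite X" "card (X - {e}) \<le> 2" "\<not> card X \<le> 2" "e \<in> X" for e :: 'a and X
    proof -
      have "card X = Suc (card (X - {e}))" using that by (metis card.remove)
      then have "card (X - {e}) = 2" using that by linarith
      then obtain f g where fg: "X - {e} = {f, g}" "f \<noteq> g" by (auto simp: card_2_iff)
      then have "X = {e, f, g}" "e \<noteq> f" "e \<noteq> g" using that(4) by blast+
      then show ?thesis using fg(2) by blast
    qed
    have proper: "E - {e} \<noteq> {}" if "e \<in> E" for e
    proof
      assume "E - {e} = {}"
      then have E: "E = {e}" using that by blast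
      have "D = {}" if "D \<in> \<D>" for D using d2[of e e] dsp(1)[OF that] that E by (auto simp: subset_singleton_iff)
      then have "orth {e} D" if "D \<in> \<D>" for D using that by fastforce
      then have "{e} \<in> cycles E \<D>" using E by (auto simp: cycles_def)
      then show False using c2[of e e] by simp
    qed
    have triad: "\<exists>f g. e \<noteq> f \<and> e \<noteq> g \<and> f \<noteq> g \<and> {e, f, g} \<in> \<D>" if e: "e \<in> E" for e
    proof -
      have "\<exists>D\<in>\<D>. D \<inter> (E - {e}) \<noteq> {} \<and> card (D \<inter> (E - {e})) \<le> 2"
        using reduce[of "{}" "E - {e}"] proper[OF e] e simple by (auto simp: psubset_eq)
      then obtain D where D: "D \<in> \<D>" "D \<inter> (E - {e}) \<noteq> {}" "card (D \<inter> (E - {e})) \<le> 2" by blast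
      have "D \<inter> (E - {e}) = D - {e}" using dsp(1)[OF D(1)] by blast
      then have De: "card (D - {e}) \<le> 2" using D(3) by simp
      have D3: "\<not> card D \<le> 2" using cosimple[OF D(1)] D(2) by blast
      have "e \<in> D" using De D3 by (cases "e \<in> D") simp_all
      then show ?thesis using two[OF finD[OF D(1)] De D3] D(1) by blast
    qed
    have triangle: "\<exists>f g. e \<noteq> f \<and> e \<noteq> g \<and> f \<noteq> g \<and> {e, f, g} \<in> cycles E \<D>" if e: "e \<in> E" for e
    proof -
      have "\<not> (\<exists>D\<in>\<D>. D \<inter> {e} = {} \<and> D \<inter> (E - {e}) \<noteq> {} \<and> card (D \<inter> (E - {e})) \<le> 2)"
      proof
        assume "\<exists>D\<in>\<D>. D \<inter> {e} = {} \<and> D \<inter> (E - {e}) \<noteq> {} \<and> card (D \<inter> (E - {e})) \<le> 2"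
        then obtain D where D: "D \<in> \<D>" "D \<inter> {e} = {}" "D \<inter> (E - {e}) \<noteq> {}" "card (D \<inter> (E - {e})) \<le> 2" by blast
        then have "D \<inter> (E - {e}) = D" using dsp(1) by blast
        then show False using D cosimple by metis
      qed
      moreover have "(\<exists>Y Z. Y \<subseteq> E - {e} \<and> Y \<noteq> {} \<and> card Y \<le> 2 \<and> Z \<subseteq> {e} \<and> Y \<union> Z \<in> cycles E \<D>) \<or>
        (\<exists>D\<in>\<D>. D \<inter> {e} = {} \<and> D \<inter> (E - {e}) \<noteq> {} \<and> card (D \<inter> (E - {e})) \<le> 2)"
        using e proper[OF e] by (intro reduce) auto
      ultimately obtain Y Z where Y: "Y \<subseteq> E - {e}" "Y \<noteq> {}" "card Y \<le> 2" "Z \<subseteq> {e}" "Y \<union> Z \<in> cycles E \<D>"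
        by blast
      have "Z \<noteq> {}" using simple Y by fastforce
      then have Z: "Y \<union> Z = insert e Y" using Y(4) by blast
      have "finite (insert e Y)" using Y(1) fin by (meson finite_Diff finite_insert finite_subset)
      moreover have "insert e Y - {e} = Y" using Y(1) by blast
      moreover have "\<not> card (insert e Y) \<le> 2" using simple Y(5) Z by (metis insert_not_empty)
      ultimately obtain f g where "e \<noteq> f" "e \<noteq> g" "f \<noteq> g" "insert e Y = {e, f, g}"
        using two[of "insert e Y" e] Y(3) by auto
      then show ?thesis using Y(5) Z by metis
    qed
    \<comment> \<open>A triangle through \<open>p\<close> meets a triad through \<open>p\<close> in exactly two elements.\<close>
    have third: "\<exists>w. w \<notin> {p, q, r} \<and> ({p, q, w} \<in> cycles E \<D> \<or> {p, r, w} \<in> cycles E \<D>)"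
      if "{p, q, r} \<in> \<D>" "p \<noteq> q" "p \<noteq> r" "q \<noteq> r" for p q r
    proof -
      have "p \<in> E" using dsp(1)[OF that(1)] by blast
      then obtain f g where fg: "p \<noteq> f" "p \<noteq> g" "f \<noteq> g" "{p, f, g} \<in> cycles E \<D>" using triangle by blast
      have "orth {p, f, g} {p, q, r}" by (rule orthD[OF fg(4) that(1)])
      then have "(f \<in> {q, r}) \<noteq> (g \<in> {q, r})" using fg that by (auto simp: orth_triple)
      moreover have "{p, f, g} = {p, g, f}" by blast
      ultimately show ?thesis using fg by auto
    qed
    obtain a b c x y where fan: "a \<noteq> b" "a \<noteq> c" "b \<noteq> c" "x \<notin> {a, b, c}" "y \<notin> {a, b, c}"
      and T: "{a, b, c} \<in> \<D>" and abx: "{a, b, x} \<in> cycles E \<D>" and bcy: "{b, c, y} \<in> cycles E \<D>"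
    proof -
      obtain e where "e \<in> E" using less.prems(3) by blast
      then obtain f g where *: "e \<noteq> f" "e \<noteq> g" "f \<noteq> g" "{e, f, g} \<in> \<D>" using triad by blast
      have perm: "{f, e, g} = {e, f, g}" "{g, e, f} = {e, f, g}" "{f, g, e} = {e, f, g}" "{g, f, e} = {e, f, g}"
        "{e, g, f} = {e, f, g}" by auto
      have tperm: "{q, p, w} = {p, q, w}" for p q w :: 'a by auto
      obtain u where u: "u \<notin> {e, f, g}" "{e, f, u} \<in> cycles E \<D> \<or> {e, g, u} \<in> cycles E \<D>"
        using third[of e f g] * by auto
      obtain v where v: "v \<notin> {e, f, g}" "{f, e, v} \<in> cycles E \<D> \<or> {f, g, v} \<in> cycles E \<D>"
        using third[of f e g] * perm by auto
      obtain w where w: "w \<notin> {e, f, g}" "{g, e, w} \<in> cycles E \<D> \<or> {g, f, w} \<in> cycles E \<D>"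
        using third[of g e f] * perm by auto
      \<comment> \<open>Each of the three elements of the triad lies in one of the pairs that are contained in a
        triangle, so at least two pairs are, and these share an element.\<close>
      consider p q where "p \<notin> {e,f,g}" "q \<notin> {e,f,g}" "{e, f, p} \<in> cycles E \<D>" "{f, g, q} \<in> cycles E \<D>"
        | p q where "p \<notin> {e,f,g}" "q \<notin> {e,f,g}" "{f, e, p} \<in> cycles E \<D>" "{e, g, q} \<in> cycles E \<D>"
        | p q where "p \<notin> {e,f,g}" "q \<notin> {e,f,g}" "{e, g, p} \<in> cycles E \<D>" "{g, f, q} \<in> cycles E \<D>"
        using u v w tperm by metis
      then show thesis
      proof cases
        case 1 then show thesis using that[of e f g p q] * by auto
      next
        case 2 then show thesis using that[of f e g p q] * perm by auto
      next
        case 3 then show thesis using that[of e g f p q] * perm by auto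
      qed
    qed
    have xy: "x \<noteq> y"
    proof
      assume "x = y"
      then have "{a, b, x} \<triangle> {b, c, y} = {a, c}" using fan by auto
      then show False using csp(3)[OF abx bcy] c2 by metis
    qed
    have inE: "a \<in> E" "b \<in> E" "c \<in> E" "x \<in> E" "y \<in> E" using abx bcy by (auto simp: cycles_def)
    have indep: "sp_indep E \<D> {a, b, c}"
      unfolding sp_indep_def
    proof (intro conjI allI impI)
      fix Y assume Y: "Y \<subseteq> {a, b, c}" "Y \<in> cycles E \<D>"
      have "Y \<noteq> {a, b, c}" using orthD[OF Y(2) T] fan by (auto simp: orth_triple)
      then have "card Y < card {a, b, c}" using Y(1) by (intro psubset_card_mono) auto
      then show "Y = {}" using simple[OF Y(2)] fan by simp
    qed (use inE in auto)
    have nocz: "{a, c, z} \<notin> cycles E \<D>" if "z \<noteq> a" "z \<noteq> c" for z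
    proof
      assume z: "{a, c, z} \<in> cycles E \<D>"
      have "z \<noteq> b" using orthD[OF z T] fan that by (auto simp: orth_triple)
      moreover have "z \<noteq> x"
      proof
        assume "z = x"
        then have "{a, b, x} \<triangle> {a, c, z} = {b, c}" using fan by auto
        then show False using csp(3)[OF abx z] c2 by metis
      qed
      moreover have "z \<noteq> y"
      proof
        assume "z = y"
        then have "{b, c, y} \<triangle> {a, c, z} = {a, b}" using fan by auto
        then show False using csp(3)[OF bcy z] c2 by metis
      qed
      ultimately have "has_K4 E \<D>"
        using has_K4_of_triangles[OF fin bs _ abx bcy z indep] fan xy that by auto
      then show False using noK4 by blast
    qed
    \<comment> \<open>Contracting \<open>a\<close> and deleting \<open>b\<close> does not destroy simplicity: by orthogonality with the triad,
      a triangle through \<open>a\<close> that avoids \<open>b\<close> contains \<open>c\<close>.\<close>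
    have nopar: False if Y: "Y \<subseteq> E - {a, b}" "card Y \<le> 2" "Y \<noteq> {}" "Y \<union> Z \<in> cycles E \<D>" "Z \<subseteq> {a}" for Y Z
    proof -
      have "Z \<noteq> {}" using simple[of Y] Y by auto
      then have YZ: "insert a Y \<in> cycles E \<D>" using Y by (metis Un_insert_right subset_singletonD sup_bot_right)
      have "finite Y" using Y(1) fin by (meson finite_Diff finite_subset)
      have "a \<notin> Y" "b \<notin> Y" using Y(1) by auto
      have "c \<in> Y"
      proof (rule ccontr)
        assume "c \<notin> Y"
        then have eq: "insert a Y \<inter> {a, b, c} = {a}" using \<open>b \<notin> Y\<close> fan by blast
        have "even (card {a})" using orthD[OF YZ T] unfolding orth_def eq .
        then show False by simp
      qed
      have "card (insert a Y) = Suc (card Y)" using \<open>a \<notin> Y\<close> \<open>finite Y\<close> by simp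
      then have "card Y = 2" using simple[OF YZ] Y(2) by fastforce
      then have "card (Y - {c}) = 1" using \<open>c \<in> Y\<close> \<open>finite Y\<close> by simp
      then obtain z where "Y - {c} = {z}" by (auto simp: card_1_singleton_iff)
      then have "insert a Y = {a, c, z}" "z \<noteq> c" "z \<noteq> a" using \<open>c \<in> Y\<close> \<open>a \<notin> Y\<close> by auto
      then show False using nocz YZ by metis
    qed
    \<comment> \<open>As the wheel reduction stays simple, it creates a short cocycle, which is a triad of the
      original matroid through \<open>b\<close>.\<close>
    have bxy: "{b, x, y} \<in> \<D>"
    proof -
      have "\<not> (\<exists>Y Z. Y \<subseteq> E - {a, b} \<and> Y \<noteq> {} \<and> card Y \<le> 2 \<and> Z \<subseteq> {a} \<and> Y \<union> Z \<in> cycles E \<D>)"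
        using nopar by blast
      moreover have "{a} \<inter> (E - {a, b}) = {}" "E - {a, b} \<subset> E" "E - {a, b} \<noteq> {}"
        using inE fan by auto
      ultimately obtain D where D: "D \<in> \<D>" "a \<notin> D" "D \<inter> (E - {a, b}) \<noteq> {}" "card (D \<inter> (E - {a, b})) \<le> 2"
        using reduce[of "{a}" "E - {a, b}"] inE by auto
      have Db: "D \<inter> (E - {a, b}) = D - {b}" using dsp(1)[OF D(1)] D(2) by blast
      have D2: "card (D - {b}) \<le> 2" using D(4) Db by simp
      have D3: "\<not> card D \<le> 2" using cosimple[OF D(1)] D(3) by blast
      have "b \<in> D" using D2 D3 by (cases "b \<in> D") simp_all
      then obtain f g where fg: "b \<noteq> f" "b \<noteq> g" "f \<noteq> g" "D = {b, f, g}"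
        using two[OF finD[OF D(1)] D2 D3] by blast
      have "x \<in> D" using orthD[OF abx D(1)] fan D(2) \<open>b \<in> D\<close> by (auto simp: orth_triple)
      moreover have "c \<in> D \<or> y \<in> D" using orthD[OF bcy D(1)] fan \<open>b \<in> D\<close> by (auto simp: orth_triple)
      ultimately have "D = {b, x, c} \<or> D = {b, x, y}" using fg fan xy by auto
      moreover have "D \<noteq> {b, x, c}"
      proof
        assume "D = {b, x, c}"
        then have "D \<triangle> {a, b, c} = {a, x}" using fan by auto
        then show False using dsp(3)[OF D(1) T] d2 by metis
      qed
      ultimately show ?thesis using D(1) by blast
    qed
    \<comment> \<open>Contract \<open>a\<close>, \<open>x\<close> and delete \<open>b\<close>, \<open>y\<close>; again simplicity is preserved.\<close>
    obtain p where p: "p \<notin> {a, b, c, x, y}" "{c, y, p} \<in> \<D>"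
    proof -
      have "\<not> (\<exists>Y Z. Y \<subseteq> E - {a, b, x, y} \<and> Y \<noteq> {} \<and> card Y \<le> 2 \<and> Z \<subseteq> {a, x} \<and> Y \<union> Z \<in> cycles E \<D>)"
      proof
        assume "\<exists>Y Z. Y \<subseteq> E - {a, b, x, y} \<and> Y \<noteq> {} \<and> card Y \<le> 2 \<and> Z \<subseteq> {a, x} \<and> Y \<union> Z \<in> cycles E \<D>"
        then obtain Y Z where Y: "Y \<subseteq> E - {a, b, x, y}" "Y \<noteq> {}" "card Y \<le> 2" "Z \<subseteq> {a, x}" "Y \<union> Z \<in> cycles E \<D>"
          by blast
        have "(Y \<union> Z) \<inter> {b, x, y} = Z \<inter> {x}" using Y fan by auto
        moreover have "even (card ((Y \<union> Z) \<inter> {b, x, y}))" using orthD[OF Y(5) bxy] by (simp add: orth_def)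
        ultimately have "even (card (Z \<inter> {x}))" by metis
        then have "x \<notin> Z" by (cases "x \<in> Z") auto
        then have "Z \<subseteq> {a}" using Y(4) by blast
        then show False using nopar[of Y Z] Y by blast
      qed
      moreover have CE: "{a, x} \<subseteq> E" using inE by simp
      moreover have disj: "{a, x} \<inter> (E - {a, b, x, y}) = {}" by blast
      moreover have sub: "E - {a, b, x, y} \<subset> E" using inE(1) by blast
      moreover have ne: "E - {a, b, x, y} \<noteq> {}" using inE(3) fan by blast
      ultimately have "\<exists>D\<in>\<D>. D \<inter> {a, x} = {} \<and> D \<inter> (E - {a, b, x, y}) \<noteq> {} \<and>
          card (D \<inter> (E - {a, b, x, y})) \<le> 2"
        using reduce[OF CE sub disj ne] by satx
      then obtain D where D: "D \<in> \<D>" "D \<inter> {a, x} = {}" "D \<inter> (E - {a, b, x, y}) \<noteq> {}"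
          "card (D \<inter> (E - {a, b, x, y})) \<le> 2" by (elim bexE conjE)
      have "b \<notin> D" using orthD[OF abx D(1)] fan D(2) by (auto simp: orth_triple)
      then have Dy: "D \<inter> (E - {a, b, x, y}) = D - {y}" using dsp(1)[OF D(1)] D(2) by blast
      have D2: "card (D - {y}) \<le> 2" using D(4) Dy by simp
      have D3: "\<not> card D \<le> 2" using cosimple[OF D(1)] D(3) by blast
      have "y \<in> D" using D2 D3 by (cases "y \<in> D") simp_all
      then obtain f g where fg: "y \<noteq> f" "y \<noteq> g" "f \<noteq> g" "D = {y, f, g}"
        using two[OF finD[OF D(1)] D2 D3] by blast
      have "c \<in> D" using orthD[OF bcy D(1)] fan \<open>b \<notin> D\<close> \<open>y \<in> D\<close> by (auto simp: orth_triple)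
      then obtain p where "D = {c, y, p}" "p \<noteq> c" "p \<noteq> y" using fg fan by auto
      then show thesis using that[of p] D \<open>b \<notin> D\<close> by auto
    qed
    have "p \<in> E" using dsp(1)[OF p(2)] by blast
    then obtain f g where fg: "p \<noteq> f" "p \<noteq> g" "f \<noteq> g" "{p, f, g} \<in> cycles E \<D>" using triangle by blast
    have "orth {p, f, g} {c, y, p}" by (rule orthD[OF fg(4) p(2)])
    then have one: "(f \<in> {c, y}) \<noteq> (g \<in> {c, y})" using fg p fan by (auto simp: orth_triple)
    have "{p, g, f} = {p, f, g}" by blast
    with one fg obtain q where q: "q \<notin> {p, c, y}" "{p, c, q} \<in> cycles E \<D> \<or> {p, y, q} \<in> cycles E \<D>"
      by auto metis+
    from q(2) show False
    proof
      assume pcq: "{p, c, q} \<in> cycles E \<D>"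
      have "q = a \<or> q = b" using orthD[OF pcq T] p(1) q(1) fan by (auto simp: orth_triple)
      then show False
      proof
        assume "q = a"
        then have "{p, c, q} = {a, c, p}" by auto
        then show False using nocz[of p] pcq p by auto
      next
        assume "q = b"
        then have "{p, c, q} \<triangle> {b, c, y} = {p, y}" using p(1) fan by auto
        then show False using csp(3)[OF pcq bcy] c2 by metis
      qed
    next
      assume pyq: "{p, y, q} \<in> cycles E \<D>"
      have "q = x \<or> q = b" using orthD[OF pyq bxy] p(1) q(1) fan xy by (auto simp: orth_triple)
      then show False
      proof
        assume "q = x"
        then have "({p, y, q} \<triangle> {a, b, x}) \<triangle> {b, c, y} = {a, c, p}" using p(1) fan xy by auto
        then show False using nocz[of p] csp(3)[OF csp(3)[OF pyq abx] bcy] p by auto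
      next
        assume "q = b"
        then have "{p, y, q} \<triangle> {b, c, y} = {p, c}" using p(1) fan by auto
        then show False using csp(3)[OF pyq bcy] c2 by metis
      qed
    qed
  qed
qed


section \<open>Orbits of injective maps\<close>

definition exit_time :: "('v \<Rightarrow> 'v) \<Rightarrow> 'v set \<Rightarrow> 'v \<Rightarrow> nat" where
  "exit_time h D x = (LEAST n. (h ^^ n) x \<notin> D)"

lemma orbit_inside: "k < exit_time h D x \<Longrightarrow> (h ^^ k) x \<in> D"
  unfolding exit_time_def using not_less_Least by blast

lemma orbit_cancel:
  assumes "inj_on h D" "\<And>k. k < i \<Longrightarrow> (h ^^ k) x \<in> D" "\<And>k. k < j \<Longrightarrow> (h ^^ k) y \<in> D"
    and "i \<le> j" "(h ^^ i) x = (h ^^ j) y"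
  shows "x = (h ^^ (j - i)) y"
  using assms(2-)
proof (induction i arbitrary: j)
  case (Suc i)
  then obtain j' where j: "j = Suc j'" by (cases j) auto
  have "(h ^^ i) x = (h ^^ j') y"
  proof (rule inj_onD[OF assms(1)])
    show "h ((h ^^ i) x) = h ((h ^^ j') y)" using Suc.prems(4) by (simp add: j)
    show "(h ^^ i) x \<in> D" by (rule Suc.prems(1)) simp
    show "(h ^^ j') y \<in> D" by (rule Suc.prems(2)) (simp add: j)
  qed
  then have "x = (h ^^ (j' - i)) y"
  proof (rule Suc.IH[rotated -1])
    show "(h ^^ k) x \<in> D" if "k < i" for k using that by (intro Suc.prems(1)) simp
    show "(h ^^ k) y \<in> D" if "k < j'" for k using that by (intro Suc.prems(2)) (simp add: j)
    show "i \<le> j'" using Suc.prems(3) by (simp add: j)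
  qed
  then show ?case by (simp add: j)
qed simp

text \<open>
  Points outside the range of \<open>h\<close> start orbits, and by injectivity two orbits that meet can be traced
  back to the same start. Alternating paths of two matchings and the paths of a linking are such orbits.
\<close>

lemma orbit_eq:
  assumes "inj_on h D" "x \<notin> h ` D" "y \<notin> h ` D"
    and "\<And>k. k < i \<Longrightarrow> (h ^^ k) x \<in> D" "\<And>k. k < j \<Longrightarrow> (h ^^ k) y \<in> D" "(h ^^ i) x = (h ^^ j) y"
  shows "x = y \<and> i = j"
proof -
  have le: "x = y \<and> i = j" if "i \<le> j" "x \<notin> h ` D"
    "\<And>k. k < i \<Longrightarrow> (h ^^ k) x \<in> D" "\<And>k. k < j \<Longrightarrow> (h ^^ k) y \<in> D" "(h ^^ i) x = (h ^^ j) y" for x y i j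
  proof -
    have x: "x = (h ^^ (j - i)) y" using orbit_cancel[OF assms(1) that(3,4,1,5)] by blast
    have "j - i = 0"
    proof (rule ccontr)
      assume "j - i \<noteq> 0"
      then obtain m where m: "j - i = Suc m" by (cases "j - i") auto
      then have "x = h ((h ^^ m) y)" "(h ^^ m) y \<in> D" using x that(4)[of m] by auto
      then show False using that(2) by blast
    qed
    then show ?thesis using x that(1) by simp
  qed
  show ?thesis
  proof (cases "i \<le> j")
    case True
    then show ?thesis using le[OF True assms(2,4,5,6)] by blast
  next
    case False
    then have "j \<le> i" by simp
    from le[OF this assms(3,5,4) assms(6)[symmetric]] show ?thesis by simp
  qed
qed

lemma orbit_exits:
  assumes "finite D" "inj_on h D" "x \<notin> h ` D"
  shows "(h ^^ exit_time h D x) x \<notin> D"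
proof -
  have "\<exists>n. (h ^^ n) x \<notin> D"
  proof (rule ccontr)
    assume "\<not> ?thesis"
    then have all: "(h ^^ n) x \<in> D" for n by blast
    then have "inj (\<lambda>n. (h ^^ n) x)"
      using orbit_eq[OF assms(2,3,3) all all] by (intro injI) simp
    then have "infinite (range (\<lambda>n. (h ^^ n) x))" using range_inj_infinite by blast
    moreover have "range (\<lambda>n. (h ^^ n) x) \<subseteq> D" using all by blast
    ultimately show False using assms(1) finite_subset by blast
  qed
  then show ?thesis unfolding exit_time_def by (rule LeastI_ex)
qed

lemma orbit_exit_eq:
  assumes "inj_on h D" "x \<notin> h ` D" "y \<notin> h ` D"
    and "i \<le> exit_time h D x" "j \<le> exit_time h D y" "(h ^^ i) x = (h ^^ j) y"
  shows "x = y \<and> i = j"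
proof (rule orbit_eq[OF assms(1-3) _ _ assms(6)])
  show "(h ^^ k) x \<in> D" if "k < i" for k using that assms(4) by (intro orbit_inside) simp
  show "(h ^^ k) y \<in> D" if "k < j" for k using that assms(5) by (intro orbit_inside) simp
qed


section \<open>Matchings\<close>

text \<open>
  If \<open>L\<close> can be matched at all, these sets \<open>Z\<close> are the independent sets of the dual of the transversal
  matroid presented by the sets \<open>N l\<close>.
\<close>

definition matched_off :: "'l set \<Rightarrow> ('l \<Rightarrow> 'v set) \<Rightarrow> 'v set \<Rightarrow> bool" where
  "matched_off L N Z \<longleftrightarrow> (\<exists>g. inj_on g L \<and> (\<forall>l\<in>L. g l \<in> N l) \<and> Z \<inter> g ` L = {})"

lemma matched_offI:
  assumes "inj_on g L" "\<forall>l\<in>L. g l \<in> N l" "\<And>l. l \<in> L \<Longrightarrow> g l \<notin> Z"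
  shows "matched_off L N Z"
  unfolding matched_off_def using assms by (intro exI[of _ g]) auto

lemma matched_off_mono: "matched_off L N Z \<Longrightarrow> Z' \<subseteq> Z \<Longrightarrow> matched_off L N Z'"
  unfolding matched_off_def by blast

lemma matched_off_insert_fresh:
  assumes "\<And>l. l \<in> L \<Longrightarrow> v \<notin> N l"
  shows "matched_off L N (insert v Z) \<longleftrightarrow> matched_off L N Z"
proof -
  have "v \<notin> g ` L" if "\<forall>l\<in>L. g l \<in> N l" for g using that assms by auto
  then show ?thesis unfolding matched_off_def by (intro ex_cong1 conj_cong refl) simp
qed

lemma matched_off_insert_left:
  assumes "l \<notin> L"
  shows "matched_off (insert l L) (N(l := A)) Z \<longleftrightarrow> (\<exists>w\<in>A - Z. matched_off L N (insert w Z))"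
proof
  assume "matched_off (insert l L) (N(l := A)) Z"
  then obtain g where g: "inj_on g (insert l L)" "\<forall>m\<in>insert l L. g m \<in> (N(l := A)) m"
    "Z \<inter> g ` insert l L = {}"
    unfolding matched_off_def by blast
  have "g l \<in> A - Z" using g by auto
  moreover have "inj_on g L" using g(1) by (rule inj_on_subset) blast
  moreover have "\<forall>m\<in>L. g m \<in> N m"
  proof
    fix m assume "m \<in> L"
    then show "g m \<in> N m" using bspec[OF g(2), of m] assms by (cases "m = l") simp_all
  qed
  moreover have "insert (g l) Z \<inter> g ` L = {}" using g(1,3) assms by (auto simp: inj_on_def)
  ultimately show "\<exists>w\<in>A - Z. matched_off L N (insert w Z)" unfolding matched_off_def by blast
next
  assume "\<exists>w\<in>A - Z. matched_off L N (insert w Z)"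
  then obtain w g where w: "w \<in> A - Z" and g: "inj_on g L" "\<forall>m\<in>L. g m \<in> N m" "insert w Z \<inter> g ` L = {}"
    unfolding matched_off_def by blast
  have img: "(g(l := w)) ` L = g ` L" using assms by auto
  have "inj_on (g(l := w)) (insert l L)"
    using g assms img by (auto simp: inj_on_def)
  moreover have "\<forall>m\<in>insert l L. (g(l := w)) m \<in> (N(l := A)) m" using g w assms by auto
  moreover have "Z \<inter> (g(l := w)) ` insert l L = {}" using g w img by auto
  ultimately show "matched_off (insert l L) (N(l := A)) Z" unfolding matched_off_def by blast
qed

text \<open>
  Overlay the two matchings \<open>g1\<close> and \<open>g2\<close>. A vertex \<open>x\<close> of \<open>Z1\<close> is not covered by \<open>g1\<close>, so it starts
  an alternating path: \<open>h\<close> leads from a vertex along its \<open>g2\<close>-edge and then along the \<open>g1\<close>-edge at the same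
  left vertex. The path ends at a vertex \<open>f x\<close> not covered by \<open>g2\<close>. Swapping the two matchings along
  it frees \<open>f x\<close> and covers \<open>x\<close> in \<open>g1\<close>, and the other way round in \<open>g2\<close>.
\<close>

lemma matched_off_exchange:
  assumes "finite L" "matched_off L N Z1" "matched_off L N Z2"
  shows "\<exists>f. inj_on f Z1 \<and> (\<forall>x\<in>Z1. (x \<in> Z2 \<longrightarrow> f x = x) \<and>
    matched_off L N (insert (f x) (Z1 - {x})) \<and> matched_off L N (insert x (Z2 - {f x})))"
proof -
  obtain g1 where g1: "inj_on g1 L" "\<forall>l\<in>L. g1 l \<in> N l" "Z1 \<inter> g1 ` L = {}"
    using assms(2) unfolding matched_off_def by blast
  obtain g2 where g2: "inj_on g2 L" "\<forall>l\<in>L. g2 l \<in> N l" "Z2 \<inter> g2 ` L = {}"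
    using assms(3) unfolding matched_off_def by blast
  define D where "D = g2 ` L"
  define h where "h v = g1 (inv_into L g2 v)" for v
  have hg: "h (g2 l) = g1 l" if "l \<in> L" for l using that g2(1) by (simp add: h_def)
  have injh: "inj_on h D"
    unfolding D_def using g1(1) hg by (auto simp: inj_on_def)
  have hD: "h ` D = g1 ` L" unfolding D_def image_image using hg by (auto simp: image_iff)
  have finD: "finite D" using assms(1) by (simp add: D_def)
  define n where "n x = exit_time h D x" for x
  define f where "f x = (h ^^ n x) x" for x
  have start: "x \<notin> h ` D" if "x \<in> Z1" for x using that g1(3) hD by blast
  have inD: "(h ^^ k) x \<in> D" if "k < n x" for k x using that orbit_inside by (simp add: n_def)
  have outD: "f x \<notin> D" if "x \<in> Z1" for x
    using orbit_exits[OF finD injh start[OF that]] by (simp add: f_def n_def)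
  have eq: "x = y \<and> i = j" if "x \<in> Z1" "y \<in> Z1" "i \<le> n x" "j \<le> n y" "(h ^^ i) x = (h ^^ j) y" for x y i j
    using orbit_exit_eq[OF injh start start, of x y i j] that by (simp add: n_def)
  have "inj_on f Z1"
    using eq unfolding f_def by (intro inj_onI) blast
  moreover have "f x = x" if "x \<in> Z1" "x \<in> Z2" for x
  proof -
    have "x \<notin> D" using that g2(3) by (auto simp: D_def)
    then have "n x = 0" using inD[of 0 x] by fastforce
    then show ?thesis by (simp add: f_def)
  qed
  moreover have "matched_off L N (insert (f x) (Z1 - {x})) \<and> matched_off L N (insert x (Z2 - {f x}))"
    if x: "x \<in> Z1" for x
  proof -
    \<comment> \<open>\<open>P\<close> is the alternating path without its last vertex; \<open>g1'\<close> and \<open>g2'\<close> are the swapped matchings.\<close>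
    define P where "P = (\<lambda>k. (h ^^ k) x) ` {..<n x}"
    define g1' where "g1' l = (if g2 l \<in> P then g2 l else g1 l)" for l
    define g2' where "g2' l = (if g2 l \<in> P then g1 l else g2 l)" for l
    have off1: "g1 l \<noteq> (h ^^ k) x" if l: "l \<in> L" "g2 l \<notin> P" and k: "k \<le> n x" for l k
    proof
      assume e: "g1 l = (h ^^ k) x"
      have "k \<noteq> 0" using e start[OF x] hD l(1) by (metis funpow_0 image_eqI)
      then obtain m where m: "k = Suc m" by (cases k) auto
      then have "h (g2 l) = h ((h ^^ m) x)" using e hg[OF l(1)] by simp
      then have "g2 l = (h ^^ m) x"
      proof (rule inj_onD[OF injh])
        show "g2 l \<in> D" using l(1) by (simp add: D_def)
        show "(h ^^ m) x \<in> D" using m k by (intro inD) simp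
      qed
      moreover have "(h ^^ m) x \<in> P" unfolding P_def using m k by (intro imageI) simp
      ultimately show False using l(2) by simp
    qed
    have off2: "g2 l \<noteq> (h ^^ k) x" if l: "l \<in> L" "g2 l \<notin> P" and k: "k \<le> n x" for l k
    proof
      assume e: "g2 l = (h ^^ k) x"
      have "(h ^^ k) x \<in> P" if "k < n x" unfolding P_def using that by (intro imageI) simp
      then have "k = n x" using l(2) k unfolding e by (cases "k < n x") simp_all
      moreover have "g2 l \<in> D" using l(1) by (simp add: D_def)
      ultimately show False using outD[OF x] unfolding f_def e by simp
    qed
    have on1: "\<exists>k<n x. g2 l = (h ^^ k) x" if "g2 l \<in> P" for l using that by (auto simp: P_def)
    have on2: "\<exists>k<n x. g1 l = (h ^^ Suc k) x" if "g2 l \<in> P" "l \<in> L" for l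
      using on1[OF that(1)] hg[OF that(2)] by auto
    have "inj_on g1' L"
    proof (rule inj_onI)
      fix l m assume lm: "l \<in> L" "m \<in> L" "g1' l = g1' m"
      have False if "l \<in> L" "m \<in> L" "g2 l \<in> P" "g2 m \<notin> P" "g2 l = g1 m" for l m
        using on1[OF that(3)] off1[OF that(2,4)] that(5) by (metis less_imp_le)
      then have "(g2 l \<in> P) = (g2 m \<in> P)" using lm unfolding g1'_def by (metis (full_types))
      then show "l = m" using lm g1(1) g2(1) by (auto simp: g1'_def inj_on_def split: if_splits)
    qed
    moreover have "\<forall>l\<in>L. g1' l \<in> N l" using g1(2) g2(2) by (simp add: g1'_def)
    moreover have "g1' l \<notin> insert (f x) (Z1 - {x})" if l: "l \<in> L" for l
    proof (cases "g2 l \<in> P")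
      case True
      then obtain k where k: "k < n x" "g2 l = (h ^^ k) x" using on1 by blast
      have "g2 l \<noteq> f x" using k eq[OF x x, of k "n x"] by (auto simp: f_def)
      moreover have "z = x" if "z \<in> Z1" "z = g2 l" for z
        using eq[OF that(1) x, of 0 k] k that(2) by simp
      ultimately show ?thesis using True by (auto simp: g1'_def)
    next
      case False
      then show ?thesis using off1[OF l False, of "n x"] g1(3) l by (auto simp: g1'_def f_def)
    qed
    ultimately have m1: "matched_off L N (insert (f x) (Z1 - {x}))"
      by (rule matched_offI)
    have "inj_on g2' L"
    proof (rule inj_onI)
      fix l m assume lm: "l \<in> L" "m \<in> L" "g2' l = g2' m"
      have False if "l \<in> L" "m \<in> L" "g2 l \<in> P" "g2 m \<notin> P" "g1 l = g2 m" for l m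
        using on2[OF that(3,1)] off2[OF that(2,4)] that(5) by (metis Suc_leI)
      then have "(g2 l \<in> P) = (g2 m \<in> P)" using lm unfolding g2'_def by (metis (full_types))
      then show "l = m" using lm g1(1) g2(1) by (auto simp: g2'_def inj_on_def split: if_splits)
    qed
    moreover have "\<forall>l\<in>L. g2' l \<in> N l" using g1(2) g2(2) by (simp add: g2'_def)
    moreover have "g2' l \<notin> insert x (Z2 - {f x})" if l: "l \<in> L" for l
    proof (cases "g2 l \<in> P")
      case True
      then obtain k where k: "k < n x" "g1 l = (h ^^ Suc k) x" using on2 l by blast
      have "g1 l \<noteq> x" using k eq[OF x x, of "Suc k" 0] by auto
      moreover have "g1 l \<notin> Z2 - {f x}"
      proof (cases "Suc k = n x")
        case True
        then show ?thesis using k by (simp add: f_def)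
      next
        case False
        then have "g1 l \<in> g2 ` L" using inD[of "Suc k" x] k by (simp add: D_def)
        then show ?thesis using g2(3) by blast
      qed
      ultimately show ?thesis using True by (simp add: g2'_def)
    next
      case False
      then show ?thesis using off2[OF l False, of 0] g2(3) l by (auto simp: g2'_def)
    qed
    ultimately have m2: "matched_off L N (insert x (Z2 - {f x}))"
      by (rule matched_offI)
    show ?thesis using m1 m2 by blast
  qed
  ultimately show ?thesis by blast
qed


section \<open>Linkings\<close>

text \<open>
  The vertex itself is included because it gets matched to itself if no path of a linking uses it.
\<close>

definition out_nbrs :: "('v, 'b) pre_digraph \<Rightarrow> 'v \<Rightarrow> 'v set" where
  "out_nbrs G v = insert v {w. \<exists>e\<in>arcs G. tail G e = v \<and> head G e = w}"

context fin_digraph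
begin

lemma out_nbrs_finite: "finite (out_nbrs G v)"
proof -
  have "out_nbrs G v \<subseteq> insert v (head G ` arcs G)" by (auto simp: out_nbrs_def)
  then show ?thesis using finite_arcs by (meson finite_imageI finite_insert finite_subset)
qed

lemma orbit_awalk:
  assumes "x \<in> verts G"
    and "\<And>k. k < n \<Longrightarrow> a k \<in> arcs G \<and> tail G (a k) = (h ^^ k) x \<and> head G (a k) = (h ^^ Suc k) x"
  shows "awalk x (map a [0..<n]) ((h ^^ n) x) \<and>
    awalk_verts x (map a [0..<n]) = map (\<lambda>k. (h ^^ k) x) [0..<Suc n]"
proof -
  have "awalk x (map a [0..<n]) ((h ^^ n) x)" using assms(2)
  proof (induction n)
    case 0
    then show ?case using assms(1) by (simp add: awalk_Nil_iff)
  next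
    case (Suc n)
    have "awalk ((h ^^ n) x) [a n] ((h ^^ Suc n) x)"
      using Suc.prems[of n] arc_implies_awalk[of "a n"] by simp
    then have "awalk x (map a [0..<n] @ [a n]) ((h ^^ Suc n) x)"
      using Suc by (intro awalk_appendI) auto
    then show ?case by simp
  qed
  moreover have "awalk_verts x (map a [0..<n]) = map (\<lambda>k. (h ^^ k) x) [0..<Suc n]"
  proof (cases n)
    case (Suc m)
    have "map (tail G) (map a [0..<n]) = map (\<lambda>k. (h ^^ k) x) [0..<n]"
      using assms(2) by simp
    moreover have "head G (last (map a [0..<n])) = (h ^^ n) x"
      using assms(2)[of m] Suc by simp
    ultimately show ?thesis using Suc by (simp add: awalk_verts_conv)
  qed simp
  ultimately show ?thesis by blast
qed

text \<open>
  Follow the matching \<open>h\<close> from each vertex of \<open>Z\<close> until it leaves the vertices outside \<open>S\<close>. Starting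
  points are not in the range of \<open>h\<close>, so no step stays in place, and each step is an arc.
\<close>

lemma linked_into_if_matched:
  assumes "S \<subseteq> verts G" "Z \<subseteq> verts G" "matched_off (verts G - S) (out_nbrs G) Z"
  shows "linked_into G Z S"
proof -
  define L where "L = verts G - S"
  obtain h where h: "inj_on h L" "\<forall>v\<in>L. h v \<in> out_nbrs G v" "Z \<inter> h ` L = {}"
    using assms(3) unfolding matched_off_def L_def by blast
  have finL: "finite L" by (simp add: L_def)
  define n where "n x = exit_time h L x" for x
  define ar where "ar v = (SOME e. e \<in> arcs G \<and> tail G e = v \<and> head G e = h v)" for v
  define p where "p x = map (\<lambda>k. ar ((h ^^ k) x)) [0..<n x]" for x
  have start: "x \<notin> h ` L" if "x \<in> Z" for x using that h(3) by blast
  have inL: "(h ^^ k) x \<in> L" if "k < n x" for k x using that orbit_inside by (simp add: n_def)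
  have eq: "x = y \<and> i = j" if "x \<in> Z" "y \<in> Z" "i \<le> n x" "j \<le> n y" "(h ^^ i) x = (h ^^ j) y" for x y i j
    using orbit_exit_eq[OF h(1) start start, of x y i j] that by (simp add: n_def)
  have ar: "ar ((h ^^ k) x) \<in> arcs G \<and> tail G (ar ((h ^^ k) x)) = (h ^^ k) x \<and>
      head G (ar ((h ^^ k) x)) = (h ^^ Suc k) x" if "x \<in> Z" "k < n x" for x k
  proof -
    have "h ((h ^^ k) x) \<noteq> (h ^^ k) x" using eq[of x x "Suc k" k] that by auto
    moreover have "h ((h ^^ k) x) \<in> out_nbrs G ((h ^^ k) x)" using inL that h(2) by blast
    ultimately have "\<exists>e. e \<in> arcs G \<and> tail G e = (h ^^ k) x \<and> head G e = h ((h ^^ k) x)"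
      by (auto simp: out_nbrs_def)
    from someI_ex[OF this] show ?thesis unfolding ar_def by simp
  qed
  have walk: "awalk x (p x) ((h ^^ n x) x)" "awalk_verts x (p x) = map (\<lambda>k. (h ^^ k) x) [0..<Suc (n x)]"
    if "x \<in> Z" for x
    using orbit_awalk[of x "n x" "\<lambda>k. ar ((h ^^ k) x)" h] ar[OF that] that assms(2)
    unfolding p_def by blast+
  have "\<exists>s\<in>S. apath x (p x) s" if x: "x \<in> Z" for x
  proof -
    have "(h ^^ n x) x \<in> verts G" using walk(1)[OF x] by (rule awalk_last_in_verts)
    moreover have "(h ^^ n x) x \<notin> L" using orbit_exits[OF finL h(1) start[OF x]] by (simp add: n_def)
    ultimately have "(h ^^ n x) x \<in> S" by (simp add: L_def)
    moreover have "distinct (awalk_verts x (p x))"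
      unfolding walk(2)[OF x] distinct_map using eq[OF x x] by (auto simp: inj_on_def)
    ultimately show ?thesis using walk(1)[OF x] by (auto simp: apath_def)
  qed
  moreover have "set (awalk_verts x (p x)) \<inter> set (awalk_verts y (p y)) = {}"
    if "x \<in> Z" "y \<in> Z" "x \<noteq> y" for x y
  proof (rule ccontr)
    note w = walk(2)[OF that(1)] walk(2)[OF that(2)]
    assume "\<not> ?thesis"
    then obtain i j where ij: "i < Suc (n x)" "j < Suc (n y)" "(h ^^ i) x = (h ^^ j) y"
      unfolding w set_map set_upt by fastforce
    then have "x = y" using eq[OF that(1,2) _ _ ij(3)] by simp
    then show False using that(3) by blast
  qed
  ultimately show ?thesis unfolding linked_into_def by blast
qed

lemma awalk_verts_consecutive:
  assumes "awalk u p v" "i < length p"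
  shows "awalk_verts u p ! i = tail G (p ! i)" "awalk_verts u p ! Suc i = head G (p ! i)"
proof -
  have ne: "p \<noteq> []" using assms(2) by auto
  show "awalk_verts u p ! i = tail G (p ! i)"
    using assms(2) ne by (simp add: awalk_verts_conv nth_append)
  have "cas u p v" using assms(1) by (simp add: awalk_def)
  then show "awalk_verts u p ! Suc i = head G (p ! i)"
    using assms(2) ne by (simp add: awalk_verts_conv')
qed

text \<open>
  Match a vertex outside \<open>S\<close> to its successor on the path through it, or to itself if it lies on no path.
  A path cannot end outside \<open>S\<close>, so only starting points and vertices of \<open>S\<close> remain uncovered.
\<close>

lemma matched_if_linked_into:
  assumes "Z \<subseteq> verts G" "linked_into G Z S"
  shows "matched_off (verts G - S) (out_nbrs G) Z"
proof -
  obtain p where p: "\<And>x. x \<in> Z \<Longrightarrow> \<exists>s\<in>S. apath x (p x) s"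
    and disj: "\<And>x y. x \<in> Z \<Longrightarrow> y \<in> Z \<Longrightarrow> x \<noteq> y \<Longrightarrow>
      set (awalk_verts x (p x)) \<inter> set (awalk_verts y (p y)) = {}"
    using assms(2) unfolding linked_into_def by blast
  define P where "P x = awalk_verts x (p x)" for x
  have same: "x = y \<and> i = j" if "x \<in> Z" "y \<in> Z" "i < length (P x)" "j < length (P y)" "P x ! i = P y ! j" for x y i j
  proof -
    have "P x ! i \<in> set (P x)" "P x ! i \<in> set (P y)" using that by (auto simp: in_set_conv_nth)
    then have xy: "x = y" using disj[of x y] that(1,2) by (auto simp: P_def)
    moreover have "distinct (P x)" using p[OF that(1)] by (auto simp: P_def apath_def)
    ultimately show ?thesis using that nth_eq_iff_index_eq by blast
  qed
  have len: "length (P x) = Suc (length (p x))" for x by (simp add: P_def length_awalk_verts)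
  have first: "P x ! 0 = x" if "x \<in> Z" for x
  proof -
    from p[OF that] obtain s where "awalk x (p x) s" by (auto simp: apath_def)
    then have "hd (P x) = x" unfolding P_def by (rule awhd_of_awalk)
    then show ?thesis by (simp add: hd_conv_nth P_def)
  qed
  have last: "P x ! length (p x) \<in> S" if "x \<in> Z" for x
  proof -
    from p[OF that] obtain s where "awalk x (p x) s" "s \<in> S" by (auto simp: apath_def)
    then have "last (P x) \<in> S" unfolding P_def by auto
    then show ?thesis using len[of x] by (simp add: last_conv_nth P_def)
  qed
  have arc: "P x ! Suc i \<in> out_nbrs G (P x ! i)" if "x \<in> Z" "i < length (p x)" for x i
  proof -
    from p[OF that(1)] obtain s where w: "awalk x (p x) s" by (auto simp: apath_def)
    then have "p x ! i \<in> arcs G" using that(2) by (auto simp: awalk_def)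
    then show ?thesis
      using awalk_verts_consecutive[OF w that(2)] unfolding P_def out_nbrs_def by auto
  qed
  define R where "R v w \<longleftrightarrow> (\<exists>x\<in>Z. \<exists>i<length (p x). v = P x ! i \<and> w = P x ! Suc i)" for v w
  define h where "h v = (if \<exists>w. R v w then SOME w. R v w else v)" for v
  have hR: "R v (h v)" if "R v w" for v w unfolding h_def using that by (auto intro: someI)
  have hid: "h v = v" if "\<not> (\<exists>w. R v w)" for v using that by (simp add: h_def)
  have on_path: "\<exists>w. R (P x ! i) w" if "x \<in> Z" "i < length (P x)" "P x ! i \<notin> S" for x i
  proof -
    have "i \<noteq> length (p x)" using last[OF that(1)] that(3) by auto
    then have "i < length (p x)" using that(2) len[of x] by simp
    then show ?thesis unfolding R_def using that(1) by blast
  qed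
  have Rinj: "u = v" if "R u w" "R v w" for u v w
  proof -
    obtain x i where x: "x \<in> Z" "i < length (p x)" "u = P x ! i" "w = P x ! Suc i" using \<open>R u w\<close> unfolding R_def by blast
    obtain y j where y: "y \<in> Z" "j < length (p y)" "v = P y ! j" "w = P y ! Suc j" using \<open>R v w\<close> unfolding R_def by blast
    have "x = y \<and> Suc i = Suc j" using same[of x y "Suc i" "Suc j"] x y len by simp
    then show ?thesis using x y by simp
  qed
  have Rtarget: "\<exists>w'. R w w'" if "R u w" "w \<notin> S" for u w
    using that on_path len unfolding R_def by (metis Suc_less_eq)
  have "inj_on h (verts G - S)"
  proof (rule inj_onI)
    fix u v assume uv: "u \<in> verts G - S" "v \<in> verts G - S" "h u = h v"
    show "u = v"
    proof (cases "\<exists>w. R u w"; cases "\<exists>w. R v w")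
      assume "\<exists>w. R u w" "\<exists>w. R v w"
      then show ?thesis using hR Rinj uv(3) by metis
    next
      assume a: "\<exists>w. R u w" "\<not> (\<exists>w. R v w)"
      then have "R u v" using hR hid uv(3) by metis
      then show ?thesis using Rtarget a(2) uv(2) by blast
    next
      assume a: "\<not> (\<exists>w. R u w)" "\<exists>w. R v w"
      then have "R v u" using hR hid uv(3) by metis
      then show ?thesis using Rtarget a(1) uv(1) by blast
    next
      assume "\<not> (\<exists>w. R u w)" "\<not> (\<exists>w. R v w)"
      then show ?thesis using hid uv(3) by metis
    qed
  qed
  moreover have "\<forall>v\<in>verts G - S. h v \<in> out_nbrs G v"
  proof
    fix v
    show "h v \<in> out_nbrs G v"
    proof (cases "\<exists>w. R v w")
      case True
      then have "R v (h v)" using hR by blast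
      then obtain x i where "x \<in> Z" "i < length (p x)" "v = P x ! i" "h v = P x ! Suc i"
        unfolding R_def by blast
      then show ?thesis using arc by metis
    next
      case False
      then show ?thesis using hid by (simp add: out_nbrs_def)
    qed
  qed
  moreover have "h v \<notin> Z" if v: "v \<in> verts G - S" for v
  proof
    assume hv: "h v \<in> Z"
    have len0: "0 < length (P (h v))" using len by simp
    show False
    proof (cases "\<exists>w. R v w")
      case True
      then have "R v (h v)" using hR by blast
      then obtain x i where x: "x \<in> Z" "i < length (p x)" "h v = P x ! Suc i"
        unfolding R_def by blast
      have "P (h v) ! 0 = P x ! Suc i" using first[OF hv] x(3) by simp
      moreover have "Suc i < length (P x)" using x(2) len by simp
      ultimately have "0 = Suc i" using same[OF hv x(1) len0] by blast
      then show False by simp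
    next
      case False
      then have "h v = v" by (rule hid)
      then show False using on_path[OF hv len0] first[OF hv] v False by auto
    qed
  qed
  ultimately show ?thesis by (rule matched_offI)
qed

text \<open>
  The linkage lemma of Ingleton and Piff: a strict gammoid is the dual of a transversal matroid.
\<close>

lemma linked_into_iff_matched:
  assumes "S \<subseteq> verts G" "Z \<subseteq> verts G"
  shows "linked_into G Z S \<longleftrightarrow> matched_off (verts G - S) (out_nbrs G) Z"
  using linked_into_if_matched[OF assms] matched_if_linked_into[OF assms(2)] by blast

end

section \<open>Gammoids\<close>

text \<open>
  Vertices outside the range of \<open>\<phi>\<close> are allowed. They account for deleted elements and
  thus for the difference between strict gammoids and gammoids.
\<close>

definition match_presented :: "'a set \<Rightarrow> ('a set \<Rightarrow> bool) \<Rightarrow> bool" where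
  "match_presented E I \<longleftrightarrow> (\<exists>(L :: nat set) (N :: nat \<Rightarrow> nat set) \<phi>. finite L \<and> (\<forall>l\<in>L. finite (N l)) \<and>
     inj_on \<phi> E \<and> (\<forall>X\<subseteq>E. I X \<longleftrightarrow> matched_off L N (\<phi> ` X)))"

lemma match_presented_if_gammoid:
  assumes "gammoid M"
  shows "match_presented (ground M) (\<lambda>X. X \<in> indeps M)"
proof -
  obtain G :: "(nat, nat) pre_digraph" and S T where G: "fin_digraph G" and ST: "S \<subseteq> verts G" "T \<subseteq> verts G"
    and iso: "matroid_iso M (gammoid_of G S T)"
    using assms unfolding gammoid_def by blast
  interpret fin_digraph G by (rule G)
  obtain \<phi> where bij: "bij_betw \<phi> (ground M) T"
    and ind: "\<And>X. X \<subseteq> ground M \<Longrightarrow> X \<in> indeps M \<longleftrightarrow> \<phi> ` X \<in> indeps (gammoid_of G S T)"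
    using iso unfolding matroid_iso_def by (auto simp: gammoid_of_def)
  have "X \<in> indeps M \<longleftrightarrow> matched_off (verts G - S) (out_nbrs G) (\<phi> ` X)" if X: "X \<subseteq> ground M" for X
  proof -
    have "\<phi> ` X \<subseteq> T" using bij X by (auto simp: bij_betw_def)
    then show ?thesis
      using ind[OF X] linked_into_iff_matched[OF ST(1), of "\<phi> ` X"] ST(2) by (auto simp: gammoid_of_def)
  qed
  then show ?thesis
    unfolding match_presented_def using bij out_nbrs_finite
    by (intro exI[of _ "verts G - S"] exI[of _ "out_nbrs G"] exI[of _ \<phi>]) (auto simp: bij_betw_def)
qed

text \<open>
  The empty set is independent, so some matching \<open>g0\<close> of \<open>L\<close> exists. It identifies each left vertex
  with one of its neighbours, and the remaining vertices form the target set \<open>S\<close> of the digraph.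
\<close>

lemma gammoid_if_match_presented:
  assumes "matroid M" "match_presented (ground M) (\<lambda>X. X \<in> indeps M)"
  shows "gammoid M"
proof -
  obtain L :: "nat set" and N :: "nat \<Rightarrow> nat set" and \<phi> where fin: "finite L" "\<forall>l\<in>L. finite (N l)"
    and inj: "inj_on \<phi> (ground M)"
    and ind: "\<And>X. X \<subseteq> ground M \<Longrightarrow> X \<in> indeps M \<longleftrightarrow> matched_off L N (\<phi> ` X)"
    using assms(2) unfolding match_presented_def by blast
  have "matched_off L N {}" using ind[of "{}"] matroid.empty_indep[OF assms(1)] by simp
  then obtain g0 where g0: "inj_on g0 L" "\<forall>l\<in>L. g0 l \<in> N l" unfolding matched_off_def by blast
  define V where "V = \<phi> ` ground M \<union> (\<Union>l\<in>L. N l)"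
  define G :: "(nat, nat) pre_digraph" where "G = \<lparr>verts = V,
    arcs = prod_encode ` (\<Union>l\<in>L. (\<lambda>w. (g0 l, w)) ` N l),
    tail = fst \<circ> prod_decode, head = snd \<circ> prod_decode\<rparr>"
  define S where "S = V - g0 ` L"
  have finV: "finite V" using fin matroid.finite_ground[OF assms(1)] by (simp add: V_def)
  have gV: "g0 ` L \<subseteq> V" using g0(2) by (auto simp: V_def)
  interpret fin_digraph G
    by standard (use finV fin g0 in \<open>auto simp: G_def V_def\<close>)
  have out: "out_nbrs G (g0 l) = N l" if "l \<in> L" for l
  proof -
    have "{w. \<exists>e\<in>arcs G. tail G e = g0 l \<and> head G e = w} = N l"
      using that g0(1) by (auto simp: G_def inj_on_def)
    then show ?thesis using that g0(2) unfolding out_nbrs_def by auto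
  qed
  have vS: "verts G - S = g0 ` L" using gV by (auto simp: G_def S_def)
  have match: "matched_off (g0 ` L) (out_nbrs G) Z \<longleftrightarrow> matched_off L N Z" for Z
  proof
    assume "matched_off (g0 ` L) (out_nbrs G) Z"
    then obtain h where h: "inj_on h (g0 ` L)" "\<forall>v\<in>g0 ` L. h v \<in> out_nbrs G v" "Z \<inter> h ` g0 ` L = {}"
      unfolding matched_off_def by blast
    then have "inj_on (h \<circ> g0) L" "\<forall>l\<in>L. (h \<circ> g0) l \<in> N l" "Z \<inter> (h \<circ> g0) ` L = {}"
      using g0(1) out by (auto intro: comp_inj_on simp: image_comp)
    then show "matched_off L N Z" unfolding matched_off_def by blast
  next
    assume "matched_off L N Z"
    then obtain g where g: "inj_on g L" "\<forall>l\<in>L. g l \<in> N l" "Z \<inter> g ` L = {}"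
      unfolding matched_off_def by blast
    define h where "h v = g (inv_into L g0 v)" for v
    have hg: "h (g0 l) = g l" if "l \<in> L" for l using that g0(1) by (simp add: h_def)
    have "inj_on h (g0 ` L)" using g(1) hg by (auto simp: inj_on_def)
    moreover have "\<forall>v\<in>g0 ` L. h v \<in> out_nbrs G v" using g(2) hg out by auto
    moreover have "Z \<inter> h ` g0 ` L = {}" using g(3) hg by (auto simp: image_image)
    ultimately show "matched_off (g0 ` L) (out_nbrs G) Z" unfolding matched_off_def by blast
  qed
  have "matroid_iso M (gammoid_of G S (\<phi> ` ground M))"
    unfolding matroid_iso_def
  proof (intro exI[of _ \<phi>] conjI allI impI)
    show "bij_betw \<phi> (ground M) (ground (gammoid_of G S (\<phi> ` ground M)))"
      using inj by (simp add: gammoid_of_def bij_betw_def)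
    fix X assume X: "X \<subseteq> ground M"
    then have "linked_into G (\<phi> ` X) S \<longleftrightarrow> matched_off L N (\<phi> ` X)"
      using linked_into_iff_matched[of S "\<phi> ` X"] match vS by (auto simp: G_def S_def V_def)
    then show "X \<in> indeps M \<longleftrightarrow> \<phi> ` X \<in> indeps (gammoid_of G S (\<phi> ` ground M))"
      using ind[OF X] X by (auto simp: gammoid_of_def)
  qed
  then show ?thesis
    unfolding gammoid_def using assms(1) fin_digraph_axioms
    by (intro conjI exI[of _ G] exI[of _ S] exI[of _ "\<phi> ` ground M"]) (auto simp: G_def S_def V_def)
qed


section \<open>One-element additions to a presented matroid\<close>

lemma match_presented_fresh:
  assumes "match_presented E I" "finite E" "e \<notin> E"
  obtains L :: "nat set" and N :: "nat \<Rightarrow> nat set" and \<phi> l v w where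
    "finite L" "\<And>m. m \<in> L \<Longrightarrow> finite (N m)" "inj_on \<phi> E"
    "\<And>X. X \<subseteq> E \<Longrightarrow> I X \<longleftrightarrow> matched_off L N (\<phi> ` X)"
    "l \<notin> L" "v \<noteq> w" "v \<notin> \<phi> ` E" "w \<notin> \<phi> ` E" "\<And>m. m \<in> L \<Longrightarrow> v \<notin> N m" "\<And>m. m \<in> L \<Longrightarrow> w \<notin> N m"
proof -
  obtain L :: "nat set" and N :: "nat \<Rightarrow> nat set" and \<phi> where *: "finite L" "\<forall>m\<in>L. finite (N m)"
    "inj_on \<phi> E" "\<forall>X\<subseteq>E. I X \<longleftrightarrow> matched_off L N (\<phi> ` X)"
    using assms(1) unfolding match_presented_def by blast
  obtain l where l: "l \<notin> L" using ex_new_if_finite[OF infinite_UNIV_nat *(1)] by blast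
  have fin: "finite (\<phi> ` E \<union> (\<Union>m\<in>L. N m))" using * assms(2) by simp
  obtain v where v: "v \<notin> \<phi> ` E \<union> (\<Union>m\<in>L. N m)"
    using ex_new_if_finite[OF infinite_UNIV_nat fin] by blast
  obtain w where w: "w \<notin> insert v (\<phi> ` E \<union> (\<Union>m\<in>L. N m))"
    using ex_new_if_finite[OF infinite_UNIV_nat, of "insert v (\<phi> ` E \<union> (\<Union>m\<in>L. N m))"] fin by auto
  show thesis
    by (rule that[of L N \<phi> l v w]) (use * l v w in auto)
qed

lemma image_update_insert:
  assumes "e \<notin> E" "X \<subseteq> insert e E"
  shows "(\<phi>(e := v)) ` X = (if e \<in> X then insert v (\<phi> ` (X - {e})) else \<phi> ` (X - {e}))"
  using assms by (auto simp: image_iff)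

lemma inj_on_update:
  assumes "inj_on \<phi> E" "e \<notin> E" "v \<notin> \<phi> ` E"
  shows "inj_on (\<phi>(e := v)) (insert e E)"
proof -
  have "inj_on (\<phi>(e := v)) E" using assms(1,2) by (auto simp: inj_on_def)
  moreover have "(\<phi>(e := v)) ` E = \<phi> ` E" using assms(2) by auto
  ultimately show ?thesis using assms(2,3) by simp
qed

lemma match_presented_empty:
  assumes "I {}"
  shows "match_presented {} I"
proof -
  have "matched_off {} (\<lambda>_. {}) {}" by (simp add: matched_off_def)
  with assms show ?thesis
    unfolding match_presented_def by (intro exI[of _ "{}"] exI[of _ "\<lambda>_. {}"] exI[of _ "\<lambda>_. 0"]) simp
qed

lemma match_presented_coloop:
  assumes "match_presented E I" "finite E" "e \<notin> E"
    and I': "\<And>X. X \<subseteq> insert e E \<Longrightarrow> I' X \<longleftrightarrow> I (X - {e})"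
  shows "match_presented (insert e E) I'"
  using assms(1-3)
proof (rule match_presented_fresh)
  fix L :: "nat set" and N :: "nat \<Rightarrow> nat set" and \<phi> l v w
  assume L: "finite L" "\<And>m. m \<in> L \<Longrightarrow> finite (N m)" "inj_on \<phi> E"
    and I: "\<And>X. X \<subseteq> E \<Longrightarrow> I X \<longleftrightarrow> matched_off L N (\<phi> ` X)"
    and v: "v \<notin> \<phi> ` E" "\<And>m. m \<in> L \<Longrightarrow> v \<notin> N m"
  have "I' X \<longleftrightarrow> matched_off L N ((\<phi>(e := v)) ` X)" if X: "X \<subseteq> insert e E" for X
  proof -
    have "X - {e} \<subseteq> E" using X by blast
    then show ?thesis
      unfolding image_update_insert[OF assms(3) X]
      using I'[OF X] I matched_off_insert_fresh[of L v N] v(2) by simp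
  qed
  then show ?thesis
    unfolding match_presented_def using L inj_on_update[OF L(3) assms(3) v(1)] by blast
qed

text \<open>
  A new left vertex whose only neighbour is \<open>e\<close> forces every matching to cover \<open>e\<close>.
\<close>

lemma match_presented_loop:
  assumes "match_presented E I" "finite E" "e \<notin> E"
    and I': "\<And>X. X \<subseteq> insert e E \<Longrightarrow> I' X \<longleftrightarrow> e \<notin> X \<and> I X"
  shows "match_presented (insert e E) I'"
  using assms(1-3)
proof (rule match_presented_fresh)
  fix L :: "nat set" and N :: "nat \<Rightarrow> nat set" and \<phi> l v w
  assume L: "finite L" "\<And>m. m \<in> L \<Longrightarrow> finite (N m)" "inj_on \<phi> E" "l \<notin> L"
    and I: "\<And>X. X \<subseteq> E \<Longrightarrow> I X \<longleftrightarrow> matched_off L N (\<phi> ` X)"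
    and v: "v \<notin> \<phi> ` E" "\<And>m. m \<in> L \<Longrightarrow> v \<notin> N m"
  have "I' X \<longleftrightarrow> matched_off (insert l L) (N(l := {v})) ((\<phi>(e := v)) ` X)"
    if X: "X \<subseteq> insert e E" for X
  proof (cases "e \<in> X")
    case True
    then show ?thesis
      unfolding image_update_insert[OF assms(3) X]
      using I'[OF X] matched_off_insert_left[OF L(4), of N "{v}"] by simp
  next
    case False
    then have XE: "X \<subseteq> E" "X - {e} = X" using X by auto
    then have "v \<notin> \<phi> ` X" using v(1) by blast
    then show ?thesis
      unfolding image_update_insert[OF assms(3) X]
      using I'[OF X] I[OF XE(1)] matched_off_insert_left[OF L(4), of N "{v}"]
        matched_off_insert_fresh[of L v N] v(2) False XE(2) by simp
  qed
  then show ?thesis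
    unfolding match_presented_def using L inj_on_update[OF L(3) assms(3) v(1)]
    by (intro exI[of _ "insert l L"] exI[of _ "N(l := {v})"] exI[of _ "\<phi>(e := v)"]) auto
qed

text \<open>
  A new left vertex adjacent to \<open>e\<close> and \<open>f\<close> covers one of the two and leaves only the other one free.
\<close>

lemma match_presented_parallel:
  assumes "match_presented E I" "finite E" "e \<notin> E" "f \<in> E"
    and I': "\<And>X. X \<subseteq> insert e E \<Longrightarrow>
      I' X \<longleftrightarrow> (if e \<in> X then f \<notin> X \<and> I (insert f (X - {e})) else I X)"
  shows "match_presented (insert e E) I'"
  using assms(1-3)
proof (rule match_presented_fresh)
  fix L :: "nat set" and N :: "nat \<Rightarrow> nat set" and \<phi> l v w
  assume L: "finite L" "\<And>m. m \<in> L \<Longrightarrow> finite (N m)" "inj_on \<phi> E" "l \<notin> L"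
    and I: "\<And>X. X \<subseteq> E \<Longrightarrow> I X \<longleftrightarrow> matched_off L N (\<phi> ` X)"
    and v: "v \<notin> \<phi> ` E" "\<And>m. m \<in> L \<Longrightarrow> v \<notin> N m"
  have "I' X \<longleftrightarrow> matched_off (insert l L) (N(l := {\<phi> f, v})) ((\<phi>(e := v)) ` X)"
    if X: "X \<subseteq> insert e E" for X
  proof -
    define Z where "Z = \<phi> ` (X - {e})"
    have XE: "X - {e} \<subseteq> E" using X by blast
    have fZ: "\<phi> f \<in> Z \<longleftrightarrow> f \<in> X"
      using inj_on_image_mem_iff[OF L(3) assms(4) XE] assms(3,4) by (auto simp: Z_def)
    have vZ: "v \<notin> Z" "v \<noteq> \<phi> f" using v(1) XE assms(4) by (auto simp: Z_def)
    have fresh: "matched_off L N (insert v U) \<longleftrightarrow> matched_off L N U" for U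
      using matched_off_insert_fresh[of L v N] v(2) by blast
    have mono: "matched_off L N (insert (\<phi> f) Z) \<Longrightarrow> matched_off L N Z"
      by (rule matched_off_mono) auto
    have If: "I (insert f (X - {e})) \<longleftrightarrow> matched_off L N (insert (\<phi> f) Z)"
      using I[of "insert f (X - {e})"] XE assms(4) by (simp add: Z_def)
    show ?thesis
    proof (cases "e \<in> X")
      case True
      have "matched_off L N (insert (\<phi> f) (insert v Z)) \<longleftrightarrow> matched_off L N (insert (\<phi> f) Z)"
        using fresh[of "insert (\<phi> f) Z"] by (simp add: insert_commute)
      then show ?thesis
        unfolding image_update_insert[OF assms(3) X] Z_def[symmetric]
        using True I'[OF X] If matched_off_insert_left[OF L(4), of N "{\<phi> f, v}"] fZ vZ
        by auto
    next
      case False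
      then have "X - {e} = X" by blast
      then have "I X \<longleftrightarrow> matched_off L N Z" using I[OF XE] by (simp add: Z_def)
      then show ?thesis
        unfolding image_update_insert[OF assms(3) X] Z_def[symmetric]
        using False I'[OF X] matched_off_insert_left[OF L(4), of N "{\<phi> f, v}"] vZ mono fresh
        by auto
    qed
  qed
  then show ?thesis
    unfolding match_presented_def using L inj_on_update[OF L(3) assms(3) v(1)]
    by (intro exI[of _ "insert l L"] exI[of _ "N(l := {\<phi> f, v})"] exI[of _ "\<phi>(e := v)"]) auto
qed

text \<open>
  The old vertex \<open>\<phi> f\<close> becomes hidden, \<open>e\<close> and \<open>f\<close> get new vertices \<open>v\<close> and \<open>w\<close>, and a new left vertex is
  adjacent to all three. If \<open>e\<close> and \<open>f\<close> are both to be avoided, the new left vertex has to cover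
  \<open>\<phi> f\<close>; otherwise it can take \<open>v\<close> or \<open>w\<close> and does not restrict the rest.
\<close>

lemma match_presented_series:
  assumes "match_presented E I" "finite E" "e \<notin> E" "f \<in> E"
    and I': "\<And>X. X \<subseteq> insert e E \<Longrightarrow>
      I' X \<longleftrightarrow> (if e \<in> X \<and> f \<in> X then I (X - {e}) else I (X - {e, f}))"
  shows "match_presented (insert e E) I'"
  using assms(1-3)
proof (rule match_presented_fresh)
  fix L :: "nat set" and N :: "nat \<Rightarrow> nat set" and \<phi> l v w
  assume L: "finite L" "\<And>m. m \<in> L \<Longrightarrow> finite (N m)" "inj_on \<phi> E" "l \<notin> L"
    and I: "\<And>X. X \<subseteq> E \<Longrightarrow> I X \<longleftrightarrow> matched_off L N (\<phi> ` X)"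
    and v: "v \<noteq> w" "v \<notin> \<phi> ` E" "w \<notin> \<phi> ` E" "\<And>m. m \<in> L \<Longrightarrow> v \<notin> N m" "\<And>m. m \<in> L \<Longrightarrow> w \<notin> N m"
  define \<psi> where "\<psi> = (\<phi>(f := w))(e := v)"
  have ef: "e \<noteq> f" using assms(3,4) by blast
  have "inj_on (\<phi>(f := w)) (insert f (E - {f}))"
    using L(3) v(3) by (intro inj_on_update) (auto intro: inj_on_diff)
  then have inj: "inj_on (\<phi>(f := w)) E" using assms(4) by (simp add: insert_absorb)
  have "v \<notin> (\<phi>(f := w)) ` E" using v by auto
  then have inj\<psi>: "inj_on \<psi> (insert e E)" unfolding \<psi>_def by (rule inj_on_update[OF inj assms(3)])
  have "I' X \<longleftrightarrow> matched_off (insert l L) (N(l := {\<phi> f, v, w})) (\<psi> ` X)"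
    if X: "X \<subseteq> insert e E" for X
  proof -
    define Z where "Z = \<phi> ` (X - {e, f})"
    have XE: "X - {e, f} \<subseteq> E" "X - {e} \<subseteq> E" using X by auto
    have fZ: "\<phi> f \<notin> Z"
      using inj_on_image_mem_iff[OF L(3) assms(4) XE(1)] by (auto simp: Z_def)
    have vZ: "v \<notin> Z" "v \<noteq> \<phi> f" "w \<notin> Z" "w \<noteq> \<phi> f" using v(2,3) XE assms(4) by (auto simp: Z_def)
    have img: "\<psi> ` (X - {e, f}) = Z" "\<psi> e = v" "\<psi> f = w"
      using ef unfolding Z_def \<psi>_def by (auto intro!: image_cong)
    have fresh: "matched_off L N (insert v U) \<longleftrightarrow> matched_off L N U"
      "matched_off L N (insert w U) \<longleftrightarrow> matched_off L N U" for U
      using matched_off_insert_fresh[of L v N] matched_off_insert_fresh[of L w N] v(4,5) by blast+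
    have mono: "matched_off L N (insert (\<phi> f) Z) \<Longrightarrow> matched_off L N Z"
      by (rule matched_off_mono) auto
    have IZ: "I (X - {e, f}) \<longleftrightarrow> matched_off L N Z" using I[OF XE(1)] by (simp add: Z_def)
    note left = matched_off_insert_left[OF L(4), of N "{\<phi> f, v, w}"]
    consider "e \<in> X" "f \<in> X" | "e \<in> X" "f \<notin> X" | "e \<notin> X" "f \<in> X" | "e \<notin> X" "f \<notin> X" by blast
    then show ?thesis
    proof cases
      case 1
      have eq: "X = insert f (insert e (X - {e, f}))" using 1 by auto
      have "X - {e} = insert f (X - {e, f})" using 1 ef by auto
      then have "I (X - {e}) \<longleftrightarrow> matched_off L N (insert (\<phi> f) Z)" using I[OF XE(2)] by (simp add: Z_def)
      moreover have "matched_off L N (insert (\<phi> f) (insert w (insert v Z))) \<longleftrightarrow> matched_off L N (insert (\<phi> f) Z)"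
        using fresh(1)[of "insert w (insert (\<phi> f) Z)"] fresh(2)[of "insert (\<phi> f) Z"] by (simp add: insert_commute)
      moreover have "\<psi> ` X = insert w (insert v Z)" by (subst eq) (simp only: image_insert img)
      ultimately show ?thesis using 1 I'[OF X] left fZ vZ by auto
    next
      case 2
      have e1: "matched_off L N (insert w (insert v Z)) \<longleftrightarrow> matched_off L N Z" using fresh by simp
      have e2: "matched_off L N (insert (\<phi> f) (insert v Z)) \<longleftrightarrow> matched_off L N (insert (\<phi> f) Z)"
        using fresh(1)[of "insert (\<phi> f) Z"] by (simp add: insert_commute)
      have eq: "X = insert e (X - {e, f})" using 2 by auto
      have "\<psi> ` X = insert v Z" by (subst eq) (simp only: image_insert img)
      then show ?thesis using 2 I'[OF X] IZ left fZ vZ v(1) e1 e2 mono by auto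
    next
      case 3
      have e1: "matched_off L N (insert v (insert w Z)) \<longleftrightarrow> matched_off L N Z" using fresh by simp
      have e2: "matched_off L N (insert (\<phi> f) (insert w Z)) \<longleftrightarrow> matched_off L N (insert (\<phi> f) Z)"
        using fresh(2)[of "insert (\<phi> f) Z"] by (simp add: insert_commute)
      have eq: "X = insert f (X - {e, f})" using 3 by auto
      have "\<psi> ` X = insert w Z" by (subst eq) (simp only: image_insert img)
      then show ?thesis using 3 I'[OF X] IZ left fZ vZ v(1) e1 e2 mono by auto
    next
      case 4
      have eq: "X = X - {e, f}" using 4 by auto
      have "\<psi> ` X = Z" by (subst eq) (simp only: image_insert img)
      then show ?thesis using 4 I'[OF X] IZ left fZ vZ v(1) fresh[of Z] mono by auto
    qed
  qed
  then show ?thesis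
    unfolding match_presented_def using L inj\<psi>
    by (intro exI[of _ "insert l L"] exI[of _ "N(l := {\<phi> f, v, w})"] exI[of _ \<psi>]) auto
qed


section \<open>Binary matroids without an M(K4)-minor are gammoids\<close>

lemma cycles_delete:
  assumes "finite E" "bspace E \<D>" "S \<subseteq> E"
  shows "cycles S (sminor \<D> {} S) = {Y \<in> cycles E \<D>. Y \<subseteq> S}"
proof (intro equalityI subsetI)
  fix Y assume Y: "Y \<in> cycles S (sminor \<D> {} S)"
  then have "Y \<in> cycles E \<D>" using cycles_sminor_lift[OF assms(1,2) _ assms(3) _ Y] by auto
  then show "Y \<in> {Y \<in> cycles E \<D>. Y \<subseteq> S}" using Y by (auto simp: cycles_def)
next
  fix Y assume "Y \<in> {Y \<in> cycles E \<D>. Y \<subseteq> S}"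
  then have "Y \<inter> S \<in> cycles S (sminor \<D> {} S)" "Y \<inter> S = Y" using cycles_sminor[of Y E \<D> "{}" S] by auto
  then show "Y \<in> cycles S (sminor \<D> {} S)" by simp
qed

lemma sp_indep_delete:
  assumes "finite E" "bspace E \<D>" "S \<subseteq> E" "X \<subseteq> S"
  shows "sp_indep S (sminor \<D> {} S) X \<longleftrightarrow> sp_indep E \<D> X"
  unfolding sp_indep_def cycles_delete[OF assms(1-3)] using assms(3,4) by blast

text \<open>
  A loop, a coloop and one element of a parallel pair are deleted, one element of a series pair is
  contracted. In each case independence in the matroid is expressed by independence in the minor as the
  corresponding lemma on adding an element requires.
\<close>

lemma match_presented_if_no_K4:
  assumes "finite E" "bspace E \<D>" "\<not> has_K4 E \<D>"
  shows "match_presented E (sp_indep E \<D>)"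
  using assms
proof (induction "card E" arbitrary: E \<D> rule: less_induct)
  case less
  note fin = less.prems(1) and bs = less.prems(2)
  note csp = bspaceD[OF cycles_bspace[OF fin, of \<D>]]
  have orthD: "orth Y D" if "Y \<in> cycles E \<D>" "D \<in> \<D>" for Y D using that by (simp add: cycles_def)
  have minor: "match_presented (E - {e}) (sp_indep (E - {e}) (sminor \<D> C (E - {e})))"
    if "e \<in> E" "C \<subseteq> {e}" for e C
  proof (rule less.hyps)
    show "card (E - {e}) < card E" by (rule card_Diff1_less[OF fin that(1)])
    show "\<not> has_K4 (E - {e}) (sminor \<D> C (E - {e}))"
      using has_K4_sminor[of "E - {e}" \<D> C E] less.prems(3) that by blast
  qed (use fin sminor_bspace[OF bs] in auto)
  have finE: "finite (E - {e})" for e using fin by simp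
  have del: "sp_indep (E - {e}) (sminor \<D> {} (E - {e})) X \<longleftrightarrow> sp_indep E \<D> X" if "X \<subseteq> E - {e}" for e X
    using sp_indep_delete[OF fin bs _ that] by blast
  have ins: "insert e (E - {e}) = E" if "e \<in> E" for e using that by blast
  show ?case
  proof (cases "E = {}")
    case True
    then show ?thesis by (auto intro!: match_presented_empty simp: sp_indep_def)
  next
    case False
    then have "(\<exists>Y\<in>cycles E \<D>. card Y \<le> 2 \<and> Y \<noteq> {}) \<or> (\<exists>D\<in>\<D>. card D \<le> 2 \<and> D \<noteq> {})"
      using dirac_binary[OF fin bs] less.prems(3) by blast
    then consider (loop) e where "{e} \<in> cycles E \<D>"
      | (parallel) e f where "e \<noteq> f" "{e, f} \<in> cycles E \<D>"
      | (coloop) e where "{e} \<in> \<D>"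
      | (series) e f where "e \<noteq> f" "{e, f} \<in> \<D>"
    proof -
      have small: "(\<exists>e. Y = {e}) \<or> (\<exists>e f. e \<noteq> f \<and> Y = {e, f})" if "card Y \<le> 2" "Y \<noteq> {}" "Y \<subseteq> E" for Y
      proof -
        have "finite Y" using that(3) fin finite_subset by blast
        then have "card Y = 1 \<or> card Y = 2" using that by (cases "card Y") auto
        then show ?thesis by (auto simp: card_1_singleton_iff card_2_iff)
      qed
      have "Y \<subseteq> E" if "Y \<in> cycles E \<D>" for Y using that by (simp add: cycles_def)
      then show thesis
        using \<open>_ \<or> _\<close> small loop parallel coloop series bspaceD(1)[OF bs] by metis
    qed
    then show ?thesis
    proof cases
      case loop
      then have e: "e \<in> E" by (simp add: cycles_def)
      have "match_presented (insert e (E - {e})) (sp_indep E \<D>)"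
      proof (rule match_presented_loop[OF minor[OF e] finE])
        fix X assume "X \<subseteq> insert e (E - {e})"
        then have "X \<subseteq> E - {e}" if "e \<notin> X" using that by blast
        moreover have "\<not> sp_indep E \<D> X" if "e \<in> X" using that loop by (auto simp: sp_indep_def)
        ultimately show "sp_indep E \<D> X \<longleftrightarrow> e \<notin> X \<and> sp_indep (E - {e}) (sminor \<D> {} (E - {e})) X"
          using del by blast
      qed auto
      then show ?thesis using ins[OF e] by simp
    next
      case parallel
      then have e: "e \<in> E" "f \<in> E" by (auto simp: cycles_def)
      have "match_presented (insert e (E - {e})) (sp_indep E \<D>)"
      proof (rule match_presented_parallel[OF minor[OF e(1), of "{}"] finE, where f = f])
        fix X assume "X \<subseteq> insert e (E - {e})"
        then have X: "X \<subseteq> E" using e by blast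
        have replace: "sp_indep E \<D> (insert q (X - {p}))"
          if "sp_indep E \<D> X" "{p, q} \<in> cycles E \<D>" "p \<noteq> q" "q \<in> E" "p \<in> X" "q \<notin> X" for p q X
          unfolding sp_indep_def
        proof (intro conjI allI impI)
          show "insert q (X - {p}) \<subseteq> E" using that by (auto simp: sp_indep_def)
          fix Y assume Y: "Y \<subseteq> insert q (X - {p})" "Y \<in> cycles E \<D>"
          show "Y = {}"
          proof (cases "q \<in> Y")
            case True
            have "Y \<triangle> {p, q} \<subseteq> X"
            proof
              fix u assume "u \<in> Y \<triangle> {p, q}"
              then show "u \<in> X" using Y(1) True that(3,5) by (cases "u = p"; cases "u = q") auto
            qed
            moreover have "p \<in> Y \<triangle> {p, q}" using Y(1) that(3) by auto
            ultimately show ?thesis using that(1) csp(3)[OF Y(2) that(2)] unfolding sp_indep_def by blast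
          next
            case False
            then have "Y \<subseteq> X" using Y(1) by blast
            then show ?thesis using that(1) Y(2) by (simp add: sp_indep_def)
          qed
        qed
        show "sp_indep E \<D> X \<longleftrightarrow> (if e \<in> X then f \<notin> X \<and>
            sp_indep (E - {e}) (sminor \<D> {} (E - {e})) (insert f (X - {e}))
            else sp_indep (E - {e}) (sminor \<D> {} (E - {e})) X)"
        proof (cases "e \<in> X")
          case True
          have sub: "insert f (X - {e}) \<subseteq> E - {e}" using X e parallel(1) by blast
          have "f \<notin> X" if "sp_indep E \<D> X"
          proof
            assume "f \<in> X"
            then have "{e, f} \<subseteq> X" using True by simp
            then show False using that parallel(2) unfolding sp_indep_def by blast
          qed
          moreover have "sp_indep E \<D> X" if "f \<notin> X" "sp_indep E \<D> (insert f (X - {e}))"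
          proof -
            have "insert e (insert f (X - {e}) - {f}) = X" using True that(1) by blast
            moreover have "{f, e} \<in> cycles E \<D>" using parallel(2) by (simp add: insert_commute)
            ultimately show ?thesis using replace[OF that(2), of f e] parallel(1) e by simp
          qed
          moreover have "sp_indep E \<D> (insert f (X - {e}))" if "sp_indep E \<D> X" "f \<notin> X"
            using replace[OF that(1) parallel(2,1) e(2) True that(2)] .
          ultimately show ?thesis unfolding del[OF sub] using True by auto
        next
          case False
          then show ?thesis using del[of X e] X by auto
        qed
      qed (use e parallel in auto)
      then show ?thesis using ins[OF e(1)] by simp
    next
      case coloop
      then have e: "e \<in> E" using bspaceD(1)[OF bs] by blast
      have noe: "e \<notin> Y" if "Y \<in> cycles E \<D>" for Y
        using orthD[OF that coloop] orth_commute[of Y "{e}"] by (auto simp: orth_insert)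
      have "match_presented (insert e (E - {e})) (sp_indep E \<D>)"
      proof (rule match_presented_coloop[OF minor[OF e] finE])
        fix X assume "X \<subseteq> insert e (E - {e})"
        then have X: "X \<subseteq> E" "X - {e} \<subseteq> E - {e}" using e by auto
        have "sp_indep E \<D> X \<longleftrightarrow> sp_indep E \<D> (X - {e})"
          unfolding sp_indep_def using X(1) noe by blast
        then show "sp_indep E \<D> X \<longleftrightarrow> sp_indep (E - {e}) (sminor \<D> {} (E - {e})) (X - {e})"
          using del[OF X(2)] by blast
      qed auto
      then show ?thesis using ins[OF e] by simp
    next
      case series
      then have e: "e \<in> E" "f \<in> E" using bspaceD(1)[OF bs] by blast+
      have both: "e \<in> Y \<longleftrightarrow> f \<in> Y" if "Y \<in> cycles E \<D>" for Y
        using orthD[OF that series(2)] orth_commute[of Y "{e, f}"] orth_pair[OF series(1)] by blast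
      let ?c = "sminor \<D> {e} (E - {e})"
      have lift: "Y \<in> cycles E \<D> \<or> insert e Y \<in> cycles E \<D>" if Y: "Y \<in> cycles (E - {e}) ?c" for Y
      proof -
        obtain Z where "Z \<subseteq> {e}" "Y \<union> Z \<in> cycles E \<D>"
          using cycles_sminor_lift[OF fin bs _ _ _ Y] e by blast
        then show ?thesis by (auto simp: subset_singleton_iff)
      qed
      have proj: "Y - {e} \<in> cycles (E - {e}) ?c" if "Y \<in> cycles E \<D>" for Y
      proof -
        have YE: "Y \<subseteq> E" using that by (simp add: cycles_def)
        then have "Y \<inter> (E - {e}) = Y - {e}" by blast
        moreover have "Y \<inter> (E - {e}) \<in> cycles (E - {e}) ?c"
          using YE by (intro cycles_sminor[OF that]) auto
        ultimately show ?thesis by simp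
      qed
      have "match_presented (insert e (E - {e})) (sp_indep E \<D>)"
      proof (rule match_presented_series[OF minor[OF e(1), of "{e}"] finE, where f = f])
        fix X assume "X \<subseteq> insert e (E - {e})"
        then have X: "X \<subseteq> E" using e by blast
        show "sp_indep E \<D> X \<longleftrightarrow> (if e \<in> X \<and> f \<in> X then sp_indep (E - {e}) ?c (X - {e})
            else sp_indep (E - {e}) ?c (X - {e, f}))"
        proof (cases "e \<in> X \<and> f \<in> X")
          case True
          have "sp_indep (E - {e}) ?c (X - {e})" if "sp_indep E \<D> X"
          proof (rule sp_indepI)
            fix Y assume Y: "Y \<subseteq> X - {e}" "Y \<in> cycles (E - {e}) ?c"
            have "Y \<subseteq> X" "insert e Y \<subseteq> X" using Y(1) True by auto
            then show "Y = {}" using lift[OF Y(2)] sp_indepD[OF that] by blast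
          qed (use X in blast)
          moreover have "sp_indep E \<D> X" if "sp_indep (E - {e}) ?c (X - {e})"
          proof (rule sp_indepI[OF X])
            fix Y assume Y: "Y \<subseteq> X" "Y \<in> cycles E \<D>"
            have "Y - {e} \<subseteq> X - {e}" using Y(1) by blast
            then have "Y - {e} = {}" by (rule sp_indepD[OF that _ proj[OF Y(2)]])
            then show "Y = {}" using both[OF Y(2)] series(1) by blast
          qed
          ultimately show ?thesis using True by auto
        next
          case False
          have "sp_indep (E - {e}) ?c (X - {e, f})" if "sp_indep E \<D> X"
          proof (rule sp_indepI)
            fix Y assume Y: "Y \<subseteq> X - {e, f}" "Y \<in> cycles (E - {e}) ?c"
            have "f \<notin> insert e Y" using Y(1) series(1) by blast
            then have "insert e Y \<notin> cycles E \<D>" using both[of "insert e Y"] by blast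
            then have "Y \<in> cycles E \<D>" using lift[OF Y(2)] by blast
            moreover have "Y \<subseteq> X" using Y(1) by blast
            ultimately show "Y = {}" using sp_indepD[OF that] by blast
          qed (use X in blast)
          moreover have "sp_indep E \<D> X" if "sp_indep (E - {e}) ?c (X - {e, f})"
          proof (rule sp_indepI[OF X])
            fix Y assume Y: "Y \<subseteq> X" "Y \<in> cycles E \<D>"
            have "e \<notin> Y" "f \<notin> Y" using both[OF Y(2)] Y(1) False by auto
            then have "Y - {e} = Y" "Y \<subseteq> X - {e, f}" using Y(1) by auto
            then show "Y = {}" using sp_indepD[OF that, of Y] proj[OF Y(2)] by simp
          qed
          ultimately show ?thesis using False by auto
        qed
      qed (use e series in auto)
      then show ?thesis using ins[OF e(1)] by simp
    qed
  qed
qed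

lemma gammoid_if_no_K4:
  assumes "finite E" "bspace E \<D>" "\<not> has_K4 E \<D>"
  shows "gammoid (sp_matroid E \<D>)"
  using gammoid_if_match_presented[OF sp_matroid_matroid[OF assms(1,2)]] match_presented_if_no_K4[OF assms]
  by simp


section \<open>Gammoids have no M(K4)-minor\<close>

text \<open>
  The exchange of matchings restricted to the ground set. The maximality assumption forces \<open>f x\<close> into
  \<open>I2\<close>: otherwise removing \<open>f x\<close> from \<open>I2\<close> has no effect and \<open>I2\<close> could be enlarged by \<open>x\<close>.
\<close>

lemma gammoid_exchange:
  assumes "gammoid M" and I: "I1 \<in> indeps M" "I2 \<in> indeps M"
    and max: "\<And>x. x \<in> I1 - I2 \<Longrightarrow> insert x I2 \<notin> indeps M"
  shows "\<exists>f. inj_on f I1 \<and> (\<forall>x\<in>I1. f x \<in> I2 \<and> (x \<in> I2 \<longrightarrow> f x = x) \<and>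
    insert (f x) (I1 - {x}) \<in> indeps M \<and> insert x (I2 - {f x}) \<in> indeps M)"
proof -
  have "matroid M" using assms(1) by (simp add: gammoid_def)
  then have sub: "I1 \<subseteq> ground M" "I2 \<subseteq> ground M" using I matroid.indeps_subset by blast+
  obtain L :: "nat set" and N :: "nat \<Rightarrow> nat set" and \<phi> where "finite L"
    and inj: "inj_on \<phi> (ground M)"
    and ind: "\<And>X. X \<subseteq> ground M \<Longrightarrow> X \<in> indeps M \<longleftrightarrow> matched_off L N (\<phi> ` X)"
    using match_presented_if_gammoid[OF assms(1)] unfolding match_presented_def by blast
  obtain F where F: "inj_on F (\<phi> ` I1)"
    "\<And>z. z \<in> \<phi> ` I1 \<Longrightarrow> z \<in> \<phi> ` I2 \<Longrightarrow> F z = z"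
    "\<And>z. z \<in> \<phi> ` I1 \<Longrightarrow> matched_off L N (insert (F z) (\<phi> ` I1 - {z}))"
    "\<And>z. z \<in> \<phi> ` I1 \<Longrightarrow> matched_off L N (insert z (\<phi> ` I2 - {F z}))"
    using matched_off_exchange[OF \<open>finite L\<close>, of N "\<phi> ` I1" "\<phi> ` I2"] ind sub I by metis
  have img: "\<phi> ` insert y (X - {x}) = insert (\<phi> y) (\<phi> ` X - {\<phi> x})" if "X \<subseteq> ground M" "x \<in> ground M" for X x y
    using inj_on_image_set_diff[OF inj, of X "{x}"] that by auto
  have FI2: "F (\<phi> x) \<in> \<phi> ` I2" if x: "x \<in> I1" for x
  proof (cases "x \<in> I2")
    case True
    then show ?thesis using F(2) x by simp
  next
    case False
    show ?thesis
    proof (rule ccontr)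
      assume "F (\<phi> x) \<notin> \<phi> ` I2"
      then have "matched_off L N (\<phi> ` insert x I2)" using F(4)[of "\<phi> x"] x by simp
      then have "insert x I2 \<in> indeps M" using ind[of "insert x I2"] sub x by blast
      then show False using max[of x] x False by blast
    qed
  qed
  define f where "f x = (THE y. y \<in> I2 \<and> \<phi> y = F (\<phi> x))" for x
  have f: "f x \<in> I2" "\<phi> (f x) = F (\<phi> x)" if x: "x \<in> I1" for x
  proof -
    have "\<exists>!y. y \<in> I2 \<and> \<phi> y = F (\<phi> x)"
      using FI2[OF x] inj sub(2) by (auto simp: inj_on_def) (metis subset_iff)
    from theI'[OF this] show "f x \<in> I2" "\<phi> (f x) = F (\<phi> x)" by (simp_all add: f_def)
  qed
  have "inj_on f I1"
  proof (rule inj_onI)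
    fix x y assume xy: "x \<in> I1" "y \<in> I1" "f x = f y"
    then have "F (\<phi> x) = F (\<phi> y)" using f(2) by metis
    then have "\<phi> x = \<phi> y" using F(1) xy by (simp add: inj_on_def)
    then show "x = y" using inj sub xy by (meson inj_onD subsetD)
  qed
  moreover have "f x = x" if "x \<in> I1" "x \<in> I2" for x
  proof -
    have "\<phi> (f x) = \<phi> x" using f(2)[OF that(1)] F(2) that by simp
    then show ?thesis using inj sub f(1)[OF that(1)] that by (meson inj_onD subsetD)
  qed
  moreover have "insert (f x) (I1 - {x}) \<in> indeps M" if x: "x \<in> I1" for x
  proof -
    have "matched_off L N (\<phi> ` insert (f x) (I1 - {x}))"
      using img[OF sub(1), of x "f x"] F(3)[of "\<phi> x"] f(2)[OF x] x sub by auto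
    moreover have "insert (f x) (I1 - {x}) \<subseteq> ground M" using f(1)[OF x] sub by blast
    ultimately show ?thesis using ind by blast
  qed
  moreover have "insert x (I2 - {f x}) \<in> indeps M" if x: "x \<in> I1" for x
  proof -
    have "matched_off L N (\<phi> ` insert x (I2 - {f x}))"
      using img[OF sub(2), of "f x" x] F(4)[of "\<phi> x"] f[OF x] x sub by auto
    moreover have "insert x (I2 - {f x}) \<subseteq> ground M" using x sub by blast
    ultimately show ?thesis using ind by blast
  qed
  ultimately show ?thesis using f(1) by blast
qed

text \<open>
  The edge sets \<open>{x, y, c}\<close> and \<open>{z, a, b}\<close> are complementary Hamiltonian paths of \<open>K\<^sub>4\<close>. Together with a
  basis \<open>B\<close> of the contracted set they are independent in \<open>M\<close>, and the exchange injection fixes \<open>B\<close>. For each of the end edges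
  \<open>x\<close> and \<open>c\<close> of the first path, the triangles of \<open>K\<^sub>4\<close> rule out all images but \<open>a\<close>.
\<close>

lemma no_K4_if_gammoid:
  assumes "finite E" "bspace E \<D>" "gammoid (sp_matroid E \<D>)"
  shows "\<not> has_K4 E \<D>"
proof
  assume "has_K4 E \<D>"
  then obtain C a b c x y z where dist: "distinct [a, b, c, x, y, z]" and SE: "{a, b, c, x, y, z} \<subseteq> E"
    and C: "C \<subseteq> E" "C \<inter> {a, b, c, x, y, z} = {}"
    and K: "sminor \<D> C {a, b, c, x, y, z} = K4_cocycles a b c x y z"
    by (rule has_K4E)
  define S where "S = {a, b, c, x, y, z}"
  obtain B where B: "basis_of (sp_matroid E \<D>) C B" using basis_of_exists[OF assms(1,2) C(1)] by blast
  then have BC: "B \<subseteq> C" by (simp add: basis_of_def)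
  have S: "S \<subseteq> E" "C \<inter> S = {}" "sminor \<D> C S = K4_cocycles a b c x y z"
    unfolding S_def by (fact SE C(2) K)+
  have ne: "distinct [z, y, x, c, b, a]" using dist by auto
  have contr: "sp_indep E \<D> (X \<union> B) \<longleftrightarrow> sp_indep S (K4_cocycles a b c x y z) X" if "X \<subseteq> S" for X
    using sp_indep_contract[OF assms(1,2) C(1) S(1,2) B that] S(3) by simp
  have tri: "{a, b, x} \<in> cycles S (K4_cocycles a b c x y z)" "{b, c, y} \<in> cycles S (K4_cocycles a b c x y z)"
    "{a, c, z} \<in> cycles S (K4_cocycles a b c x y z)" "{x, y, z} \<in> cycles S (K4_cocycles a b c x y z)"
    using dist ne by (simp_all add: cycles_def K4_cocycles_def S_def orth_triple)
  have dep: "\<not> sp_indep E \<D> X"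
    if T: "T \<in> cycles S (K4_cocycles a b c x y z)" "T \<noteq> {}" "T \<union> B \<subseteq> X" for T X
  proof
    assume "sp_indep E \<D> X"
    then have "sp_indep E \<D> (T \<union> B)" using T(3) by (rule sp_indep_mono)
    then have "sp_indep S (K4_cocycles a b c x y z) T" using contr[of T] T(1) by (auto simp: cycles_def)
    then show False using T(1,2) by (auto simp: sp_indep_def)
  qed
  have ind: "sp_indep S (K4_cocycles a b c x y z) {p, q, r}"
    if pqr: "{p, q, r} \<subseteq> S" "P \<in> K4_cocycles a b c x y z" "Q \<in> K4_cocycles a b c x y z" "R \<in> K4_cocycles a b c x y z"
      "{p, q, r} \<inter> P = {p}" "{p, q, r} \<inter> Q = {q}" "{p, q, r} \<inter> R = {r}" for p q r P Q R
    unfolding sp_indep_def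
  proof (intro conjI allI impI)
    fix Y assume Y: "Y \<subseteq> {p, q, r}" "Y \<in> cycles S (K4_cocycles a b c x y z)"
    have "orth Y D" if "D \<in> K4_cocycles a b c x y z" for D using Y(2) that by (simp add: cycles_def)
    then have "p \<notin> Y" "q \<notin> Y" "r \<notin> Y" using orth_singletonD[OF _ Y(1)] pqr by blast+
    then show "Y = {}" using Y(1) by blast
  qed (fact pqr)
  define I1 I2 where "I1 = {x, y, c} \<union> B" and "I2 = {a, b, z} \<union> B"
  have "sp_indep S (K4_cocycles a b c x y z) {x, y, c}"
    by (rule ind[of x y c "{a, x, z}" "{a, b, y, z}" "{a, b, c}"])
      (use dist ne in \<open>auto simp: S_def K4_cocycles_def\<close>)
  then have I1: "sp_indep E \<D> I1" using contr[of "{x, y, c}"] by (simp add: I1_def S_def)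
  have "sp_indep S (K4_cocycles a b c x y z) {a, b, z}"
    by (rule ind[of a b z "{a, c, x, y}" "{b, x, y}" "{c, y, z}"])
      (use dist ne in \<open>auto simp: S_def K4_cocycles_def\<close>)
  then have I2: "sp_indep E \<D> I2" using contr[of "{a, b, z}"] by (simp add: I2_def S_def)
  have "{a, b, y, z} \<in> cycles S (K4_cocycles a b c x y z)"
    using dist ne by (simp add: cycles_def K4_cocycles_def S_def orth_insert)
  note cyc = tri this
  \<comment> \<open>Adding \<open>x\<close>, \<open>y\<close> or \<open>c\<close> to \<open>I2\<close> creates the triangle \<open>{a, b, x}\<close>, the four-cycle \<open>{a, b, y, z}\<close> or
    the triangle \<open>{a, c, z}\<close>.\<close>
  have max: "\<not> sp_indep E \<D> (insert e I2)" if "e \<in> I1 - I2" for e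
  proof -
    have "e = x \<or> e = y \<or> e = c" using that by (auto simp: I1_def I2_def)
    then show ?thesis
      using dep[OF cyc(1), of "insert e I2"] dep[OF cyc(3), of "insert e I2"] dep[OF cyc(5), of "insert e I2"]
      by (auto simp: I2_def)
  qed
  obtain f where f: "inj_on f I1" and fI: "\<And>e. e \<in> I1 \<Longrightarrow> f e \<in> I2"
    "\<And>e. e \<in> I1 \<Longrightarrow> e \<in> I2 \<Longrightarrow> f e = e"
    "\<And>e. e \<in> I1 \<Longrightarrow> sp_indep E \<D> (insert (f e) (I1 - {e}))"
    "\<And>e. e \<in> I1 \<Longrightarrow> sp_indep E \<D> (insert e (I2 - {f e}))"
    using gammoid_exchange[OF assms(3), of I1 I2] I1 I2 max by auto
  have SB: "S \<inter> B = {}" using BC S(2) by blast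
  then have notB: "a \<notin> B" "b \<notin> B" "c \<notin> B" "x \<notin> B" "y \<notin> B" "z \<notin> B" by (auto simp: S_def)
  have nI2: "x \<notin> I2" "c \<notin> I2" using dist notB by (auto simp: I2_def)
  have fab: "f e \<in> {a, b, z}" if e: "e \<in> I1" "e \<notin> I2" for e
  proof (rule ccontr)
    assume "f e \<notin> {a, b, z}"
    then have "f e \<in> B" using fI(1)[OF e(1)] by (simp add: I2_def)
    then have "f e \<in> I1" "f (f e) = f e" using fI(2)[of "f e"] by (simp_all add: I1_def I2_def)
    then have "f e = e" using f e(1) by (simp add: inj_on_def)
    then show False using fI(1)[OF e(1)] e(2) by simp
  qed
  have xI: "x \<in> I1" and cI: "c \<in> I1" by (simp_all add: I1_def)
  have "f x \<noteq> z"
  proof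
    assume "f x = z"
    then have "sp_indep E \<D> (insert x (I2 - {z}))" using fI(4)[OF xI] by simp
    moreover have "{a, b, x} \<union> B \<subseteq> insert x (I2 - {z})" using ne notB by (auto simp: I2_def)
    ultimately show False using dep[OF tri(1)] by blast
  qed
  moreover have "f x \<noteq> b"
  proof
    assume "f x = b"
    then have "sp_indep E \<D> (insert b (I1 - {x}))" using fI(3)[OF xI] by simp
    moreover have "{b, c, y} \<union> B \<subseteq> insert b (I1 - {x})" using dist notB by (auto simp: I1_def)
    ultimately show False using dep[OF tri(2)] by blast
  qed
  ultimately have fx: "f x = a" using fab[OF xI nI2(1)] by blast
  have "f c \<noteq> z"
  proof
    assume "f c = z"
    then have "sp_indep E \<D> (insert z (I1 - {c}))" using fI(3)[OF cI] by simp
    moreover have "{x, y, z} \<union> B \<subseteq> insert z (I1 - {c})" using ne notB by (auto simp: I1_def)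
    ultimately show False using dep[OF tri(4)] by blast
  qed
  moreover have "f c \<noteq> b"
  proof
    assume "f c = b"
    then have "sp_indep E \<D> (insert c (I2 - {b}))" using fI(4)[OF cI] by simp
    moreover have "{a, c, z} \<union> B \<subseteq> insert c (I2 - {b})" using dist notB by (auto simp: I2_def)
    ultimately show False using dep[OF tri(3)] by blast
  qed
  ultimately have "f c = a" using fab[OF cI nI2(2)] by blast
  then have "x = c" using fx f xI cI by (metis inj_onD)
  then show False using dist by simp
qed


section \<open>The cycle matroids of the graphs Q2 and Q4\<close>

text \<open>
  Loops are left out: a loop contributes two to the degree of its vertex, hence nothing modulo two.
\<close>

definition star :: "('v, 'e) multigraph \<Rightarrow> 'v \<Rightarrow> 'e set" where
  "star G v = {e \<in> medges G. v \<in> mends G e \<and> mends G e \<noteq> {v}}"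

text \<open>
  Modulo two, an edge lies in the star of \<open>v\<close> as often as \<open>v\<close> occurs among its two ends, and
  going around a cycle each of its vertices occurs once as a first and once as a second end.
\<close>

lemma cycle_edges_orth_star:
  assumes "cycle_edges G C"
  shows "orth C (star G v)"
proof -
  obtain vs es where ve: "es \<noteq> []" "length vs = length es" "distinct es"
    "set es \<subseteq> medges G" "C = set es"
    and ends: "\<And>i. i < length es \<Longrightarrow> mends G (es ! i) = {vs ! i, vs ! (Suc i mod length es)}"
    using assms unfolding cycle_edges_def by blast
  have finC: "finite C" using ve(5) by simp
  define n where "n = length es"
  define g :: "nat \<Rightarrow> bit" where "g i = of_bool (vs ! i = v)" for i
  have n: "n \<noteq> 0" using ve(1) by (simp add: n_def)
  have edge: "of_bool (es ! i \<in> star G v) = g i + g (Suc i mod n)" if "i < n" for i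
  proof -
    have "es ! i \<in> medges G" using ve(4) that by (auto simp: n_def)
    then show ?thesis using ends[of i] that by (auto simp: star_def g_def n_def)
  qed
  obtain m where m: "n = Suc m" using n by (cases n) auto
  have "(\<Sum>i<n. g (Suc i mod n)) = (\<Sum>i<m. g (Suc i mod n)) + g 0" by (simp add: m)
  also have "(\<Sum>i<m. g (Suc i mod n)) = (\<Sum>i<m. g (Suc i))" by (intro sum.cong) (auto simp: m)
  also have "(\<Sum>i<m. g (Suc i)) + g 0 = (\<Sum>i<n. g i)"
    unfolding m sum.lessThan_Suc_shift by (rule add.commute)
  finally have shift: "(\<Sum>i<n. g (Suc i mod n)) = (\<Sum>i<n. g i)" .
  have "(\<Sum>i<n. of_bool (es ! i \<in> star G v)) = (\<Sum>i<n. g i + g (Suc i mod n))"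
    by (intro sum.cong) (auto simp: edge)
  also have "\<dots> = (\<Sum>i<n. g i) + (\<Sum>i<n. g i)" by (simp only: sum.distrib shift)
  also have "\<dots> = 0" by simp
  finally have "(\<Sum>i<n. of_bool (es ! i \<in> star G v)) = (0::bit)" .
  moreover have "(\<Sum>i<n. of_bool (es ! i \<in> star G v)) = (\<Sum>e\<in>C. of_bool (e \<in> star G v) :: bit)"
    unfolding n_def ve(5) by (rule sum.reindex_bij_betw[OF bij_betw_nth[OF ve(3) refl refl]])
  ultimately have "(\<Sum>e\<in>C. of_bool (e \<in> star G v) :: bit) = 0" by (simp only:)
  then have "even (card {e \<in> C. (of_bool (e \<in> star G v) :: bit) = 1})"
    using sum_bit_eq_0_iff[of C "\<lambda>e. of_bool (e \<in> star G v)"] finC by (simp only:)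
  moreover have "{e \<in> C. (of_bool (e \<in> star G v) :: bit) = 1} = C \<inter> star G v" by auto
  ultimately show ?thesis by (simp add: orth_def)
qed

lemma cycle_edges_nonempty: "cycle_edges G C \<Longrightarrow> C \<noteq> {}"
  by (auto simp: cycle_edges_def)

lemma cycle_edgesI:
  assumes "es \<noteq> []" "length vs = length es" "distinct vs" "distinct es"
    "set vs \<subseteq> mverts G" "set es \<subseteq> medges G"
    "\<And>i. i < length es \<Longrightarrow> mends G (es ! i) = {vs ! i, vs ! (Suc i mod length es)}"
  shows "cycle_edges G (set es)"
  unfolding cycle_edges_def using assms by blast

lemma cycle_matroid_eq_sp_matroid:
  assumes "\<D> \<subseteq> {{}} \<union> range (star G)"
    and "\<And>Y. Y \<in> cycles (medges G) \<D> \<Longrightarrow> Y \<noteq> {} \<Longrightarrow> \<exists>C\<subseteq>Y. cycle_edges G C"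
  shows "cycle_matroid G = sp_matroid (medges G) \<D>"
proof -
  have iff: "(\<exists>C\<subseteq>X. cycle_edges G C) \<longleftrightarrow> (\<exists>Y\<subseteq>X. Y \<in> cycles (medges G) \<D> \<and> Y \<noteq> {})" if "X \<subseteq> medges G" for X
  proof
    assume "\<exists>C\<subseteq>X. cycle_edges G C"
    then obtain C where C: "C \<subseteq> X" "cycle_edges G C" by blast
    have "orth C D" if "D \<in> \<D>" for D
      using that assms(1) cycle_edges_orth_star[OF C(2)] by auto
    then have "C \<in> cycles (medges G) \<D>" using C(1) that by (auto simp: cycles_def)
    then show "\<exists>Y\<subseteq>X. Y \<in> cycles (medges G) \<D> \<and> Y \<noteq> {}"
      using C cycle_edges_nonempty by blast
  next
    assume "\<exists>Y\<subseteq>X. Y \<in> cycles (medges G) \<D> \<and> Y \<noteq> {}"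
    then show "\<exists>C\<subseteq>X. cycle_edges G C" using assms(2) by (meson order_trans)
  qed
  have "\<not> (\<exists>C\<subseteq>X. cycle_edges G C) \<longleftrightarrow> (\<forall>Y\<subseteq>X. Y \<in> cycles (medges G) \<D> \<longrightarrow> Y = {})"
    if "X \<subseteq> medges G" for X unfolding iff[OF that] by blast
  then show ?thesis
    unfolding cycle_matroid_def sp_matroid_def sp_indep_def by (simp cong: conj_cong)
qed

lemma lessThan_six: "{..<Suc (Suc (Suc (Suc (Suc (Suc 0)))))} = {0, Suc 0, 2, 3, 4, 5}"
  by auto


lemma Collect_insert_conj:
  "{e \<in> insert a B. P e} = (if P a then insert a {e \<in> B. P e} else {e \<in> B. P e})"
  by auto

lemma medges_graph_of_ends [simp]: "medges (graph_of_ends ends) = {..<length ends}"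
  and mverts_graph_of_ends [simp]: "mverts (graph_of_ends ends) = {Qu, Qv, Qw}"
  and mends_graph_of_ends [simp]: "mends (graph_of_ends ends) e = ends ! e"
  by (simp_all add: graph_of_ends_def)

lemma loop_cycle_edges:
  assumes "e < length ends" "ends ! e = {u}"
  shows "cycle_edges (graph_of_ends ends) {e}"
  using cycle_edgesI[of "[e]" "[u]" "graph_of_ends ends"] assms by (cases u) auto

lemma parallel_cycle_edges:
  assumes "e < length ends" "f < length ends" "e \<noteq> f" "u \<noteq> v" "ends ! e = {u, v}" "ends ! f = {u, v}"
  shows "cycle_edges (graph_of_ends ends) {e, f}"
proof -
  have "cycle_edges (graph_of_ends ends) (set [e, f])"
  proof (rule cycle_edgesI[of _ "[u, v]"])
    show "set [u, v] \<subseteq> mverts (graph_of_ends ends)" by (cases u; cases v) auto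
    fix i assume "i < length [e, f]"
    then have "i = 0 \<or> i = 1" by auto
    then show "mends (graph_of_ends ends) ([e, f] ! i) = {[u, v] ! i, [u, v] ! (Suc i mod length [e, f])}"
      using assms(5,6) by (elim disjE) (simp_all add: insert_commute)
  qed (use assms(1-4) in auto)
  then show ?thesis by simp
qed

lemma triangle_cycle_edges:
  assumes "d < length ends" "e < length ends" "f < length ends"
    "ends ! d = {Qu, Qv}" "ends ! e = {Qv, Qw}" "ends ! f = {Qu, Qw}"
  shows "cycle_edges (graph_of_ends ends) {d, e, f}"
proof -
  have "cycle_edges (graph_of_ends ends) (set [d, e, f])"
  proof (rule cycle_edgesI[of _ "[Qu, Qv, Qw]"])
    show "distinct [d, e, f]" using assms(4-6) by (auto simp: doubleton_eq_iff)
    fix i assume "i < length [d, e, f]"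
    then have "i = 0 \<or> i = 1 \<or> i = 2" by auto
    then show "mends (graph_of_ends ends) ([d, e, f] ! i) =
        {[Qu, Qv, Qw] ! i, [Qu, Qv, Qw] ! (Suc i mod length [d, e, f])}"
      using assms(4-6) by (elim disjE) (simp_all add: numeral_2_eq_2 insert_commute)
  qed (use assms(1-3) in auto)
  then show ?thesis by simp
qed

lemma cycle_matroid_Q2:
  "cycle_matroid Q2 = sp_matroid {0, 1, 2, 3, 4, 5} {{}, {0, 1, 4}, {2, 3, 4}, {0, 1, 2, 3}}"
proof -
  let ?D = "{{}, {0, 1, 4}, {2, 3, 4}, {0, 1, 2, 3}} :: nat set set"
  have edges: "medges Q2 = {0, 1, 2, 3, 4, 5}" by (simp add: Q2_def lessThan_six)
  have st: "star Q2 Qv = {0, 1, 4}" "star Q2 Qw = {2, 3, 4}" "star Q2 Qu = {0, 1, 2, 3}"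
    unfolding star_def edges Collect_insert_conj by (simp_all add: Q2_def)
  have "?D \<subseteq> {{}} \<union> range (star Q2)" unfolding st[symmetric] by blast
  moreover have "\<exists>C\<subseteq>Y. cycle_edges Q2 C" if Y: "Y \<in> cycles (medges Q2) ?D" "Y \<noteq> {}" for Y
  proof -
    have o: "4 \<in> Y \<longleftrightarrow> (0 \<in> Y) \<noteq> (1 \<in> Y)" "4 \<in> Y \<longleftrightarrow> (2 \<in> Y) \<noteq> (3 \<in> Y)"
      using Y(1) by (auto simp: cycles_def orth_commute[of Y] orth_triple)
    have cyc: "cycle_edges Q2 {5}" "cycle_edges Q2 {0, 1}" "cycle_edges Q2 {2, 3}"
      unfolding Q2_def by (rule loop_cycle_edges parallel_cycle_edges; simp)+
    have tri: "cycle_edges Q2 {i, 4, j}" if "i \<in> {0, 1}" "j \<in> {2, 3}" for i j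
      unfolding Q2_def using that by (intro triangle_cycle_edges) auto
    consider "5 \<in> Y" | "0 \<in> Y" "1 \<in> Y" | "2 \<in> Y" "3 \<in> Y" | i j where "i \<in> {0, 1}" "j \<in> {2, 3}" "{i, 4, j} \<subseteq> Y"
    proof -
      have "Y \<subseteq> {0, 1, 2, 3, 4, 5}" using Y(1) by (simp add: cycles_def edges)
      then have ne: "0 \<in> Y \<or> 1 \<in> Y \<or> 2 \<in> Y \<or> 3 \<in> Y \<or> 4 \<in> Y \<or> 5 \<in> Y" using Y(2) by blast
      show thesis
      proof (cases "5 \<in> Y \<or> (0 \<in> Y \<and> 1 \<in> Y) \<or> (2 \<in> Y \<and> 3 \<in> Y)")
        case True
        then show thesis using that(1-3) by blast
      next
        case False
        then have "4 \<in> Y" using o ne by blast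
        moreover from this have "\<exists>i\<in>{0, 1}. i \<in> Y" "\<exists>j\<in>{2, 3}. j \<in> Y" using o by blast+
        ultimately show thesis using that(4) by blast
      qed
    qed
    then show ?thesis
    proof cases
      case 1 then show ?thesis using cyc(1) by (intro exI[of _ "{5}"]) simp
    next
      case 2 then show ?thesis using cyc(2) by (intro exI[of _ "{0, 1}"]) simp
    next
      case 3 then show ?thesis using cyc(3) by (intro exI[of _ "{2, 3}"]) simp
    next
      case 4 then show ?thesis using tri by blast
    qed
  qed
  ultimately show ?thesis using cycle_matroid_eq_sp_matroid edges by metis
qed

lemma cycle_matroid_Q4:
  "cycle_matroid Q4 = sp_matroid {0, 1, 2, 3, 4, 5} {{}, {0, 1, 4, 5}, {2, 3, 4, 5}, {0, 1, 2, 3}}"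
proof -
  let ?D = "{{}, {0, 1, 4, 5}, {2, 3, 4, 5}, {0, 1, 2, 3}} :: nat set set"
  have edges: "medges Q4 = {0, 1, 2, 3, 4, 5}" by (simp add: Q4_def lessThan_six)
  have st: "star Q4 Qv = {0, 1, 4, 5}" "star Q4 Qw = {2, 3, 4, 5}" "star Q4 Qu = {0, 1, 2, 3}"
    unfolding star_def edges Collect_insert_conj by (simp_all add: Q4_def)
  have "?D \<subseteq> {{}} \<union> range (star Q4)" unfolding st[symmetric] by blast
  moreover have "\<exists>C\<subseteq>Y. cycle_edges Q4 C" if Y: "Y \<in> cycles (medges Q4) ?D" "Y \<noteq> {}" for Y
  proof -
    have o: "((0 \<in> Y) \<noteq> (1 \<in> Y)) = ((4 \<in> Y) \<noteq> (5 \<in> Y))" "((2 \<in> Y) \<noteq> (3 \<in> Y)) = ((4 \<in> Y) \<noteq> (5 \<in> Y))"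
      using Y(1) by (auto simp: cycles_def orth_commute[of Y] orth_quadruple)
    have cyc: "cycle_edges Q4 {0, 1}" "cycle_edges Q4 {2, 3}" "cycle_edges Q4 {4, 5}"
      unfolding Q4_def by (rule parallel_cycle_edges; simp)+
    have tri: "cycle_edges Q4 {i, l, j}" if "i \<in> {0, 1}" "j \<in> {2, 3}" "l \<in> {4, 5}" for i j l
      unfolding Q4_def using that by (intro triangle_cycle_edges) auto
    consider "0 \<in> Y" "1 \<in> Y" | "2 \<in> Y" "3 \<in> Y" | "4 \<in> Y" "5 \<in> Y"
      | i j l where "i \<in> {0, 1}" "j \<in> {2, 3}" "l \<in> {4, 5}" "{i, l, j} \<subseteq> Y"
    proof -
      have "Y \<subseteq> {0, 1, 2, 3, 4, 5}" using Y(1) by (simp add: cycles_def edges)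
      then have ne: "0 \<in> Y \<or> 1 \<in> Y \<or> 2 \<in> Y \<or> 3 \<in> Y \<or> 4 \<in> Y \<or> 5 \<in> Y" using Y(2) by blast
      show thesis
      proof (cases "(0 \<in> Y \<and> 1 \<in> Y) \<or> (2 \<in> Y \<and> 3 \<in> Y) \<or> (4 \<in> Y \<and> 5 \<in> Y)")
        case True
        then show thesis using that(1-3) by blast
      next
        case False
        then have "\<exists>i\<in>{0, 1}. i \<in> Y" "\<exists>j\<in>{2, 3}. j \<in> Y" "\<exists>l\<in>{4, 5}. l \<in> Y" using o ne by blast+
        then show thesis using that(4) by blast
      qed
    qed
    then show ?thesis
    proof cases
      case 1 then show ?thesis using cyc(1) by (intro exI[of _ "{0, 1}"]) simp
    next
      case 2 then show ?thesis using cyc(2) by (intro exI[of _ "{2, 3}"]) simp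
    next
      case 3 then show ?thesis using cyc(3) by (intro exI[of _ "{4, 5}"]) simp
    next
      case 4 then show ?thesis using tri by blast
    qed
  qed
  ultimately show ?thesis using cycle_matroid_eq_sp_matroid edges by metis
qed

lemma sp_matroid_iso_image:
  assumes "inj_on g E'" "\<D>' \<subseteq> Pow E'"
  shows "matroid_iso (sp_matroid (g ` E') ((\<lambda>D. g ` D) ` \<D>')) (sp_matroid E' \<D>')"
proof -
  let ?h = "inv_into E' g"
  have orth: "orth (g ` Y) (g ` D) \<longleftrightarrow> orth Y D" if "Y \<subseteq> E'" "D \<subseteq> E'" for Y D
  proof -
    have "g ` Y \<inter> g ` D = g ` (Y \<inter> D)" using inj_on_image_Int[OF assms(1) that] by simp
    moreover have "inj_on g (Y \<inter> D)" using assms(1) that by (meson inf.coboundedI1 inj_on_subset)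
    ultimately show ?thesis by (simp add: orth_def card_image)
  qed
  have cyc: "g ` Y \<in> cycles (g ` E') ((\<lambda>D. g ` D) ` \<D>') \<longleftrightarrow> Y \<in> cycles E' \<D>'" if "Y \<subseteq> E'" for Y
  proof -
    have "(\<forall>D\<in>\<D>'. orth (g ` Y) (g ` D)) \<longleftrightarrow> (\<forall>D\<in>\<D>'. orth Y D)"
      using orth[OF that] assms(2) by blast
    then show ?thesis using that by (simp add: cycles_def image_mono)
  qed
  have gh: "g ` ?h ` X = X" if "X \<subseteq> g ` E'" for X using that by (rule image_inv_into_cancel[OF refl])
  have hE: "?h ` X \<subseteq> E'" if "X \<subseteq> g ` E'" for X using that by (auto intro: inv_into_into)
  have "sp_indep (g ` E') ((\<lambda>D. g ` D) ` \<D>') X \<longleftrightarrow> sp_indep E' \<D>' (?h ` X)" if X: "X \<subseteq> g ` E'" for X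
  proof
    assume a: "sp_indep (g ` E') ((\<lambda>D. g ` D) ` \<D>') X"
    show "sp_indep E' \<D>' (?h ` X)"
    proof (rule sp_indepI[OF hE[OF X]])
      fix Y assume Y: "Y \<subseteq> ?h ` X" "Y \<in> cycles E' \<D>'"
      have "g ` Y \<subseteq> X" using image_mono[OF Y(1), of g] gh[OF X] by simp
      moreover have "g ` Y \<in> cycles (g ` E') ((\<lambda>D. g ` D) ` \<D>')"
        using cyc[of Y] Y hE[OF X] by blast
      ultimately have "g ` Y = {}" using sp_indepD[OF a] by blast
      then show "Y = {}" by simp
    qed
  next
    assume a: "sp_indep E' \<D>' (?h ` X)"
    show "sp_indep (g ` E') ((\<lambda>D. g ` D) ` \<D>') X"
    proof (rule sp_indepI[OF X])
      fix Y assume Y: "Y \<subseteq> X" "Y \<in> cycles (g ` E') ((\<lambda>D. g ` D) ` \<D>')"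
      have YE: "Y \<subseteq> g ` E'" using Y(1) X by blast
      then have "?h ` Y \<in> cycles E' \<D>'" using cyc[OF hE[OF YE]] gh[OF YE] Y(2) by simp
      then have "?h ` Y = {}" using sp_indepD[OF a image_mono[OF Y(1)]] by blast
      then show "Y = {}" by simp
    qed
  qed
  moreover have "bij_betw ?h (g ` E') E'" using assms(1) by (intro bij_betw_inv_into) (simp add: inj_on_imp_bij_betw)
  ultimately show ?thesis unfolding matroid_iso_def by (intro exI[of _ ?h]) simp
qed

lemma iso_Q2:
  assumes "distinct [e0, e1, e2, e3, e4, e5]" "S = {e0, e1, e2, e3, e4, e5}"
    and "\<N> = {{}, {e0, e1, e4}, {e2, e3, e4}, {e0, e1, e2, e3}}"
  shows "matroid_iso (sp_matroid S \<N>) (cycle_matroid Q2)"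
proof -
  let ?g = "\<lambda>i. [e0, e1, e2, e3, e4, e5] ! i"
  have inj: "inj_on ?g {0, 1, 2, 3, 4, 5}" using assms(1) by (auto simp: inj_on_def)
  have S_eq: "S = ?g ` {0, 1, 2, 3, 4, 5}" using assms(2) by simp
  have N_eq: "\<N> = (\<lambda>D. ?g ` D) ` {{}, {0, 1, 4}, {2, 3, 4}, {0, 1, 2, 3}}" using assms(3) by simp
  show ?thesis
    unfolding cycle_matroid_Q2 S_eq N_eq by (rule sp_matroid_iso_image[OF inj]) simp
qed

lemma iso_Q4:
  assumes "distinct [e0, e1, e2, e3, e4, e5]" "S = {e0, e1, e2, e3, e4, e5}"
    and "\<N> = {{}, {e0, e1, e4, e5}, {e2, e3, e4, e5}, {e0, e1, e2, e3}}"
  shows "matroid_iso (sp_matroid S \<N>) (cycle_matroid Q4)"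
proof -
  let ?g = "\<lambda>i. [e0, e1, e2, e3, e4, e5] ! i"
  have inj: "inj_on ?g {0, 1, 2, 3, 4, 5}" using assms(1) by (auto simp: inj_on_def)
  have S_eq: "S = ?g ` {0, 1, 2, 3, 4, 5}" using assms(2) by simp
  have N_eq: "\<N> = (\<lambda>D. ?g ` D) ` {{}, {0, 1, 4, 5}, {2, 3, 4, 5}, {0, 1, 2, 3}}" using assms(3) by simp
  show ?thesis
    unfolding cycle_matroid_Q4 S_eq N_eq by (rule sp_matroid_iso_image[OF inj]) simp
qed


section \<open>Projections of M(K4)\<close>

text \<open>
  A subspace of codimension one is the kernel of a linear functional on the cocycles, which is
  determined by its values on the three generators \<open>{a, x, z}\<close>, \<open>{b, x, y}\<close>, \<open>{c, y, z}\<close>. The seven nonzero functionals are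
  the seven points of the Fano plane.
\<close>

lemma K4_hyperplane:
  assumes dist: "distinct [a, b, c, x, y, z]" and S: "S = {a, b, c, x, y, z}"
    and sub: "\<N> \<subset> K4_cocycles a b c x y z" and "{} \<in> \<N>"
    and add: "\<And>A B. A \<in> K4_cocycles a b c x y z \<Longrightarrow> B \<in> K4_cocycles a b c x y z \<Longrightarrow>
      A \<triangle> B \<in> \<N> \<longleftrightarrow> (A \<in> \<N> \<longleftrightarrow> B \<in> \<N>)"
  shows "\<exists>Q\<in>{Q2, Q4}. matroid_iso (sp_matroid S \<N>) (cycle_matroid Q)"
proof -
  let ?K = "K4_cocycles a b c x y z"
  have ne: "distinct [z, y, x, c, b, a]" using dist by auto
  have K: "{a, x, z} \<in> ?K" "{b, x, y} \<in> ?K" "{c, y, z} \<in> ?K" "{a, b, y, z} \<in> ?K"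
    "{a, c, x, y} \<in> ?K" "{b, c, x, z} \<in> ?K" "{a, b, c} \<in> ?K"
    by (simp_all add: K4_cocycles_def)
  have sums: "{a, x, z} \<triangle> {b, x, y} = {a, b, y, z}" "{a, x, z} \<triangle> {c, y, z} = {a, c, x, y}"
    "{b, x, y} \<triangle> {c, y, z} = {b, c, x, z}" "{a, b, y, z} \<triangle> {c, y, z} = {a, b, c}"
    using dist ne by auto
  have m: "{a, b, y, z} \<in> \<N> \<longleftrightarrow> ({a, x, z} \<in> \<N> \<longleftrightarrow> {b, x, y} \<in> \<N>)"
    "{a, c, x, y} \<in> \<N> \<longleftrightarrow> ({a, x, z} \<in> \<N> \<longleftrightarrow> {c, y, z} \<in> \<N>)"
    "{b, c, x, z} \<in> \<N> \<longleftrightarrow> ({b, x, y} \<in> \<N> \<longleftrightarrow> {c, y, z} \<in> \<N>)"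
    "{a, b, c} \<in> \<N> \<longleftrightarrow> ({a, b, y, z} \<in> \<N> \<longleftrightarrow> {c, y, z} \<in> \<N>)"
    using add[OF K(1) K(2)] add[OF K(1) K(3)] add[OF K(2) K(3)] add[OF K(4) K(3)] unfolding sums by blast+
  have "\<N> = {D \<in> ?K. D \<in> \<N>}" using sub by blast
  note eq = this[unfolded K4_cocycles_def Collect_insert_conj]
  \<comment> \<open>The orders in which the elements correspond to the edges of \<open>Q2\<close> (the last one being the loop)
    and of \<open>Q4\<close>.\<close>
  have comm: "S = {b, x, c, z, y, a}" "S = {a, x, c, y, z, b}" "S = {a, z, b, y, x, c}"
    "S = {y, z, a, b, c, x}" "S = {x, z, b, c, a, y}" "S = {x, y, a, c, b, z}" "S = {a, y, c, x, b, z}"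
    unfolding S by (simp_all add: insert_commute)
  consider "{a, x, z} \<in> \<N>" "{b, x, y} \<in> \<N>" "{c, y, z} \<in> \<N>" | "{a, x, z} \<notin> \<N>" "{b, x, y} \<in> \<N>" "{c, y, z} \<in> \<N>"
    | "{a, x, z} \<in> \<N>" "{b, x, y} \<notin> \<N>" "{c, y, z} \<in> \<N>" | "{a, x, z} \<in> \<N>" "{b, x, y} \<in> \<N>" "{c, y, z} \<notin> \<N>"
    | "{a, x, z} \<notin> \<N>" "{b, x, y} \<notin> \<N>" "{c, y, z} \<in> \<N>" | "{a, x, z} \<in> \<N>" "{b, x, y} \<notin> \<N>" "{c, y, z} \<notin> \<N>"
    | "{a, x, z} \<notin> \<N>" "{b, x, y} \<in> \<N>" "{c, y, z} \<notin> \<N>" | "{a, x, z} \<notin> \<N>" "{b, x, y} \<notin> \<N>" "{c, y, z} \<notin> \<N>"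
    by blast
  then show ?thesis
  proof cases
    case 1
    then have "\<N> = ?K"
      unfolding K4_cocycles_def by (subst eq) (simp add: m \<open>{} \<in> \<N>\<close>)
    then show ?thesis using sub by blast
  next
    case 2
    have "\<N> = {{}, {b, x, y}, {c, z, y}, {b, x, c, z}}"
      by (subst eq) (simp add: 2 m \<open>{} \<in> \<N>\<close> insert_commute)
    then show ?thesis using iso_Q2[OF _ comm(1)] dist ne by simp
  next
    case 3
    have "\<N> = {{}, {a, x, z}, {c, y, z}, {a, x, c, y}}"
      by (subst eq) (simp add: 3 m \<open>{} \<in> \<N>\<close> insert_commute)
    then show ?thesis using iso_Q2[OF _ comm(2)] dist ne by simp
  next
    case 4
    have "\<N> = {{}, {a, z, x}, {b, y, x}, {a, z, b, y}}"
      by (subst eq) (simp add: 4 m \<open>{} \<in> \<N>\<close> insert_commute)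
    then show ?thesis using iso_Q2[OF _ comm(3)] dist ne by simp
  next
    case 5
    have "\<N> = {{}, {y, z, c}, {a, b, c}, {y, z, a, b}}"
      by (subst eq) (simp add: 5 m \<open>{} \<in> \<N>\<close> insert_commute)
    then show ?thesis using iso_Q2[OF _ comm(4)] dist ne by simp
  next
    case 6
    have "\<N> = {{}, {x, z, a}, {b, c, a}, {x, z, b, c}}"
      by (subst eq) (simp add: 6 m \<open>{} \<in> \<N>\<close> insert_commute)
    then show ?thesis using iso_Q2[OF _ comm(5)] dist ne by simp
  next
    case 7
    have "\<N> = {{}, {x, y, b}, {a, c, b}, {x, y, a, c}}"
      by (subst eq) (simp add: 7 m \<open>{} \<in> \<N>\<close> insert_commute)
    then show ?thesis using iso_Q2[OF _ comm(6)] dist ne by simp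
  next
    case 8
    have "\<N> = {{}, {a, y, b, z}, {c, x, b, z}, {a, y, c, x}}"
      by (subst eq) (simp add: 8 m \<open>{} \<in> \<N>\<close> insert_commute)
    then show ?thesis using iso_Q4[OF _ comm(7)] dist ne by simp
  qed
qed

text \<open>
  Two vectors outside a subspace of codimension one differ by a vector of the subspace.
\<close>

lemma sminor_adjoin_vector_hyperplane:
  assumes "bspace E \<D>" "A \<in> sminor (adjoin_vector \<D> H) C S" "B \<in> sminor (adjoin_vector \<D> H) C S"
  shows "A \<triangle> B \<in> sminor \<D> C S \<or> A \<in> sminor \<D> C S \<or> B \<in> sminor \<D> C S"
proof -
  obtain A' where A: "A' \<in> adjoin_vector \<D> H" "A = A' \<inter> S" "A' \<inter> C = {}" using assms(2) by (auto simp: sminor_def)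
  obtain B' where B: "B' \<in> adjoin_vector \<D> H" "B = B' \<inter> S" "B' \<inter> C = {}" using assms(3) by (auto simp: sminor_def)
  have "A' \<triangle> B' \<in> \<D> \<or> A' \<in> \<D> \<or> B' \<in> \<D>"
  proof -
    have "(X \<triangle> H) \<triangle> (Y \<triangle> H) = X \<triangle> Y" for X Y by auto
    then show ?thesis using A(1) B(1) bspaceD(3)[OF assms(1)] unfolding adjoin_vector_def by (smt (verit) Un_iff image_iff)
  qed
  moreover have "A \<triangle> B = (A' \<triangle> B') \<inter> S" "(A' \<triangle> B') \<inter> C = {}" using A B by auto
  ultimately show ?thesis using A B unfolding sminor_def by blast
qed

text \<open>
  Apply to \<open>\<D>\<close> the contraction and the deletion that lead to \<open>M(K\<^sub>4)\<close> after adjoining \<open>H\<close>. The result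
  has codimension at most one in the cocycle space of \<open>K\<^sub>4\<close>, and exactly one because \<open>\<D>\<close> has no
  \<open>M(K\<^sub>4)\<close>-minor.
\<close>

lemma Q_minor_if_adjoin_vector_K4:
  assumes "finite E" "bspace E \<D>" "H \<subseteq> E" "has_K4 E (adjoin_vector \<D> H)" "\<not> has_K4 E \<D>"
  shows "\<exists>P. minor P (sp_matroid E \<D>) \<and> (\<exists>Q\<in>{Q2, Q4}. matroid_iso P (cycle_matroid Q))"
proof -
  obtain C a b c x y z where dist: "distinct [a, b, c, x, y, z]" and SE: "{a, b, c, x, y, z} \<subseteq> E"
    and C: "C \<subseteq> E" "C \<inter> {a, b, c, x, y, z} = {}"
    and K: "sminor (adjoin_vector \<D> H) C {a, b, c, x, y, z} = K4_cocycles a b c x y z"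
    using assms(4) by (rule has_K4E)
  define S where "S = {a, b, c, x, y, z}"
  note K' = K[folded S_def]
  let ?N = "sminor \<D> C S"
  have bN: "bspace S ?N" by (rule sminor_bspace[OF assms(2)])
  have "?N \<subseteq> K4_cocycles a b c x y z"
    unfolding K'[symmetric] by (auto simp: sminor_def adjoin_vector_def)
  moreover have "?N \<noteq> K4_cocycles a b c x y z"
    using has_K4I[OF dist SE C] assms(5) unfolding S_def by blast
  ultimately have sub: "?N \<subset> K4_cocycles a b c x y z" by blast
  have add: "A \<triangle> B \<in> ?N \<longleftrightarrow> (A \<in> ?N \<longleftrightarrow> B \<in> ?N)"
    if "A \<in> K4_cocycles a b c x y z" "B \<in> K4_cocycles a b c x y z" for A B
  proof -
    have "(A \<triangle> B) \<triangle> B = A" "(A \<triangle> B) \<triangle> A = B" by auto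
    then show ?thesis
      using sminor_adjoin_vector_hyperplane[OF assms(2), of A H C S B] that bspaceD(3)[OF bN] K' by metis
  qed
  have "\<exists>Q\<in>{Q2, Q4}. matroid_iso (sp_matroid S ?N) (cycle_matroid Q)"
    using K4_hyperplane[OF dist S_def sub bspaceD(2)[OF bN] add] by blast
  moreover have "minor (sp_matroid S ?N) (sp_matroid E \<D>)"
    by (rule sp_matroid_minor[OF assms(1,2) C(1)]) (use SE C(2) in \<open>simp_all add: S_def\<close>)
  ultimately show ?thesis by blast
qed

section \<open>Splitting a binary gammoid\<close>

theorem theorem1p4:
  fixes k :: nat and M :: "'a pre_matroid"
  assumes "k \<ge> 2"
    and "binary_gammoid M"
    and "M \<in> split_class k"
  shows "\<exists>P. minor P M \<and>
    ((\<exists>L N :: 'a pre_matroid.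
        minimal_minor (k - 1) L \<and> extension_by 1 N L \<and> matroid_iso P N) \<or>
     (\<exists>Q \<in> {Q2, Q3, Q4}.
        matroid_iso P (cycle_matroid Q) \<or>
        (\<exists>m \<le> k. \<exists>N :: nat pre_matroid.
           extension_by m N (cycle_matroid Q) \<and> matroid_iso P N)))"
proof -
  obtain H where H: "H \<subseteq> ground M" "\<not> binary_gammoid (splitting M H)"
    using assms(3) unfolding split_class_def by blast
  have M: "gammoid M" "binary M" using assms(2) by (simp_all add: binary_gammoid_def)
  obtain r A where rep: "represents r A M" using M(2) unfolding binary_def by blast
  define E where "E = ground M"
  define \<D> where "\<D> = row_space E A r"
  have fin: "finite E" using M(2) by (simp add: binary_def E_def matroid.finite_ground)
  have bs: "bspace E \<D>" unfolding \<D>_def by (rule row_space_bspace)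
  have HE: "H \<subseteq> E" using H(1) by (simp add: E_def)
  have M_eq: "M = sp_matroid E \<D>"
    using rep vector_matroid_eq_sp_matroid[OF fin, of r A] unfolding represents_def E_def \<D>_def by simp
  have noK4: "\<not> has_K4 E \<D>" using no_K4_if_gammoid[OF fin bs] M(1) M_eq by simp
  have bs': "bspace E (adjoin_vector \<D> H)" by (rule adjoin_vector_bspace[OF bs HE])
  have split: "splitting M H = sp_matroid E (adjoin_vector \<D> H)"
    using splitting_eq_sp_matroid[OF _ rep H(1)] fin by (simp add: E_def \<D>_def)
  have "represents (Suc r) (adjoin_row r A H) (splitting M H)"
    using splitting_eq[OF _ rep, of H] fin by (simp add: represents_def E_def vector_matroid_def)
  then have "binary (splitting M H)"
    unfolding binary_def split using sp_matroid_matroid[OF fin bs'] by blast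
  then have "\<not> gammoid (sp_matroid E (adjoin_vector \<D> H))"
    using H(2) split by (simp add: binary_gammoid_def)
  then have "has_K4 E (adjoin_vector \<D> H)" using gammoid_if_no_K4[OF fin bs'] by blast
  then obtain P Q where "minor P M" "Q \<in> {Q2, Q4}" "matroid_iso P (cycle_matroid Q)"
    using Q_minor_if_adjoin_vector_K4[OF fin bs HE _ noK4] M_eq by blast
  then show ?thesis by blast
qed

end
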